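(* Let $n,m\ge 1$ and, for $h=1,\dots,n+m$, let $K_h=[a_h,b_h]$ and let $f_h\colon K_h\to[0,\infty)$ be Lipschitz continuous and concave with $f_h(a_h)=f_h(b_h)=0$, and such that $\sum_{i=1}^n f_i(0)-\sum_{j=n+1}^{n+m}f_j(0)=0$. Let $\hat\eta_h\colon\mathbb R\to\mathbb R$ be convex and let $\Pi^M$, $M\in\mathbb R$, be priority functions for $(\hat\eta_h)_h$. Then solutions $(\rho_h)_h$ to the generalized Cauchy problem are unique. Moreover, if $(\rho_h^s)_h$ are solutions with initial data $\rho_{0,h}^s\in L^1(\Omega_h,K_h)$, $s=1,2$, then $$\sum_{h=1}^{n+m}\int_{\Omega_h}|\rho_h^1(T,x)-\rho_h^2(T,x)|\,\mathrm dx\le\sum_{h=1}^{n+m}\int_{\Omega_h}|\rho_{0,h}^1(x)-\rho_{0,h}^2(x)|\,\mathrm dx\qquad\text{for every }T\ge0.$$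
   Context: **Network.** Roads $h=i\in\{1,\dots,n\}$ are incoming, with $\Omega_h=(-\infty,0)$; roads $h=j\in\{n+1,\dots,n+m\}$ are outgoing, with $\Omega_h=(0,\infty)$; the junction is $x=0$. Each $f_h$ is extended by $0$ to $\mathbb R\setminus K_h$; monotone representatives of $f_h'$ and of derivatives of convex functions are used. $L^1(\Omega_h,K_h)$ is the set of $L^1$ functions on $\Omega_h$ with values a.e. in $K_h$. **Entropies.** An entropy pair $(\eta_h,G_h)$ on road $h$ consists of a convex $\eta_h\colon\mathbb R\to\mathbb R$ and an entropy flux $G_h$ with $G_h'=\eta_h'f_h'$ a.e. **Priority functions.** With the convention $\hat\eta_h'(a_h-)=-\infty$, $\hat\eta_h'(b_h+)=+\infty$, priority functions are families $\Pi^M=(\Pi^M_1,\dots,\Pi^M_{n+m})$, $M\in\mathbb R$, such that each $\Pi_h^M\colon[0,1]\to\{\rho\in K_h:\hat\eta_h'(\rho-)\le M\le\hat\eta_h'(\rho+)\}$ is non-decreasing and surjective. **Riemann solver.** Given constants $\rho_{0,h}\in K_h$, choose $M\in\mathbb R$, $z\in[0,1]$ (the same for all $h$) and $\hat\rho_h=\Pi^M_h(z)$ such that, if $\rho_h$ is the weak entropy solution on $(0,\infty)\times\mathbb R$ of the standard Riemann problem $\partial_t\rho_h+\partial_xf_h(\rho_h)=0$ with $\rho_h(0,x)=\rho_{0,h}$ for $x\in\Omega_h$ and $\rho_h(0,x)=\hat\rho_h$ for $x\notin\Omega_h$, then $\sum_{i=1}^nf_i(\rho_i(t,0))-\sum_{j=n+1}^{n+m}f_j(\rho_j(t,0))=0$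 (the flux of $\rho_h$ at $x=0$ is the same from both sides). The restrictions of $\rho_h$ to $\Omega_h$ exist and are unique, and $\mathcal{RP}(\rho_0)=(\rho_1(t,0-),\dots,\rho_n(t,0-),\rho_{n+1}(t,0+),\dots,\rho_{n+m}(t,0+))$. **Generalized Cauchy problem.** $(\rho_1,\dots,\rho_{n+m})$ with $\rho_h\colon(0,\infty)_t\times\Omega_h\to K_h$ is a solution with initial data $\rho_{0,h}\in L^1(\Omega_h,K_h)$ if: (1) for every $h$, every entropy pair $(\eta_h,G_h)$ and every $\phi\in C_c^\infty(\mathbb R_t\times\Omega_h)$, $\phi\ge0$, one has $\iint_{(0,\infty)\times\Omega_h}\eta_h(\rho_h)\partial_t\phi+G_h(\rho_h)\partial_x\phi\,\mathrm dt\,\mathrm dx+\int_{\Omega_h}\eta_h(\rho_{0,h}(x))\phi(0,x)\,\mathrm dx\ge0$; (2) there are traces $\rho_h(\cdot,0)\in L^\infty((0,\infty),K_h)$ such that $G_h(\rho_h(\cdot,x))\to G_h(\rho_h(\cdot,0))$ in $L^1_{\mathrm{loc}}((0,\infty)_t)$ as $x\to0$, $x\in\Omega_h$, for all entropy fluxes $G_h$, and $\mathcal{RP}(\rho(t,0))=\rho(t,0)$ for a.e. $t>0$. Solutions are identified with their representative that is continuous in time with values in $L^1_{\mathrm{loc}}(\Omega_h)$. *)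

theory Defs
  imports "HOL-Analysis.Analysis"
begin

section \<open>Test functions\<close>

fun Ck :: "nat \<Rightarrow> ('a::euclidean_space \<Rightarrow> real) \<Rightarrow> bool" where
  "Ck 0 g \<longleftrightarrow> continuous_on UNIV g"
| "Ck (Suc k) g \<longleftrightarrow>
     (\<forall>p. g differentiable (at p)) \<and> (\<forall>v\<in>Basis. Ck k (\<lambda>p. frechet_derivative g (at p) v))"

definition smooth_compact_support_in :: "('a::euclidean_space) set \<Rightarrow> ('a \<Rightarrow> real) \<Rightarrow> bool" where
  "smooth_compact_support_in U \<phi> \<longleftrightarrow>
     (\<forall>k. Ck k \<phi>) \<and> compact (closure {p. \<phi> p \<noteq> 0}) \<and> closure {p. \<phi> p \<noteq> 0} \<subseteq> U"


section \<open>Entropy pairs and weak entropy solutions\<close>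

text \<open>The flux is always a function on the whole line, vanishing outside \<open>K\<close>.
  Local Lipschitz continuity of \<open>G\<close> is what makes \<open>G' = \<eta>' f'\<close> a.e. determine \<open>G\<close> up to a
  constant; it loses nothing, because \<open>\<eta>'\<close> and \<open>f'\<close> are locally bounded.  The points where
  \<open>\<eta>\<close> or \<open>f\<close> fails to be differentiable form a null set, so the choice of representatives of
  \<open>\<eta>'\<close> and \<open>f'\<close> is immaterial here.\<close>

definition entropy_pair :: "(real \<Rightarrow> real) \<Rightarrow> (real \<Rightarrow> real) \<Rightarrow> (real \<Rightarrow> real) \<Rightarrow> bool" where
  "entropy_pair f \<eta> G \<longleftrightarrow>
     convex_on UNIV \<eta> \<and>
     (\<forall>R. \<exists>L. L-lipschitz_on {-R..R} G) \<and>
     (AE u in lborel. (G has_real_derivative deriv \<eta> u * deriv f u) (at u))"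

text \<open>Elements of \<open>L\<^sup>\<infinity>\<close> and \<open>L\<^sup>1\<close> are represented by Borel functions, and time comes before space:
  \<open>\<rho> t x\<close>.  With \<open>\<Omega>\<close> a half-line this is the notion of solution inside a road, with \<open>\<Omega> = UNIV\<close>
  the standard Cauchy problem on the line.\<close>

definition entropy_solution ::
  "real set \<Rightarrow> (real \<Rightarrow> real) \<Rightarrow> real set \<Rightarrow> (real \<Rightarrow> real) \<Rightarrow> (real \<Rightarrow> real \<Rightarrow> real) \<Rightarrow> bool" where
  "entropy_solution K f \<Omega> \<rho>0 \<rho> \<longleftrightarrow>
     set_borel_measurable lborel ({0<..} \<times> \<Omega>) (\<lambda>(t, x). \<rho> t x) \<and>
     (AE (t, x) in lborel. t > 0 \<and> x \<in> \<Omega> \<longrightarrow> \<rho> t x \<in> K) \<and>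
     (\<forall>\<eta> G \<phi>. entropy_pair f \<eta> G \<longrightarrow> smooth_compact_support_in (UNIV \<times> \<Omega>) \<phi> \<longrightarrow> (\<forall>p. \<phi> p \<ge> 0) \<longrightarrow>
        set_lebesgue_integral lborel ({0<..} \<times> \<Omega>)
          (\<lambda>(t, x). \<eta> (\<rho> t x) * deriv (\<lambda>s. \<phi> (s, x)) t + G (\<rho> t x) * deriv (\<lambda>y. \<phi> (t, y)) x)
        + set_lebesgue_integral lborel \<Omega> (\<lambda>x. \<eta> (\<rho>0 x) * \<phi> (0, x)) \<ge> 0)"

definition L1_dist :: "real set \<Rightarrow> (real \<Rightarrow> real) \<Rightarrow> (real \<Rightarrow> real) \<Rightarrow> ennreal" where
  "L1_dist A u v = (\<integral>\<^sup>+x\<in>A. ennreal \<bar>u x - v x\<bar> \<partial>lborel)"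

text \<open>Since \<open>\<rho>\<close> is only determined up to null sets, limits as \<open>x \<rightarrow> 0\<close> within a road are
  essential limits, that is, limits along the following filter (neglecting a null set of \<open>x\<close>).\<close>

definition ess_at0 :: "real set \<Rightarrow> real filter" where
  "ess_at0 \<Omega> = inf (at 0 within \<Omega>) (ae_filter lborel)"


section \<open>Priority functions\<close>

definition left_deriv :: "(real \<Rightarrow> real) \<Rightarrow> real \<Rightarrow> real" where
  "left_deriv g u = (THE D. (g has_real_derivative D) (at_left u))"

definition right_deriv :: "(real \<Rightarrow> real) \<Rightarrow> real \<Rightarrow> real" where
  "right_deriv g u = (THE D. (g has_real_derivative D) (at_right u))"

definition level_set :: "real \<Rightarrow> real \<Rightarrow> (real \<Rightarrow> real) \<Rightarrow> real \<Rightarrow> real set" where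
  "level_set a b \<eta> M = {u \<in> {a..b}.
     (if u = a then -\<infinity> else ereal (left_deriv \<eta> u)) \<le> ereal M \<and>
     ereal M \<le> (if u = b then \<infinity> else ereal (right_deriv \<eta> u))}"

text \<open>\<open>\<P> M h\<close> stands for \<open>\<Pi>\<^sub>h\<^sup>M\<close>; \<open>N\<close> is the total number of roads.\<close>

definition priority_functions ::
  "nat \<Rightarrow> (nat \<Rightarrow> real) \<Rightarrow> (nat \<Rightarrow> real) \<Rightarrow> (nat \<Rightarrow> real \<Rightarrow> real)
    \<Rightarrow> (real \<Rightarrow> nat \<Rightarrow> real \<Rightarrow> real) \<Rightarrow> bool" where
  "priority_functions N a b \<eta> \<P> \<longleftrightarrow>
     (\<forall>M. \<forall>h\<in>{1..N}. mono_on {0..1} (\<P> M h) \<and> \<P> M h ` {0..1} = level_set (a h) (b h) (\<eta> h) M)"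


section \<open>The junction\<close>

definition road :: "nat \<Rightarrow> nat \<Rightarrow> real set" where
  "road n h = (if h \<le> n then {..<0} else {0<..})"

text \<open>The Riemann solver as a relation: \<open>riemann_solver n m a b f \<P> \<rho>0 \<sigma>\<close> says
  \<open>RP(\<rho>0) = \<sigma>\<close>.  The trace at the junction of the self-similar solution \<open>r h\<close> does not depend on
  time; its flux at \<open>x = 0\<close> is evaluated on the side of the road.\<close>

definition riemann_solver ::
  "nat \<Rightarrow> nat \<Rightarrow> (nat \<Rightarrow> real) \<Rightarrow> (nat \<Rightarrow> real) \<Rightarrow> (nat \<Rightarrow> real \<Rightarrow> real) \<Rightarrow> (real \<Rightarrow> nat \<Rightarrow> real \<Rightarrow> real)
    \<Rightarrow> (nat \<Rightarrow> real) \<Rightarrow> (nat \<Rightarrow> real) \<Rightarrow> bool" where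
  "riemann_solver n m a b f \<P> \<rho>0 \<sigma> \<longleftrightarrow>
     (\<forall>h\<in>{1..n+m}. \<rho>0 h \<in> {a h..b h}) \<and>
     (\<exists>M. \<exists>z\<in>{0..1}. \<exists>r.
        (\<forall>h\<in>{1..n+m}.
           entropy_solution {a h..b h} (f h) UNIV
             (\<lambda>x. if x \<in> road n h then \<rho>0 h else \<P> M h z) (r h) \<and>
           (AE t in lborel. t > 0 \<longrightarrow> (r h t \<longlongrightarrow> \<sigma> h) (ess_at0 (road n h)))) \<and>
        (\<Sum>i=1..n. f i (\<sigma> i)) - (\<Sum>j=n+1..n+m. f j (\<sigma> j)) = 0)"

definition initial_data ::
  "nat \<Rightarrow> nat \<Rightarrow> (nat \<Rightarrow> real) \<Rightarrow> (nat \<Rightarrow> real) \<Rightarrow> (nat \<Rightarrow> real \<Rightarrow> real) \<Rightarrow> bool" where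
  "initial_data n m a b \<rho>0 \<longleftrightarrow>
     (\<forall>h\<in>{1..n+m}. set_integrable lborel (road n h) (\<rho>0 h) \<and>
        (AE x in lborel. x \<in> road n h \<longrightarrow> \<rho>0 h x \<in> {a h..b h}))"

definition generalized_solution ::
  "nat \<Rightarrow> nat \<Rightarrow> (nat \<Rightarrow> real) \<Rightarrow> (nat \<Rightarrow> real) \<Rightarrow> (nat \<Rightarrow> real \<Rightarrow> real) \<Rightarrow> (real \<Rightarrow> nat \<Rightarrow> real \<Rightarrow> real)
    \<Rightarrow> (nat \<Rightarrow> real \<Rightarrow> real) \<Rightarrow> (nat \<Rightarrow> real \<Rightarrow> real \<Rightarrow> real) \<Rightarrow> bool" where
  "generalized_solution n m a b f \<P> \<rho>0 \<rho> \<longleftrightarrow>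
     (\<forall>h\<in>{1..n+m}. entropy_solution {a h..b h} (f h) (road n h) (\<rho>0 h) (\<rho> h)) \<and>
     (\<exists>\<sigma>.
        (\<forall>h\<in>{1..n+m}.
           set_borel_measurable lborel {0<..} (\<sigma> h) \<and>
           (AE t in lborel. t > 0 \<longrightarrow> \<sigma> h t \<in> {a h..b h}) \<and>
           (\<forall>\<eta> G. entropy_pair (f h) \<eta> G \<longrightarrow>
              (\<forall>c d. 0 < c \<longrightarrow> c \<le> d \<longrightarrow>
                 ((\<lambda>x. L1_dist {c..d} (\<lambda>t. G (\<rho> h t x)) (\<lambda>t. G (\<sigma> h t))) \<longlongrightarrow> 0)
                   (ess_at0 (road n h))))) \<and>
        (AE t in lborel. t > 0 \<longrightarrow>
           riemann_solver n m a b f \<P> (\<lambda>h. \<sigma> h t) (\<lambda>h. \<sigma> h t)))"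

text \<open>\<open>\<rho>\<close> is the representative that is continuous from \<open>[0,\<infinity>)\<close> to \<open>L\<^sup>1\<^sub>l\<^sub>o\<^sub>c\<close> of each road.  The
  value at time \<open>0\<close> is not prescribed separately.\<close>

definition time_continuous :: "nat \<Rightarrow> nat \<Rightarrow> (nat \<Rightarrow> real \<Rightarrow> real \<Rightarrow> real) \<Rightarrow> bool" where
  "time_continuous n m \<rho> \<longleftrightarrow>
     (\<forall>h\<in>{1..n+m}. \<forall>c d. {c..d} \<subseteq> road n h \<longrightarrow>
        (\<forall>t\<ge>0. set_integrable lborel {c..d} (\<rho> h t) \<and>
           ((\<lambda>s. L1_dist {c..d} (\<rho> h s) (\<rho> h t)) \<longlongrightarrow> 0) (at t within {0..})))"

end

(* Kruzhkov's doubling of variables gives, on every road, an inequality for the distance of two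
   solutions whose only boundary contribution at the junction is the Kruzhkov flux of the two traces.
   The weight exp (- mu x), with mu > 0, replaces a cut-off at infinity: the flux is at most L times
   the distance, so the weight costs a factor exp (L mu t), which disappears as mu tends to 0.
   At the junction, solving the Riemann problem with data (trace, Pi_h^M(z)) forces the trace to
   satisfy the Bardos-LeRoux-Nedelec condition with respect to Pi_h^M(z).  Priority functions are
   totally ordered, simultaneously on all roads, so for two solutions the exterior states are ordered
   in the same way on all roads; monotonicity of the boundary fluxes and conservation of mass then
   show that the boundary contributions sum up to something dissipative. *)
theory Submission
  imports Defs
begin

text \<open>Traces at the junction are given only for entropy fluxes
  \<open>G (\<rho> h t x)\<close>, not for the density, so the flux of two solutions does not
  obviously converge at \<open>x = 0\<close>. Concavity provides a way: if \<open>m\<close> is a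
  maximum point of the flux, then \<open>Q f u m\<close> is monotone in \<open>u\<close>, and its
  increments dominate those of \<open>Q f u v\<close> for every \<open>v\<close>. Convergence of
  this single Kruzhkov flux for each solution therefore carries over to the flux of the pair.
  Initial data enter only through the weak inequality. The doubling kernel is therefore one-sided,
  the second variables being later than the first ones and farther from the junction. All supports
  then stay inside the open road (reflected to the positive half-line), the initial term of the
  second solution vanishes, and that of the first is compared with the data by using the inequality
  of the second solution once more. Products of a function of time and a function of space suffice
  as test functions. The estimate is obtained for almost every time; continuity in time serves to
  reach every \<open>T\<close>.\<close>

section \<open>Smooth functions\<close>

lemma frechet_derivative_real:
  fixes g :: "real \<Rightarrow> real"
  assumes "(g has_real_derivative D) (at x)"
  shows "frechet_derivative g (at x) v = D * v"
  using frechet_derivative_at[OF assms[unfolded has_field_derivative_def]] by (metis)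

text \<open>Reduces the recursion over Frechet derivatives and basis vectors to an ordinary
  derivative, so that the closure properties below are inductions in which only a derivative has to
  be named.\<close>

lemma Ck_Suc_real_iff:
  fixes g :: "real \<Rightarrow> real"
  shows "Ck (Suc k) g \<longleftrightarrow> (\<exists>g'. (\<forall>x. (g has_real_derivative g' x) (at x)) \<and> Ck k g')"
proof
  assume g: "Ck (Suc k) g"
  then have "g differentiable (at x)" for x by simp
  then have "(g has_real_derivative deriv g x) (at x)" for x
    by (simp add: DERIV_deriv_iff_real_differentiable)
  moreover have "Ck k (\<lambda>p. frechet_derivative g (at p) 1)"
    using g by simp
  moreover have "(\<lambda>p. frechet_derivative g (at p) 1) = deriv g"
    using frechet_derivative_real[OF calculation(1)] by auto
  ultimately show "\<exists>g'. (\<forall>x. (g has_real_derivative g' x) (at x)) \<and> Ck k g'"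
    by metis
next
  assume "\<exists>g'. (\<forall>x. (g has_real_derivative g' x) (at x)) \<and> Ck k g'"
  then obtain g' where g': "\<And>x. (g has_real_derivative g' x) (at x)" "Ck k g'" by blast
  have "(\<lambda>p. frechet_derivative g (at p) 1) = g'"
    using frechet_derivative_real[OF g'(1)] by auto
  then show "Ck (Suc k) g"
    using g' by (auto simp: real_differentiable_def)
qed

lemma Ck_SucI:
  fixes g :: "real \<Rightarrow> real"
  shows "(\<And>x. (g has_real_derivative g' x) (at x)) \<Longrightarrow> Ck k g' \<Longrightarrow> Ck (Suc k) g"
  using Ck_Suc_real_iff by blast

lemma Ck_SucE:
  fixes g :: "real \<Rightarrow> real"
  assumes "Ck (Suc k) g"
  obtains g' where "\<And>x. (g has_real_derivative g' x) (at x)" "Ck k g'"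
  using assms Ck_Suc_real_iff by blast

lemma Ck_Suc_imp_Ck:
  fixes g :: "real \<Rightarrow> real"
  shows "Ck (Suc k) g \<Longrightarrow> Ck k g"
proof (induction k arbitrary: g)
  case 0
  then show ?case
    by (auto elim!: Ck_SucE intro!: continuous_at_imp_continuous_on DERIV_isCont simp del: Ck.simps(2))
next
  case (Suc k)
  from Suc.prems obtain g' where "\<And>x. (g has_real_derivative g' x) (at x)" "Ck (Suc k) g'"
    using Ck_SucE by blast
  then show ?case using Suc.IH Ck_SucI by blast
qed

lemma Ck_const: "Ck k (\<lambda>x::real. c::real)"
proof (induction k arbitrary: c)
  case (Suc k)
  show ?case by (rule Ck_SucI[where g'="\<lambda>_. 0"]) (auto intro: Suc simp del: Ck.simps)
qed simp

lemma Ck_add: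
  fixes f g :: "real \<Rightarrow> real"
  shows "Ck k f \<Longrightarrow> Ck k g \<Longrightarrow> Ck k (\<lambda>x. f x + g x)"
proof (induction k arbitrary: f g)
  case 0 then show ?case by (auto intro: continuous_on_add)
next
  case (Suc k)
  obtain f' where f': "\<And>x. (f has_real_derivative f' x) (at x)" "Ck k f'" using Suc.prems Ck_SucE by metis
  obtain g' where g': "\<And>x. (g has_real_derivative g' x) (at x)" "Ck k g'" using Suc.prems Ck_SucE by metis
  show ?case
    by (rule Ck_SucI[where g'="\<lambda>x. f' x + g' x"])
      (auto intro!: Suc.IH f' g' derivative_eq_intros simp del: Ck.simps)
qed

lemma Ck_mult:
  fixes f g :: "real \<Rightarrow> real"
  shows "Ck k f \<Longrightarrow> Ck k g \<Longrightarrow> Ck k (\<lambda>x. f x * g x)"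
proof (induction k arbitrary: f g)
  case 0 then show ?case by (auto intro: continuous_on_mult)
next
  case (Suc k)
  obtain f' where f': "\<And>x. (f has_real_derivative f' x) (at x)" "Ck k f'" using Suc.prems Ck_SucE by metis
  obtain g' where g': "\<And>x. (g has_real_derivative g' x) (at x)" "Ck k g'" using Suc.prems Ck_SucE by metis
  have "Ck k f" "Ck k g" using Suc.prems Ck_Suc_imp_Ck by blast+
  then show ?case
    by (intro Ck_SucI[where g'="\<lambda>x. f' x * g x + f x * g' x"] Ck_add Suc.IH f' g')
      (auto intro!: f' g' derivative_eq_intros simp del: Ck.simps)
qed

lemma Ck_affine:
  fixes f :: "real \<Rightarrow> real"
  shows "Ck k f \<Longrightarrow> Ck k (\<lambda>x. f (c * x + d))"
proof (induction k arbitrary: f)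
  case 0 then show ?case by (auto intro!: continuous_intros continuous_on_compose2[of UNIV f])
next
  case (Suc k)
  obtain f' where f': "\<And>x. (f has_real_derivative f' x) (at x)" "Ck k f'" using Suc.prems Ck_SucE by metis
  have "((\<lambda>x. f (c * x + d)) has_real_derivative f' (c * x + d) * c) (at x)" for x
    by (rule DERIV_chain2[OF f'(1)]) (auto intro!: derivative_eq_intros)
  then show ?case
    by (rule Ck_SucI[OF _ Ck_mult[OF Suc.IH[OF f'(2)] Ck_const]])
qed

lemma Ck_exp: "Ck k (\<lambda>x::real. exp (c * x))"
proof (induction k)
  case 0 then show ?case by (auto intro!: continuous_intros)
next
  case (Suc k)
  show ?case
    by (rule Ck_SucI[where g'="\<lambda>x. c * exp (c * x)"])
      (auto intro!: Suc.IH Ck_mult Ck_const derivative_eq_intros simp del: Ck.simps)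
qed

text \<open>Both partial derivatives of a product in separated variables are again such products,
  which closes the induction. Test functions on the plane are only ever built in this form.\<close>

lemma Ck_tensor:
  fixes f g :: "real \<Rightarrow> real"
  shows "Ck k f \<Longrightarrow> Ck k g \<Longrightarrow> Ck k (\<lambda>p. f (fst p) * g (snd p))"
proof (induction k arbitrary: f g)
  case 0 then show ?case
    by (auto intro!: continuous_intros continuous_on_compose2[of UNIV f] continuous_on_compose2[of UNIV g])
next
  case (Suc k)
  obtain f' where f': "\<And>x. (f has_real_derivative f' x) (at x)" "Ck k f'" using Suc.prems Ck_SucE by metis
  obtain g' where g': "\<And>x. (g has_real_derivative g' x) (at x)" "Ck k g'" using Suc.prems Ck_SucE by metis
  have D: "((\<lambda>p. f (fst p) * g (snd p)) has_derivative
      (\<lambda>v. f' (fst p) * fst v * g (snd p) + f (fst p) * (g' (snd p) * snd v))) (at p)" for p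
  proof -
    have 1: "((\<lambda>p. f (fst p)) has_derivative (\<lambda>v. f' (fst p) * fst v)) (at p)"
      using has_derivative_compose[OF has_derivative_fst[OF has_derivative_ident] f'(1)[unfolded has_field_derivative_def]] .
    have 2: "((\<lambda>p. g (snd p)) has_derivative (\<lambda>v. g' (snd p) * snd v)) (at p)"
      using has_derivative_compose[OF has_derivative_snd[OF has_derivative_ident] g'(1)[unfolded has_field_derivative_def]] .
    show ?thesis
      by (rule has_derivative_eq_rhs[OF has_derivative_mult[OF 1 2]]) (auto simp: algebra_simps)
  qed
  have F: "frechet_derivative (\<lambda>p. f (fst p) * g (snd p)) (at p) =
     (\<lambda>v. f' (fst p) * fst v * g (snd p) + f (fst p) * (g' (snd p) * snd v))" for p
    using frechet_derivative_at[OF D] by simp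
  have diff: "(\<lambda>p. f (fst p) * g (snd p)) differentiable (at p)" for p
    using D differentiable_def by blast
  have "Ck k (\<lambda>p. f' (fst p) * g (snd p))" "Ck k (\<lambda>p. f (fst p) * g' (snd p))"
    using Suc.IH[OF f'(2) Ck_Suc_imp_Ck] Suc.IH[OF Ck_Suc_imp_Ck g'(2)] Suc.prems by blast+
  then have "Ck k (\<lambda>p. f' (fst p) * fst v * g (snd p) + f (fst p) * (g' (snd p) * snd v))"
    if "v \<in> Basis" for v
    using that by (auto simp: Basis_prod_def)
  then show ?case
    using diff by (simp add: F)
qed

section \<open>A smooth step and a one-sided mollifier\<close>

definition flat_poly :: "real poly \<Rightarrow> real \<Rightarrow> real" where
  "flat_poly p x = (if x > 0 then poly p (1 / x) * exp (- 1 / x) else 0)"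

lemma poly_exp_decay: "((\<lambda>y::real. poly p y * exp (- y)) \<longlongrightarrow> 0) at_top"
proof -
  have "((\<lambda>y::real. coeff p i * (y ^ i / exp y)) \<longlongrightarrow> coeff p i * 0) at_top" for i
    by (intro tendsto_intros tendsto_power_div_exp_0)
  then have "((\<lambda>y::real. \<Sum>i\<le>degree p. coeff p i * (y ^ i / exp y)) \<longlongrightarrow> (\<Sum>i\<le>degree p. coeff p i * 0)) at_top"
    by (intro tendsto_sum)
  moreover have "(\<Sum>i\<le>degree p. coeff p i * (y ^ i / exp y)) = poly p y * exp (- y)" for y
    by (simp add: poly_altdef exp_minus field_simps sum_distrib_right sum_divide_distrib)
  ultimately show ?thesis by simp
qed

text \<open>With \<open>y = 1 / x\<close> one has \<open>d/dx = - y^2 d/dy\<close>, so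
  \<open>p(y) exp(-y)\<close> becomes \<open>y^2 (p - p')(y) exp(-y)\<close>;
  \<open>[:0, 0, 1:]\<close> is the polynomial \<open>y^2\<close>. The family is thus closed under
  differentiation, and smoothness follows for all members at once.\<close>

lemma flat_poly_deriv:
  "(flat_poly p has_real_derivative flat_poly ([:0, 0, 1:] * (p - pderiv p)) x) (at x)"
proof -
  consider "x > 0" | "x < 0" | "x = 0" by linarith
  then show ?thesis
  proof cases
    case 1
    have "((\<lambda>x. poly p (1 / x) * exp (- 1 / x)) has_real_derivative
        flat_poly ([:0, 0, 1:] * (p - pderiv p)) x) (at x)"
      using 1 by (auto intro!: derivative_eq_intros DERIV_chain2[OF poly_DERIV]
          simp: flat_poly_def power2_eq_square field_simps)
    then show ?thesis
      by (rule has_field_derivative_transform_within[where d=x])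
        (use 1 in \<open>auto simp: flat_poly_def dist_real_def\<close>)
  next
    case 2
    have "((\<lambda>x. 0) has_real_derivative flat_poly ([:0, 0, 1:] * (p - pderiv p)) x) (at x)"
      using 2 by (auto simp: flat_poly_def)
    then show ?thesis
      by (rule has_field_derivative_transform_within[where d="-x"])
        (use 2 in \<open>auto simp: flat_poly_def dist_real_def\<close>)
  next
    case 3
    have "((\<lambda>h. (flat_poly p h - flat_poly p 0) / (h - 0)) \<longlongrightarrow> 0) (at 0)"
    proof (rule filterlim_split_at)
      show "((\<lambda>h. (flat_poly p h - flat_poly p 0) / (h - 0)) \<longlongrightarrow> 0) (at_left 0)"
        by (rule tendsto_eventually) (auto simp: flat_poly_def eventually_at_filter)
      \<comment> \<open>The difference quotient at 0 has one more factor \<open>1 / h\<close>;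
        multiplying \<open>p\<close> by \<open>[:0, 1:]\<close> absorbs it into the
        polynomial.\<close>
      have "((\<lambda>h. poly ([:0,1:] * p) (inverse h) * exp (- inverse h)) \<longlongrightarrow> 0) (at_right (0::real))"
        using filterlim_compose[OF poly_exp_decay filterlim_inverse_at_top_right] .
      then show "((\<lambda>h. (flat_poly p h - flat_poly p 0) / (h - 0)) \<longlongrightarrow> 0) (at_right 0)"
        by (rule Lim_transform_eventually)
          (auto simp: flat_poly_def eventually_at_filter field_simps)
    qed
    then show ?thesis
      using 3 by (simp add: has_field_derivative_iff flat_poly_def)
  qed
qed

lemma Ck_flat_poly: "Ck k (flat_poly p)"
proof (induction k arbitrary: p)
  case 0
  show ?case
    using flat_poly_deriv by (auto intro!: continuous_at_imp_continuous_on DERIV_isCont)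
next
  case (Suc k)
  show ?case by (rule Ck_SucI[OF flat_poly_deriv Suc])
qed

text \<open>The argument \<open>1 - x\<close> is written as \<open>- 1 * x + 1\<close> so that
  \<open>Ck_affine\<close> applies to it.\<close>

definition bump :: "real \<Rightarrow> real" where
  "bump x = flat_poly 1 x * flat_poly 1 (- 1 * x + 1)"

lemma Ck_bump: "Ck k bump"
  unfolding bump_def[abs_def] by (intro Ck_mult Ck_affine Ck_flat_poly)

lemma bump_nonneg: "bump x \<ge> 0" and bump_pos_iff: "bump x > 0 \<longleftrightarrow> 0 < x \<and> x < 1"
  by (auto simp: bump_def flat_poly_def)

text \<open>A primitive of \<open>bump\<close>, shifted and scaled: it is constant outside
  \<open>[0, 1]\<close>, and its increment over \<open>[0, 1]\<close> is positive because
  \<open>bump\<close> is positive inside.\<close>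

lemma smooth_step_exists:
  "\<exists>S S' :: real \<Rightarrow> real. (\<forall>x. (S has_real_derivative S' x) (at x)) \<and> (\<forall>k. Ck k S') \<and>
     (\<forall>x. 0 \<le> S' x) \<and> (\<forall>x\<le>0. S x = 0) \<and> (\<forall>x\<ge>1. S x = 1)"
proof -
  have cont: "isCont bump x" for x
    using Ck_bump[of 0] by (simp add: continuous_on_eq_continuous_at)
  obtain F where F: "\<And>x. (F has_vector_derivative bump x) (at x)"
    using einterval_antiderivative[of "-\<infinity>" "\<infinity>" bump] cont by auto
  have F': "(F has_real_derivative bump x) (at x)" for x
    using F by (simp add: has_real_derivative_iff_has_vector_derivative)
  have b0: "bump x = 0" if "x \<le> 0 \<or> 1 \<le> x" for x
    using bump_nonneg[of x] bump_pos_iff[of x] that by linarith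
  have less: "F 0 < F 1"
    by (rule DERIV_pos_imp_increasing_open)
      (use F' bump_pos_iff in \<open>auto intro!: continuous_at_imp_continuous_on DERIV_isCont\<close>)
  have cont_F: "continuous_on A F" for A
    by (intro continuous_at_imp_continuous_on ballI DERIV_isCont[OF F'])
  have F0: "(F has_real_derivative 0) (at y)" if "y \<le> 0 \<or> 1 \<le> y" for y
    using F'[of y] b0[OF that] by simp
  have left: "F x = F 0" if "x \<le> 0" for x
  proof (cases "x = 0")
    case False
    then have "F 0 = F x"
      using that by (intro DERIV_isconst_end cont_F F0) auto
    then show ?thesis by simp
  qed simp
  have right: "F x = F 1" if "x \<ge> 1" for x
  proof (cases "x = 1")
    case False
    then show ?thesis
      using that by (intro DERIV_isconst_end cont_F F0) auto
  qed simp
  define c where "c = 1 / (F 1 - F 0)"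
  have c: "c > 0" "c * (F 1 - F 0) = 1" using less by (auto simp: c_def)
  show ?thesis
  proof (rule exI[where x="\<lambda>x. c * (F x - F 0)"], rule exI[where x="\<lambda>x. c * bump x"], intro conjI allI impI)
    show "((\<lambda>x. c * (F x - F 0)) has_real_derivative c * bump x) (at x)" for x
      by (auto intro!: derivative_eq_intros F')
    show "Ck k (\<lambda>x. c * bump x)" for k by (intro Ck_mult Ck_const Ck_bump)
    show "0 \<le> c * bump x" for x using c bump_nonneg by simp
    show "c * (F x - F 0) = 0" if "x \<le> 0" for x using left[OF that] by simp
    show "c * (F x - F 0) = 1" if "1 \<le> x" for x using right[OF that] c by simp
  qed
qed

definition step :: "real \<Rightarrow> real" where
  "step = (SOME S. \<exists>S'. (\<forall>x. (S has_real_derivative S' x) (at x)) \<and> (\<forall>k. Ck k S') \<and>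
     (\<forall>x. 0 \<le> S' x) \<and> (\<forall>x\<le>0. S x = 0) \<and> (\<forall>x\<ge>1. S x = 1))"

text \<open>A mollifier of mass 1 supported in \<open>[0, 1]\<close>. That the support lies on one
  side of 0 is what makes the doubling kernel one-sided.\<close>

definition kern :: "real \<Rightarrow> real" where
  "kern = deriv step"

lemma step_deriv: "(step has_real_derivative kern x) (at x)"
  and Ck_kern: "Ck k kern"
  and kern_nonneg: "0 \<le> kern x"
  and step_0: "x \<le> 0 \<Longrightarrow> step x = 0"
  and step_1: "x \<ge> 1 \<Longrightarrow> step x = 1"
proof -
  obtain S' where S': "\<And>x. (step has_real_derivative S' x) (at x)" "\<And>k. Ck k S'" "\<And>x. 0 \<le> S' x"
     "\<And>x. x\<le>0 \<Longrightarrow> step x = 0" "\<And>x. x\<ge>1 \<Longrightarrow> step x = 1"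
    using someI_ex[OF smooth_step_exists, folded step_def] by blast
  have "kern = S'" unfolding kern_def using S'(1) by (auto intro: DERIV_imp_deriv)
  with S' show "(step has_real_derivative kern x) (at x)" "Ck k kern" "0 \<le> kern x"
    "x \<le> 0 \<Longrightarrow> step x = 0" "x \<ge> 1 \<Longrightarrow> step x = 1" by auto
qed

lemma Ck_step: "Ck k step"
  by (rule Ck_Suc_imp_Ck[OF Ck_SucI[OF step_deriv Ck_kern]])

lemma step_mono: "x \<le> y \<Longrightarrow> step x \<le> step y"
  using DERIV_nonneg_imp_nondecreasing[of x y step] step_deriv kern_nonneg by blast

lemma step_bounds: "0 \<le> step x" "step x \<le> 1"
  using step_mono[of "min x 0" x] step_mono[of x "max x 1"] by (auto simp: step_0 step_1)

lemma isCont_kern: "isCont kern x"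
  using Ck_kern[of 0] by (simp add: continuous_on_eq_continuous_at)

lemma kern_eq_0: 
  assumes "x \<le> 0 \<or> 1 \<le> x" shows "kern x = 0"
proof -
  have 1: "kern x = 0" if "x < 0" for x
  proof -
    have "((\<lambda>_. 0) has_real_derivative kern x) (at x)"
      by (rule has_field_derivative_transform_within[OF step_deriv, where d="-x"])
        (use that in \<open>auto simp: dist_real_def step_0\<close>)
    then show ?thesis using DERIV_unique[OF _ DERIV_const] by blast
  qed
  have 2: "kern x = 0" if "x > 1" for x
  proof -
    have "((\<lambda>_. 1) has_real_derivative kern x) (at x)"
      by (rule has_field_derivative_transform_within[OF step_deriv, where d="x - 1"])
        (use that in \<open>auto simp: dist_real_def step_1\<close>)
    then show ?thesis using DERIV_unique[OF _ DERIV_const] by blast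
  qed
  \<comment> \<open>At the two end points \<open>step\<close> is constant on one side only, so the
    value of \<open>kern\<close> is read off by continuity from that side.\<close>
  have "(kern \<longlongrightarrow> kern 0) (at_left 0)" "(kern \<longlongrightarrow> kern 1) (at_right 1)"
    using isCont_kern by (auto simp: isCont_def filterlim_at_split)
  moreover have "(kern \<longlongrightarrow> 0) (at_left 0)" "(kern \<longlongrightarrow> 0) (at_right 1)"
    by (rule tendsto_eventually, auto simp: eventually_at_filter 1 2)+
  ultimately have "kern 0 = 0" "kern 1 = 0"
    using tendsto_unique[OF trivial_limit_at_left_real] tendsto_unique[OF trivial_limit_at_right_real] by blast+
  then show ?thesis using assms 1 2 by (metis order_le_less)
qed

lemma kern_borel [measurable]: "kern \<in> borel_measurable borel"
  and step_borel [measurable]: "step \<in> borel_measurable borel"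
  using Ck_kern[of 0] Ck_step[of 0] by (auto intro!: borel_measurable_continuous_onI)

lemma kern_bounded: "\<exists>B. \<forall>x. kern x \<le> B"
proof -
  have "bounded (kern ` {0..1})"
    by (intro compact_imp_bounded compact_continuous_image)
      (auto intro!: continuous_at_imp_continuous_on isCont_kern)
  then obtain B where B: "\<forall>x\<in>{0..1}. norm (kern x) \<le> B" unfolding bounded_iff by auto
  have "kern x \<le> max B 0" for x
  proof (cases "x \<in> {0..1}")
    case True
    then have "norm (kern x) \<le> B" using B by blast
    then show ?thesis by auto
  next
    case False
    then show ?thesis using kern_eq_0[of x] by auto
  qed
  then show ?thesis by blast
qed

lemma kern_integral: "has_bochner_integral lborel kern 1"
proof -
  have "has_bochner_integral lborel (\<lambda>x. kern x * indicator {0..1} x) (step 1 - step 0)"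
    by (rule has_bochner_integral_FTC_Icc_real)
      (auto intro!: step_deriv isCont_kern)
  moreover have "(\<lambda>x. kern x * indicator {0..1} x) = kern"
  proof
    show "kern x * indicator {0..1} x = kern x" for x
      using kern_eq_0[of x] by (cases "x \<in> {0..1}") auto
  qed
  ultimately show ?thesis by (simp add: step_0 step_1)
qed

section \<open>Convex functions\<close>

lemma monotone_limit_at_right:
  fixes s :: "real \<Rightarrow> real"
  assumes mono: "\<And>x y. u < x \<Longrightarrow> x \<le> y \<Longrightarrow> s x \<le> s y" and bd: "\<And>x. u < x \<Longrightarrow> c \<le> s x"
  shows "\<exists>D. (s \<longlongrightarrow> D) (at_right u) \<and> c \<le> D \<and> (\<forall>x>u. D \<le> s x)"
proof -
  define D where "D = Inf (s ` {u<..})"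
  have bb: "bdd_below (s ` {u<..})" using bd by (auto intro!: bdd_belowI[where m=c])
  have D: "D \<le> s x" if "u < x" for x unfolding D_def using bb that by (auto intro: cInf_lower)
  have "c \<le> D" unfolding D_def using bd by (intro cInf_greatest) auto
  moreover have "(s \<longlongrightarrow> D) (at_right u)"
  proof (rule order_tendstoI)
    fix y assume "y < D"
    then show "\<forall>\<^sub>F x in at_right u. y < s x"
      using D by (auto simp: eventually_at_filter intro!: always_eventually intro: less_le_trans)
  next
    fix y assume "D < y"
    then obtain x0 where x0: "u < x0" "s x0 < y"
      unfolding D_def using cInf_less_iff[OF _ bb] by auto
    then show "\<forall>\<^sub>F x in at_right u. s x < y"
      using mono by (auto simp: eventually_at_right intro!: exI[of _ x0] intro: le_less_trans less_imp_le)
  qed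
  ultimately show ?thesis using D by blast
qed

lemma monotone_limit_at_left:
  fixes s :: "real \<Rightarrow> real"
  assumes mono: "\<And>x y. y < u \<Longrightarrow> x \<le> y \<Longrightarrow> s x \<le> s y" and bd: "\<And>x. x < u \<Longrightarrow> s x \<le> c"
  shows "\<exists>D. (s \<longlongrightarrow> D) (at_left u) \<and> D \<le> c \<and> (\<forall>x<u. s x \<le> D)"
proof -
  have "\<exists>D. ((\<lambda>x. - s (- x)) \<longlongrightarrow> D) (at_right (- u)) \<and> - c \<le> D \<and> (\<forall>x>- u. D \<le> - s (- x))"
    using mono bd by (intro monotone_limit_at_right) auto
  then obtain D where D: "((\<lambda>x. - s (- x)) \<longlongrightarrow> D) (at_right (- u))" "- c \<le> D" "\<And>x. x > - u \<Longrightarrow> D \<le> - s (- x)"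
    by blast
  have "(s \<longlongrightarrow> - D) (at_left u)"
    using tendsto_minus[OF D(1)] by (simp add: at_left_minus filterlim_filtermap)
  moreover have "s x \<le> - D" if "x < u" for x using D(3)[of "- x"] that by simp
  ultimately show ?thesis using D(2) by (intro exI[of _ "- D"]) auto
qed

text \<open>\<open>right_deriv\<close> is a definite description, so the limit has to be shown to
  exist first: slopes from \<open>u\<close> to points on its right are monotone and bounded below by
  the slope over \<open>[u - 1, u]\<close>. The limit is then their infimum.\<close>

lemma convex_right_deriv:
  fixes g :: "real \<Rightarrow> real"
  assumes g: "convex_on UNIV g" and "u < v"
  shows "right_deriv g u \<le> (g v - g u) / (v - u)"
proof -
  have sl: "(g x - g u) / (x - u) \<le> (g y - g u) / (y - u)" if "u < x" "x \<le> y" for x y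
    using convex_on_slope_le(1)[OF g, of u y x] that
    by (cases "x = y") (auto simp: divide_simps mult.commute algebra_simps)
  have bd: "(g (u - 1) - g u) / (u - 1 - u) \<le> (g y - g u) / (y - u)" if "u < y" for y
    using convex_on_slope_le[OF g, of "u - 1" y u] that by (auto simp: divide_simps algebra_simps)
  obtain D where D: "((\<lambda>y. (g y - g u) / (y - u)) \<longlongrightarrow> D) (at_right u)" "\<forall>x>u. D \<le> (g x - g u) / (x - u)"
    using monotone_limit_at_right[of u "\<lambda>y. (g y - g u) / (y - u)", OF sl bd] by blast
  have "right_deriv g u = D"
    unfolding right_deriv_def
    using D(1) by (auto simp: has_field_derivative_iff intro!: the_equality intro: tendsto_unique[OF trivial_limit_at_right_real])
  then show ?thesis using D \<open>u < v\<close> by blast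
qed

lemma convex_left_deriv:
  fixes g :: "real \<Rightarrow> real"
  assumes g: "convex_on UNIV g" and "v < u"
  shows "(g v - g u) / (v - u) \<le> left_deriv g u"
proof -
  have sl: "(g x - g u) / (x - u) \<le> (g y - g u) / (y - u)" if "y < u" "x \<le> y" for x y
    using convex_on_slope_le(2)[OF g, of x u y] that
    by (cases "x = y") (auto simp: divide_simps mult.commute algebra_simps)
  have bd: "(g y - g u) / (y - u) \<le> (g (u + 1) - g u) / (u + 1 - u)" if "y < u" for y
    using convex_on_slope_le[OF g, of y "u + 1" u] that by (auto simp: divide_simps algebra_simps)
  obtain D where D: "((\<lambda>y. (g y - g u) / (y - u)) \<longlongrightarrow> D) (at_left u)" "\<forall>x<u. (g x - g u) / (x - u) \<le> D"
    using monotone_limit_at_left[of u "\<lambda>y. (g y - g u) / (y - u)", OF sl bd] by blast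
  have "left_deriv g u = D"
    unfolding left_deriv_def
    using D(1) by (auto simp: has_field_derivative_iff intro!: the_equality intro: tendsto_unique[OF trivial_limit_at_left_real])
  then show ?thesis using D \<open>v < u\<close> by blast
qed

text \<open>If \<open>u < v\<close>, the slope between \<open>u\<close> and \<open>v\<close> is at
  least \<open>right_deriv g u\<close>, hence at least \<open>M2\<close>, and at most
  \<open>left_deriv g v\<close>, hence at most \<open>M1\<close>. Moreover \<open>u < v\<close>
  excludes \<open>u = b\<close> and \<open>v = a\<close>, so the infinite values set at the end
  points do not interfere.\<close>

lemma level_set_ordered:
  assumes g: "convex_on UNIV g" and "M1 < M2" and "v \<in> level_set a b g M1" and "u \<in> level_set a b g M2"
  shows "v \<le> u"
proof (rule ccontr)
  assume "\<not> v \<le> u"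
  then have "u < v" by simp
  with assms have "ereal (left_deriv g v) \<le> ereal M1" "ereal M2 \<le> ereal (right_deriv g u)"
    by (auto simp: level_set_def split: if_splits)
  moreover have "right_deriv g u \<le> (g v - g u) / (v - u)"
    using convex_right_deriv[OF g \<open>u < v\<close>] .
  moreover have "(g u - g v) / (u - v) \<le> left_deriv g v"
    using convex_left_deriv[OF g \<open>u < v\<close>] .
  moreover have "(g u - g v) / (u - v) = (g v - g u) / (v - u)"
    by (metis minus_diff_eq minus_divide_divide)
  ultimately show False using \<open>M1 < M2\<close> by simp
qed

text \<open>The order is the lexicographic one of the pairs \<open>(M, z)\<close>, which does not
  refer to a road: different \<open>M\<close> are compared through the level sets, equal
  \<open>M\<close> through monotonicity in \<open>z\<close>.\<close>

lemma priority_functions_ordered: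
  assumes "priority_functions N a b \<eta> \<P>" and "\<And>h. h \<in> {1..N} \<Longrightarrow> convex_on UNIV (\<eta> h)"
    and "z1 \<in> {0..1}" "z2 \<in> {0..1}"
  shows "(\<forall>h\<in>{1..N}. \<P> M1 h z1 \<le> \<P> M2 h z2) \<or> (\<forall>h\<in>{1..N}. \<P> M2 h z2 \<le> \<P> M1 h z1)"
proof -
  have mono: "mono_on {0..1} (\<P> M h)" and img: "\<P> M h ` {0..1} = level_set (a h) (b h) (\<eta> h) M"
    if "h \<in> {1..N}" for M h using assms(1) that by (auto simp: priority_functions_def)
  consider "M1 < M2" | "M2 < M1" | "M1 = M2" "z1 \<le> z2" | "M1 = M2" "z2 \<le> z1" by linarith
  then show ?thesis
  proof cases
    case 1
    then show ?thesis using level_set_ordered[OF assms(2) 1] img assms(3,4) by blast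
  next
    case 2
    then show ?thesis using level_set_ordered[OF assms(2) 2] img assms(3,4) by blast
  next
    case 3
    then show ?thesis using monotone_onD[OF mono] assms(3,4) by blast
  next
    case 4
    then show ?thesis using monotone_onD[OF mono] assms(3,4) by blast
  qed
qed

text \<open>A monotone selection of supporting slopes of the convex function \<open>- f\<close> has
  at most countably many discontinuities, and at a point of continuity of the selection the function
  is differentiable. This provides the almost-everywhere condition in
  \<open>entropy_pair\<close>.\<close>

lemma concave_AE_differentiable:
  fixes f :: "real \<Rightarrow> real"
  assumes conc: "concave_on {a..b} f" and out: "\<And>u. u \<notin> {a..b} \<Longrightarrow> f u = 0"
  shows "AE u in lborel. f differentiable (at u)"
proof -
  define g where "g u = - f u" for u
  \<comment> \<open>The right derivative of \<open>g\<close>, written as the infimum of slopes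
    because \<open>convex_le_Inf_differential\<close> produces the supporting line in this
    form.\<close>
  define R where "R x = Inf ((\<lambda>t. (g x - g t) / (x - t)) ` ({x<..} \<inter> {a<..<b}))" for x
  have cg: "convex_on {a<..<b} g"
    using conc unfolding concave_on_def g_def[abs_def] by (rule convex_on_subset) auto
  have sub: "g x + R x * (y - x) \<le> g y" if "x \<in> {a<..<b}" "y \<in> {a<..<b}" for x y
    using convex_le_Inf_differential[OF cg, of x y] that by (simp add: R_def interior_open)
  have mono: "mono_on {a<..<b} R"
  proof (rule mono_onI)
    fix x y assume xy: "x \<in> {a<..<b}" "y \<in> {a<..<b}" "x \<le> y"
    show "R x \<le> R y"
    proof (cases "x = y")
      case False
      have "R x * (y - x) \<le> R y * (y - x)" using sub[OF xy(1,2)] sub[OF xy(2,1)] by (simp add: algebra_simps)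
      then show ?thesis using False xy(3) by simp
    qed simp
  qed
  define N where "N = {x\<in>{a<..<b}. \<not> isCont R x} \<union> {a, b}"
  have "countable N" unfolding N_def using mono_on_ctble_discont_open[OF _ mono] by auto
  then have null: "N \<in> null_sets lborel" by (rule countable_imp_null_set_lborel)
  have "f differentiable (at x)" if x: "x \<notin> N" for x
  proof (cases "x \<in> {a<..<b}")
    case True
    with x have cont: "isCont R x" by (auto simp: N_def)
    \<comment> \<open>The difference quotient lies between the supporting slopes at its two end
      points.\<close>
    have sq: "\<bar>(g y - g x) / (y - x) - R x\<bar> \<le> \<bar>R y - R x\<bar>" if "y \<in> {a<..<b}" and ne: "y \<noteq> x" for y
    proof -
      have 1: "R x * (y - x) \<le> g y - g x" "g y - g x \<le> R y * (y - x)"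
        using sub[OF True that(1)] sub[OF that(1) True] by (auto simp: algebra_simps)
      consider "y > x" | "y < x" using ne by linarith
      then show ?thesis
      proof cases
        case 1
        with \<open>R x * (y - x) \<le> g y - g x\<close> \<open>g y - g x \<le> R y * (y - x)\<close>
        have "R x \<le> (g y - g x) / (y - x)" "(g y - g x) / (y - x) \<le> R y"
          by (simp_all only: pos_le_divide_eq pos_divide_le_eq diff_gt_0_iff_gt)
        then show ?thesis by linarith
      next
        case 2
        with \<open>R x * (y - x) \<le> g y - g x\<close> \<open>g y - g x \<le> R y * (y - x)\<close>
        have "R x \<ge> (g y - g x) / (y - x)" "(g y - g x) / (y - x) \<ge> R y"
          by (simp_all only: neg_le_divide_eq neg_divide_le_eq diff_less_0_iff_less)
        then show ?thesis by linarith
      qed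
    qed
    have R0: "((\<lambda>y. norm (R y - R x)) \<longlongrightarrow> 0) (at x)"
      using cont by (intro tendsto_norm_zero) (simp add: isCont_def LIM_zero_iff)
    have "eventually (\<lambda>y. y \<in> {a<..<b} \<and> y \<noteq> x) (at x)"
      using eventually_at_in_open[of "{a<..<b}" x] True by simp
    then have "eventually (\<lambda>y. norm ((g y - g x) / (y - x) - R x) \<le> norm (R y - R x)) (at x)"
    proof eventually_elim
      case (elim y)
      show ?case unfolding real_norm_def by (rule sq[OF conjunct1[OF elim] conjunct2[OF elim]])
    qed
    from Lim_null_comparison[OF this R0]
    have "((\<lambda>y. (g y - g x) / (y - x) - R x) \<longlongrightarrow> 0) (at x)" .
    then have "(g has_real_derivative R x) (at x)"
      by (simp add: has_field_derivative_iff LIM_zero_iff)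
    then have "((\<lambda>u. - g u) has_real_derivative - R x) (at x)" by (rule DERIV_minus)
    then show ?thesis by (auto simp: g_def real_differentiable_def)
  next
    case False
    with x have "x \<in> - {a..b}" by (auto simp: N_def)
    have "((\<lambda>_. 0) has_real_derivative 0) (at x)" by simp
    then have "(f has_real_derivative 0) (at x)"
      by (rule has_field_derivative_transform_within_open[where S="- {a..b}"])
        (use \<open>x \<in> - {a..b}\<close> out in auto)
    then show ?thesis by (auto simp: real_differentiable_def)
  qed
  then show ?thesis using null by (auto intro!: AE_I'[of N])
qed

text \<open>As \<open>f\<close> vanishes at both ends and outside, it equals its restriction
  composed with the projection onto \<open>[a, b]\<close>, which does not increase
  distances.\<close>

lemma lipschitz_extension:
  fixes f :: "real \<Rightarrow> real"
  assumes "L-lipschitz_on {a..b} f" "a \<le> b" "f a = 0" "f b = 0" "\<And>u. u \<notin> {a..b} \<Longrightarrow> f u = 0"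
  shows "L-lipschitz_on UNIV f"
proof -
  define c where "c u = max a (min b u)" for u
  have fc: "f u = f (c u)" for u
    using assms(2-4) assms(5)[of u] by (cases "u < a"; cases "u > b") (auto simp: c_def)
  show ?thesis
  proof (rule lipschitz_onI)
    show "0 \<le> L" using assms(1) lipschitz_on_nonneg by blast
    fix u v
    have "dist (f (c u)) (f (c v)) \<le> L * dist (c u) (c v)"
      using assms(2) by (intro lipschitz_onD[OF assms(1)]) (auto simp: c_def)
    also have "\<dots> \<le> L * dist u v"
      using \<open>0 \<le> L\<close> by (intro mult_left_mono) (auto simp: c_def dist_real_def)
    finally show "dist (f u) (f v) \<le> L * dist u v" using fc by metis
  qed
qed

section \<open>Kruzhkov entropies\<close>

text \<open>Two weights cover all cases: \<open>p = q = 1\<close> is the distance to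
  \<open>k\<close> used for doubling, while \<open>p = 1, q = 0\<close> and
  \<open>p = 0, q = 1\<close> are the semi-entropies that detect the boundary condition.\<close>

definition kruzhkov :: "real \<Rightarrow> real \<Rightarrow> real \<Rightarrow> real \<Rightarrow> real" where
  "kruzhkov p q k u = p * max 0 (k - u) + q * max 0 (u - k)"

definition kruzhkov_flux :: "(real \<Rightarrow> real) \<Rightarrow> real \<Rightarrow> real \<Rightarrow> real \<Rightarrow> real \<Rightarrow> real" where
  "kruzhkov_flux f p q k u = (if u < k then - p else q) * (f u - f k)"

lemma kruzhkov_1_1: "kruzhkov 1 1 k u = \<bar>u - k\<bar>"
  by (auto simp: kruzhkov_def max_def)

text \<open>Kruzhkov's entropy flux for the entropy \<open>\<bar>u - v\<bar>\<close>, written so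
  that its symmetry in the two states is visible.\<close>

definition Q :: "(real \<Rightarrow> real) \<Rightarrow> real \<Rightarrow> real \<Rightarrow> real" where
  "Q f u v = sgn (u - v) * (f u - f v)"

lemma kruzhkov_flux_1_1: "kruzhkov_flux f 1 1 k u = Q f u k"
  by (auto simp: kruzhkov_flux_def Q_def sgn_if)

lemma kruzhkov_nonneg: "0 \<le> p \<Longrightarrow> 0 \<le> q \<Longrightarrow> 0 \<le> kruzhkov p q k u"
  by (simp add: kruzhkov_def)

lemma kruzhkov_convex: "0 \<le> p \<Longrightarrow> 0 \<le> q \<Longrightarrow> convex_on UNIV (kruzhkov p q k)"
proof -
  assume "0 \<le> p" "0 \<le> q"
  moreover have *: "convex_on UNIV (\<lambda>u::real. max 0 (c * u + d))" for c d
  proof (rule convex_onI)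
    fix t x y :: real assume t: "0 < t" "t < 1"
    have "(1 - t) * (c * x + d) + t * (c * y + d) \<le> (1 - t) * max 0 (c * x + d) + t * max 0 (c * y + d)"
      "0 \<le> (1 - t) * max 0 (c * x + d) + t * max 0 (c * y + d)"
      using t by (auto intro!: add_mono mult_left_mono add_nonneg_nonneg mult_nonneg_nonneg)
    moreover have "c * ((1 - t) *\<^sub>R x + t *\<^sub>R y) + d = (1 - t) * (c * x + d) + t * (c * y + d)"
      by (simp add: algebra_simps)
    ultimately show "max 0 (c * ((1 - t) *\<^sub>R x + t *\<^sub>R y) + d) \<le> (1 - t) * max 0 (c * x + d) + t * max 0 (c * y + d)"
      by simp
  qed simp
  then have "convex_on UNIV (\<lambda>u. max 0 (k - u))" "convex_on UNIV (\<lambda>u::real. max 0 (u - k))"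
    using *[of "-1" k] *[of 1 "- k"] by simp_all
  ultimately show ?thesis
    unfolding kruzhkov_def[abs_def] by (intro convex_on_add convex_on_cmul)
qed

lemma lipschitz_abs:
  assumes "L-lipschitz_on UNIV (f :: real \<Rightarrow> real)"
  shows "\<bar>f u - f v\<bar> \<le> L * \<bar>u - v\<bar>"
  using lipschitz_onD[OF assms, of u v] by (simp add: dist_real_def)

lemma kruzhkov_flux_le:
  assumes "L-lipschitz_on UNIV f" "0 \<le> p" "0 \<le> q"
  shows "\<bar>kruzhkov_flux f p q k u\<bar> \<le> L * kruzhkov p q k u"
proof -
  have "\<bar>f u - f k\<bar> \<le> L * \<bar>u - k\<bar>" using lipschitz_abs[OF assms(1)] .
  then have "p * \<bar>f u - f k\<bar> \<le> p * (L * \<bar>u - k\<bar>)" "q * \<bar>f u - f k\<bar> \<le> q * (L * \<bar>u - k\<bar>)"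
    using assms by (auto intro: mult_left_mono)
  moreover have "\<bar>kruzhkov_flux f p q k u\<bar> = (if u < k then p * \<bar>f u - f k\<bar> else q * \<bar>f u - f k\<bar>)"
    using assms(2,3) by (simp add: kruzhkov_flux_def abs_mult)
  moreover have "L * kruzhkov p q k u = (if u < k then p * (L * \<bar>u - k\<bar>) else q * (L * \<bar>u - k\<bar>))"
    by (auto simp: kruzhkov_def max_def)
  ultimately show ?thesis by presburger
qed

lemma Q_le: "L-lipschitz_on UNIV f \<Longrightarrow> \<bar>Q f u v\<bar> \<le> L * \<bar>u - v\<bar>"
  using kruzhkov_flux_le[of L f 1 1 v u] by (simp add: kruzhkov_flux_1_1 kruzhkov_1_1)

lemma kruzhkov_flux_lipschitz:
  assumes "L-lipschitz_on UNIV f" "0 \<le> p" "0 \<le> q"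
  shows "((p + q) * L)-lipschitz_on UNIV (kruzhkov_flux f p q k)"
proof (rule lipschitz_onI)
  have L: "0 \<le> L" using assms(1) lipschitz_on_nonneg by blast
  show "0 \<le> (p + q) * L" using L assms by simp
  have *: "\<bar>kruzhkov_flux f p q k u - kruzhkov_flux f p q k v\<bar> \<le> (p + q) * L * \<bar>u - v\<bar>" if "u \<le> v" for u v
  proof -
    have pl: "p * \<bar>f x - f y\<bar> \<le> p * (L * \<bar>x - y\<bar>)" and ql: "q * \<bar>f x - f y\<bar> \<le> q * (L * \<bar>x - y\<bar>)" for x y
      using assms lipschitz_abs[OF assms(1)] by (auto intro: mult_left_mono)
    have nn: "0 \<le> p * (L * \<bar>x - y\<bar>)" "0 \<le> q * (L * \<bar>x - y\<bar>)" for x y using assms L by auto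
    consider "v < k" | "k \<le> u" | "u < k" "k \<le> v" by linarith
    then show ?thesis
    proof cases
      case 1
      then have "kruzhkov_flux f p q k u - kruzhkov_flux f p q k v = - p * (f u - f v)"
        using that by (auto simp: kruzhkov_flux_def algebra_simps)
      then have "\<bar>kruzhkov_flux f p q k u - kruzhkov_flux f p q k v\<bar> = p * \<bar>f u - f v\<bar>"
        using assms by (simp add: abs_mult)
      then show ?thesis using pl[of u v] nn(2)[of u v] by (simp add: algebra_simps)
    next
      case 2
      then have "kruzhkov_flux f p q k u - kruzhkov_flux f p q k v = q * (f u - f v)"
        using that by (auto simp: kruzhkov_flux_def algebra_simps)
      then have "\<bar>kruzhkov_flux f p q k u - kruzhkov_flux f p q k v\<bar> = q * \<bar>f u - f v\<bar>"
        using assms by (simp add: abs_mult)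
      then show ?thesis using ql[of u v] nn(1)[of u v] by (simp add: algebra_simps)
    next
      \<comment> \<open>Both branches vanish at \<open>k\<close>; splitting the increment there
        makes each part cost one of the two weights.\<close>
      case 3
      then have "kruzhkov_flux f p q k u - kruzhkov_flux f p q k v = - (p * (f u - f k)) - q * (f v - f k)"
        by (auto simp: kruzhkov_flux_def algebra_simps)
      then have "\<bar>kruzhkov_flux f p q k u - kruzhkov_flux f p q k v\<bar> \<le> \<bar>p * (f u - f k)\<bar> + \<bar>q * (f v - f k)\<bar>"
        by linarith
      also have "\<dots> \<le> p * (L * \<bar>u - k\<bar>) + q * (L * \<bar>v - k\<bar>)"
        using pl[of u k] ql[of v k] assms by (simp add: abs_mult)
      also have "\<dots> \<le> p * (L * \<bar>u - v\<bar>) + q * (L * \<bar>u - v\<bar>)"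
        using 3 assms L by (intro add_mono mult_left_mono) auto
      finally show ?thesis by (simp add: algebra_simps)
    qed
  qed
  fix u v
  show "dist (kruzhkov_flux f p q k u) (kruzhkov_flux f p q k v) \<le> (p + q) * L * dist u v"
    using *[of u v] *[of v u] by (cases "u \<le> v") (auto simp: dist_real_def abs_minus_commute)
qed

lemma Q_commute: "Q f u v = Q f v u"
  by (simp add: Q_def sgn_minus[of "u - v", simplified] algebra_simps)

lemma Q_lipschitz:
  assumes "L-lipschitz_on UNIV f"
  shows "\<bar>Q f u v - Q f u' v'\<bar> \<le> 2 * L * (\<bar>u - u'\<bar> + \<bar>v - v'\<bar>)"
proof -
  have *: "\<bar>Q f u v - Q f u' v\<bar> \<le> 2 * L * \<bar>u - u'\<bar>" for u u' v
    using lipschitz_abs[OF kruzhkov_flux_lipschitz[OF assms, of 1 1 v], of u u'] by (simp add: kruzhkov_flux_1_1)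
  show ?thesis using *[of u v u'] *[of v u' v'] by (simp add: Q_commute[of f u'] distrib_left)
qed

text \<open>Apart from the kink at \<open>k\<close>, both functions are locally affine in
  \<open>u\<close> and in \<open>f u\<close>, so the derivative relation holds wherever
  \<open>f\<close> is differentiable.\<close>

lemma entropy_pair_kruzhkov:
  assumes L: "L-lipschitz_on UNIV f" and pq: "0 \<le> p" "0 \<le> q"
    and diff: "AE u in lborel. f differentiable (at u)"
  shows "entropy_pair f (kruzhkov p q k) (kruzhkov_flux f p q k)"
  unfolding entropy_pair_def
proof (intro conjI allI)
  show "convex_on UNIV (kruzhkov p q k)" using pq by (rule kruzhkov_convex)
  show "\<exists>L. L-lipschitz_on {- R..R} (kruzhkov_flux f p q k)" for R
    using kruzhkov_flux_lipschitz[OF L pq] lipschitz_on_subset by blast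
  have "AE u in lborel. u \<noteq> k" by (rule AE_lborel_singleton)
  with diff show "AE u in lborel. (kruzhkov_flux f p q k has_real_derivative
      deriv (kruzhkov p q k) u * deriv f u) (at u)"
  proof eventually_elim
    case (elim u)
    have f: "(f has_real_derivative deriv f u) (at u)"
      using elim(1) by (simp add: DERIV_deriv_iff_real_differentiable)
    consider "u < k" | "k < u" using elim(2) by linarith
    then show ?case
    proof cases
      case 1
      have "((\<lambda>u. p * (k - u)) has_real_derivative - p) (at u)"
        by (auto intro!: derivative_eq_intros)
      then have "(kruzhkov p q k has_real_derivative - p) (at u)"
        by (rule has_field_derivative_transform_within_open[where S="{..<k}"])
          (use 1 in \<open>auto simp: kruzhkov_def\<close>)
      then have d: "deriv (kruzhkov p q k) u = - p" by (rule DERIV_imp_deriv)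
      have "((\<lambda>u. - p * (f u - f k)) has_real_derivative - p * deriv f u) (at u)"
        by (auto intro!: derivative_eq_intros f)
      then show ?thesis unfolding d
        by (rule has_field_derivative_transform_within_open[where S="{..<k}"])
          (use 1 in \<open>auto simp: kruzhkov_flux_def\<close>)
    next
      case 2
      have "((\<lambda>u. q * (u - k)) has_real_derivative q) (at u)"
        by (auto intro!: derivative_eq_intros)
      then have "(kruzhkov p q k has_real_derivative q) (at u)"
        by (rule has_field_derivative_transform_within_open[where S="{k<..}"])
          (use 2 in \<open>auto simp: kruzhkov_def\<close>)
      then have d: "deriv (kruzhkov p q k) u = q" by (rule DERIV_imp_deriv)
      have "((\<lambda>u. q * (f u - f k)) has_real_derivative q * deriv f u) (at u)"
        by (auto intro!: derivative_eq_intros f)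
      then show ?thesis unfolding d
        by (rule has_field_derivative_transform_within_open[where S="{k<..}"])
          (use 2 in \<open>auto simp: kruzhkov_flux_def\<close>)
    qed
  qed
qed

text \<open>\<open>Q f \<cdot> m\<close> measures the total variation of \<open>f\<close>, so it controls every other Kruzhkov flux.\<close>

lemma Q_le_unimodal:
  assumes inc: "mono_on {a..m} f" and dec: "antimono_on {m..b} f" and m: "m \<in> {a..b}"
    and uv: "u \<in> {a..b}" "u' \<in> {a..b}" "v \<in> {a..b}"
  shows "\<bar>Q f u v - Q f u' v\<bar> \<le> \<bar>Q f u m - Q f u' m\<bar>"
proof -
  define \<Phi> where "\<Phi> u = Q f u m" for u
  \<comment> \<open>\<open>\<Phi>\<close> is minus the signed variation of \<open>f\<close> measured
    from \<open>m\<close>, so its decrease over an interval bounds the increment of \<open>f\<close>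
    there.\<close>
  have step: "\<bar>f x - f y\<bar> \<le> \<Phi> x - \<Phi> y" if "x \<le> y" "x \<in> {a..b}" "y \<in> {a..b}" for x y
  proof -
    have i: "f s \<le> f t" if "s \<le> t" "a \<le> s" "t \<le> m" for s t using monotone_onD[OF inc, of s t] that by simp
    have d: "f t \<le> f s" if "s \<le> t" "m \<le> s" "t \<le> b" for s t using monotone_onD[OF dec, of s t] that by simp
    consider "y \<le> m" | "m \<le> x" | "x < m" "m < y" by linarith
    then show ?thesis
    proof cases
      case 1
      then show ?thesis using that i[of x y] i[of y m] i[of x m] by (auto simp: \<Phi>_def Q_def sgn_if)
    next
      case 2
      then show ?thesis using that d[of x y] d[of m y] d[of m x] by (auto simp: \<Phi>_def Q_def sgn_if)
    next
      case 3
      then show ?thesis using that i[of x m] d[of m y] by (auto simp: \<Phi>_def Q_def sgn_if)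
    qed
  qed
  have *: "\<bar>Q f x v - Q f y v\<bar> \<le> \<Phi> x - \<Phi> y" if "x \<le> y" "x \<in> {a..b}" "y \<in> {a..b}" for x y
  proof -
    consider "y \<le> v" | "v \<le> x" | "x < v" "v < y" by linarith
    then show ?thesis
    proof cases
      case 1
      then show ?thesis using step[OF that] that by (auto simp: Q_def sgn_if)
    next
      case 2
      then show ?thesis using step[OF that] that by (auto simp: Q_def sgn_if)
    next
      case 3
      then show ?thesis using step[of x v] step[of v y] that uv by (auto simp: Q_def sgn_if)
    qed
  qed
  show ?thesis using *[of u u'] *[of u' u] uv
    by (cases "u \<le> u'") (auto simp: \<Phi>_def abs_minus_commute)
qed

text \<open>\<open>m\<close> is a maximum point; on the segment from \<open>x\<close> to
  \<open>m\<close> concavity keeps \<open>f\<close> above \<open>f x\<close>, which gives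
  monotonicity on both sides.\<close>

lemma concave_unimodal:
  fixes f :: "real \<Rightarrow> real"
  assumes conc: "concave_on {a..b} f" and cont: "continuous_on {a..b} f" and "a \<le> b"
  obtains m where "m \<in> {a..b}" "mono_on {a..m} f" "antimono_on {m..b} f"
proof -
  obtain m where m: "m \<in> {a..b}" "\<And>x. x \<in> {a..b} \<Longrightarrow> f x \<le> f m"
    using continuous_attains_sup[OF compact_Icc _ cont] \<open>a \<le> b\<close> by auto
  have key: "min (f x) (f m) \<le> f y" if x: "x \<in> {a..b}" and y: "y \<in> closed_segment x m" for x y
  proof -
    obtain t where t: "0 \<le> t" "t \<le> 1" "y = (1 - t) *\<^sub>R x + t *\<^sub>R m"
      using y by (auto simp: closed_segment_def)
    have "(1 - t) * f x + t * f m \<le> f y"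
      using concave_onD[OF conc t(1,2) x m(1)] t(3) by simp
    moreover have "(1 - t) * min (f x) (f m) + t * min (f x) (f m) \<le> (1 - t) * f x + t * f m"
      using t by (intro add_mono mult_left_mono) auto
    ultimately show ?thesis by (simp add: algebra_simps)
  qed
  have "mono_on {a..m} f"
  proof (rule mono_onI)
    fix x y assume "x \<in> {a..m}" "y \<in> {a..m}" "x \<le> y"
    then show "f x \<le> f y" using key[of x y] m(2)[of x] m(1) by (auto simp: closed_segment_eq_real_ivl)
  qed
  moreover have "antimono_on {m..b} f"
  proof (rule monotone_onI)
    fix x y assume "x \<in> {m..b}" "y \<in> {m..b}" "x \<le> y"
    then show "f y \<le> f x" using key[of y x] m(2)[of y] m(1) by (auto simp: closed_segment_eq_real_ivl)
  qed
  ultimately show thesis using that m(1) by blast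
qed

section \<open>Lebesgue integration\<close>

lemma integrable_bounded_support:
  fixes f :: "'a::euclidean_space \<Rightarrow> real"
  assumes [measurable]: "f \<in> borel_measurable borel" and bd: "\<And>x. \<bar>f x\<bar> \<le> C"
    and S: "bounded S" and supp: "\<And>x. x \<notin> S \<Longrightarrow> f x = 0"
  shows "integrable lborel f"
proof -
  obtain a b where ab: "S \<subseteq> cbox a b" using bounded_subset_cbox_symmetric[OF S] by blast
  have "integrable lborel (\<lambda>x. C * indicator (cbox a b) x :: real)"
    by (intro integrable_mult_right integrable_real_indicator) (auto simp: emeasure_lborel_cbox_finite[unfolded infinity_ennreal_def])
  then show ?thesis
  proof (rule Bochner_Integration.integrable_bound)
    show "AE x in lborel. norm (f x) \<le> norm (C * indicator (cbox a b) x)"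
    proof (rule AE_I2)
      fix x show "norm (f x) \<le> norm (C * indicator (cbox a b) x)"
        using bd[of x] supp[of x] ab by (cases "x \<in> cbox a b") auto
    qed
  qed simp
qed

section \<open>Translations and their continuity in the mean\<close>

lemma lborel_integral_translate:
  fixes f :: "'a::euclidean_space \<Rightarrow> real"
  assumes [measurable]: "f \<in> borel_measurable borel"
  shows "(LBINT x. f (x + c)) = (LBINT x. f x)"
proof -
  have "(LBINT x. f x) = (\<integral>x. f x \<partial>(distr lborel borel ((+) c)))" by (simp add: lborel_distr_plus)
  also have "\<dots> = (LBINT x. f (c + x))" by (rule integral_distr) auto
  finally show ?thesis by (simp add: add.commute)
qed

lemma lborel_integrable_translate:
  fixes f :: "'a::euclidean_space \<Rightarrow> real"
  assumes "integrable lborel f"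
  shows "integrable lborel (\<lambda>x. f (x + c))"
proof -
  have [measurable]: "f \<in> borel_measurable borel" using assms by auto
  have "integrable (distr lborel borel ((+) c)) f" using assms by (simp add: lborel_distr_plus)
  then have "integrable lborel (\<lambda>x. f (c + x))" by (subst (asm) integrable_distr_eq) auto
  then show ?thesis by (simp add: add.commute)
qed

text \<open>Pointwise convergence of the shifted indicator is clear only inside the open set. The
  integral is therefore written as twice the measure of \<open>U\<close> minus twice that of the
  overlap of \<open>U\<close> with its shift, where only points of \<open>U\<close> count.\<close>

lemma L1_translation_indicator_open:
  fixes U :: "'a::euclidean_space set"
  assumes U: "open U" "emeasure lborel U < \<infinity>" and h: "h \<longlonglongrightarrow> 0"
  shows "(\<lambda>n. LBINT x. \<bar>indicator U (x + h n) - indicator U x\<bar> :: real) \<longlonglongrightarrow> 0"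
proof -
  have [measurable]: "U \<in> sets borel" using U by auto
  let ?g = "indicator U :: 'a \<Rightarrow> real"
  have int: "integrable lborel ?g" using U by simp
  have int': "integrable lborel (\<lambda>x. ?g (x + c))" for c by (rule lborel_integrable_translate[OF int])
  have prod: "integrable lborel (\<lambda>x. ?g (x + c) * ?g x)" for c
    by (rule Bochner_Integration.integrable_bound[OF int]) (auto simp: indicator_def)
  have "(\<lambda>n. LBINT x. ?g (x + h n) * ?g x) \<longlonglongrightarrow> (LBINT x. ?g x)"
  proof (rule integral_dominated_convergence[where w="?g"])
    show "AE x in lborel. (\<lambda>n. ?g (x + h n) * ?g x) \<longlonglongrightarrow> ?g x"
    proof (rule AE_I2)
      fix x
      show "(\<lambda>n. ?g (x + h n) * ?g x) \<longlonglongrightarrow> ?g x"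
      proof (cases "x \<in> U")
        case True
        have "(\<lambda>n. x + h n) \<longlonglongrightarrow> x + 0" by (intro tendsto_intros h)
        then have "eventually (\<lambda>n. x + h n \<in> U) sequentially"
          using True U(1) by (auto elim!: topological_tendstoD)
        then show ?thesis using True by (auto intro!: tendsto_eventually elim: eventually_mono)
      qed simp
    qed
  qed (auto simp: int indicator_def)
  then have "(\<lambda>n. 2 * (LBINT x. ?g x) - 2 * (LBINT x. ?g (x + h n) * ?g x))
      \<longlonglongrightarrow> 2 * (LBINT x. ?g x) - 2 * (LBINT x. ?g x)"
    by (intro tendsto_intros)
  moreover have "(LBINT x. \<bar>?g (x + c) - ?g x\<bar>)
      = 2 * (LBINT x. ?g x) - 2 * (LBINT x. ?g (x + c) * ?g x)" for c
  proof -
    have "(LBINT x. \<bar>?g (x + c) - ?g x\<bar>) = (LBINT x. ?g (x + c) + ?g x - 2 * (?g (x + c) * ?g x))"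
      by (intro Bochner_Integration.integral_cong) (auto simp: indicator_def)
    also have "\<dots> = (LBINT x. ?g (x + c)) + (LBINT x. ?g x) - 2 * (LBINT x. ?g (x + c) * ?g x)"
      using int int' prod by simp
    finally show ?thesis by (simp add: lborel_integral_translate[of ?g c])
  qed
  ultimately show ?thesis by simp
qed

lemma L1_translation_indicator:
  fixes A :: "'a::euclidean_space set"
  assumes A[measurable]: "A \<in> sets borel" and fin: "emeasure lborel A < \<infinity>" and h: "h \<longlonglongrightarrow> 0"
  shows "(\<lambda>n. LBINT x. \<bar>indicator A (x + h n) - indicator A x\<bar> :: real) \<longlonglongrightarrow> 0"
proof (rule LIMSEQ_I)
  fix r :: real assume "0 < r"
  \<comment> \<open>Three errors of at most \<open>e\<close> arise: one for the open set
    \<open>U\<close>, and one each for \<open>U - A\<close> and its shift.\<close>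
  define e where "e = r / 4"
  have "0 < e" using \<open>0 < r\<close> by (simp add: e_def)
  obtain U where U: "open U" "A \<subseteq> U" "emeasure lborel (U - A) < e"
    using outer_regular_lborel[OF A \<open>0 < e\<close>] by blast
  have [measurable]: "U \<in> sets borel" using U by auto
  have "emeasure lborel U = emeasure lborel (A \<union> (U - A))" using U by (auto intro!: arg_cong2[where f=emeasure])
  also have "\<dots> \<le> emeasure lborel A + emeasure lborel (U - A)" by (rule emeasure_subadditive) auto
  also have "\<dots> < \<infinity>" using fin U(3) by (auto simp: less_top[symmetric])
  finally have finU: "emeasure lborel U < \<infinity>" .
  have finD: "emeasure lborel (U - A) < \<infinity>" using U(3) by (metis ennreal_less_top infinity_ennreal_def less_trans)
  let ?i = "\<lambda>A x. indicator A x :: real"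
  have intA: "integrable lborel (?i A)" and intU: "integrable lborel (?i U)" and intD: "integrable lborel (?i (U - A))"
    using fin finU finD by auto
  note tr = lborel_integrable_translate[OF intA] lborel_integrable_translate[OF intU] lborel_integrable_translate[OF intD]
  have mD: "(LBINT x. ?i (U - A) x) \<le> e"
    using U(3) \<open>0 < e\<close> finD by (simp add: measure_def enn2real_leI less_imp_le)
  obtain N where N: "\<And>n. n \<ge> N \<Longrightarrow> \<bar>LBINT x. \<bar>?i U (x + h n) - ?i U x\<bar>\<bar> < e"
    using LIMSEQ_D[OF L1_translation_indicator_open[OF U(1) finU h] \<open>0 < e\<close>] by auto
  have "\<bar>LBINT x. \<bar>?i A (x + h n) - ?i A x\<bar>\<bar> < r" if "n \<ge> N" for n
  proof -
    have "(LBINT x. \<bar>?i A (x + h n) - ?i A x\<bar>)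
        \<le> (LBINT x. \<bar>?i U (x + h n) - ?i U x\<bar> + ?i (U - A) (x + h n) + ?i (U - A) x)"
      using U(2) by (intro integral_mono Bochner_Integration.integrable_add Bochner_Integration.integrable_diff
          integrable_abs intA intU intD tr) (auto simp: indicator_def)
    also have "\<dots> = (LBINT x. \<bar>?i U (x + h n) - ?i U x\<bar>) + (LBINT x. ?i (U - A) (x + h n)) + (LBINT x. ?i (U - A) x)"
      by (simp add: intU intD tr del: integral_indicator)
    also have "(LBINT x. ?i (U - A) (x + h n)) = (LBINT x. ?i (U - A) x)"
      by (rule lborel_integral_translate) auto
    finally show ?thesis using N[OF that] mD \<open>0 < e\<close> by (simp add: e_def)
  qed
  then show "\<exists>N. \<forall>n\<ge>N. norm ((LBINT x. \<bar>?i A (x + h n) - ?i A x\<bar>) - 0) < r" by auto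
qed

lemma L1_translation:
  fixes f :: "'a::euclidean_space \<Rightarrow> real"
  assumes "integrable lborel f" and h: "h \<longlonglongrightarrow> 0"
  shows "(\<lambda>n. LBINT x. \<bar>f (x + h n) - f x\<bar>) \<longlonglongrightarrow> 0"
  using assms(1)
proof (induction rule: integrable_induct)
  case (base A c)
  have "(LBINT x. \<bar>indicator A (x + h n) *\<^sub>R c - indicator A x *\<^sub>R c\<bar>)
      = \<bar>c\<bar> * (LBINT x. \<bar>indicator A (x + h n) - indicator A x\<bar>)" for n
    by (subst integral_mult_right_zero[symmetric], intro Bochner_Integration.integral_cong)
       (auto simp: indicator_def)
  moreover have "(\<lambda>n. \<bar>c\<bar> * (LBINT x. \<bar>indicator A (x + h n) - indicator A x\<bar>)) \<longlonglongrightarrow> \<bar>c\<bar> * 0"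
    using base by (intro tendsto_intros L1_translation_indicator[OF _ _ h]) auto
  ultimately show ?case by simp
next
  case (add f g)
  note tr = lborel_integrable_translate[OF add(1)] lborel_integrable_translate[OF add(2)]
  show ?case
  proof (rule tendsto_sandwich[OF _ _ tendsto_const])
    show "(\<lambda>n. (LBINT x. \<bar>f (x + h n) - f x\<bar>) + (LBINT x. \<bar>g (x + h n) - g x\<bar>)) \<longlonglongrightarrow> 0"
      using tendsto_add[OF add(3,4)] by simp
    have "(LBINT x. \<bar>f (x + h n) + g (x + h n) - (f x + g x)\<bar>)
      \<le> (LBINT x. \<bar>f (x + h n) - f x\<bar> + \<bar>g (x + h n) - g x\<bar>)" for n
      using add(1,2) tr by (intro integral_mono Bochner_Integration.integrable_add Bochner_Integration.integrable_diff
          integrable_abs) auto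
    also have "\<dots> n = (LBINT x. \<bar>f (x + h n) - f x\<bar>) + (LBINT x. \<bar>g (x + h n) - g x\<bar>)" for n
      using add(1,2) tr by (intro Bochner_Integration.integral_add Bochner_Integration.integrable_diff integrable_abs)
    finally show "\<forall>\<^sub>F n in sequentially. (LBINT x. \<bar>f (x + h n) + g (x + h n) - (f x + g x)\<bar>)
      \<le> (LBINT x. \<bar>f (x + h n) - f x\<bar>) + (LBINT x. \<bar>g (x + h n) - g x\<bar>)" by simp
  qed (auto intro!: always_eventually)
next
  case (lim f s)
  note [measurable] = borel_measurable_integrable[OF lim.hyps(1)] borel_measurable_integrable[OF lim.hyps(4)]
  have "(\<lambda>i. LBINT x. \<bar>s i x - f x\<bar>) \<longlonglongrightarrow> (\<integral>x. 0 \<partial>(lborel :: 'a measure))"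
  proof (rule integral_dominated_convergence[where w="\<lambda>x. 3 * \<bar>f x\<bar>"])
    show "integrable lborel (\<lambda>x. 3 * \<bar>f x\<bar>)" using lim.hyps(4) by auto
    show "AE x in lborel. (\<lambda>i. \<bar>s i x - f x\<bar>) \<longlonglongrightarrow> 0"
      using lim.hyps(2) by (auto intro!: AE_I2 tendsto_rabs_zero simp: LIM_zero_iff)
    show "AE x in lborel. norm \<bar>s i x - f x\<bar> \<le> 3 * \<bar>f x\<bar>" for i
    proof (rule AE_I2)
      fix x show "norm \<bar>s i x - f x\<bar> \<le> 3 * \<bar>f x\<bar>" using lim.hyps(3)[of x i] by simp
    qed
  qed auto
  then have conv: "(\<lambda>i. LBINT x. \<bar>s i x - f x\<bar>) \<longlonglongrightarrow> 0" by simp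
  show ?case
  proof (rule LIMSEQ_I)
    fix r :: real assume "0 < r"
    then obtain i where i: "\<bar>LBINT x. \<bar>s i x - f x\<bar>\<bar> < r / 3"
      using LIMSEQ_D[OF conv, of "r / 3"] by auto
    obtain N where N: "\<And>n. n \<ge> N \<Longrightarrow> \<bar>LBINT x. \<bar>s i (x + h n) - s i x\<bar>\<bar> < r / 3"
      using LIMSEQ_D[OF lim.IH, of "r / 3" i] \<open>0 < r\<close> by auto
    have "\<bar>LBINT x. \<bar>f (x + h n) - f x\<bar>\<bar> < r" if "n \<ge> N" for n
    proof -
      have d: "integrable lborel (\<lambda>x. \<bar>s i x - f x\<bar>)" using lim.hyps(1,4) by auto
      note tr = lborel_integrable_translate[OF lim.hyps(1)] lborel_integrable_translate[OF lim.hyps(4)] lborel_integrable_translate[OF d]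
      have "(LBINT x. \<bar>f (x + h n) - f x\<bar>)
          \<le> (LBINT x. \<bar>s i (x + h n) - s i x\<bar> + \<bar>s i (x + h n) - f (x + h n)\<bar> + \<bar>s i x - f x\<bar>)"
        using tr lim.hyps(1,4) by (intro integral_mono Bochner_Integration.integrable_add Bochner_Integration.integrable_diff
            integrable_abs) auto
      also have "\<dots> = (LBINT x. \<bar>s i (x + h n) - s i x\<bar>) + (LBINT x. \<bar>s i (x + h n) - f (x + h n)\<bar>)
          + (LBINT x. \<bar>s i x - f x\<bar>)"
        by (simp only: Bochner_Integration.integral_add Bochner_Integration.integrable_add
            integrable_abs Bochner_Integration.integrable_diff tr lim.hyps(1,4))
      also have "(LBINT x. \<bar>s i (x + h n) - f (x + h n)\<bar>) = (LBINT x. \<bar>s i x - f x\<bar>)"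
        by (rule lborel_integral_translate) auto
      finally show ?thesis using i N[OF that] by simp
    qed
    then show "\<exists>N. \<forall>n\<ge>N. norm ((LBINT x. \<bar>f (x + h n) - f x\<bar>) - 0) < r" by auto
  qed
qed

text \<open>Uniform over all small shifts, as needed for averaging against an arbitrary kernel of
  small support.\<close>

lemma L1_translation_continuous:
  fixes f :: "'a::euclidean_space \<Rightarrow> real"
  assumes f: "integrable lborel f" and "0 < e"
  shows "\<exists>d>0. \<forall>h. norm h < d \<longrightarrow> (LBINT x. \<bar>f (x + h) - f x\<bar>) < e"
proof (rule ccontr)
  assume "\<not> ?thesis"
  then have "\<forall>n. \<exists>h. norm h < 1 / real (Suc n) \<and> \<not> (LBINT x. \<bar>f (x + h) - f x\<bar>) < e"
    by (metis of_nat_0_less_iff zero_less_Suc zero_less_divide_1_iff)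
  then obtain h where h: "\<And>n. norm (h n) < 1 / real (Suc n)" "\<And>n. \<not> (LBINT x. \<bar>f (x + h n) - f x\<bar>) < e"
    by metis
  have "h \<longlonglongrightarrow> 0"
    by (rule Lim_null_comparison[OF _ LIMSEQ_inverse_real_of_nat])
      (use h(1) in \<open>auto intro!: always_eventually less_imp_le simp: inverse_eq_divide\<close>)
  from LIMSEQ_D[OF L1_translation[OF f this] \<open>0 < e\<close>] h(2) show False
    by (metis abs_ge_self diff_zero le_less_trans order.refl real_norm_def)
qed

lemma Fubini_lborel:
  fixes f :: "'a::euclidean_space \<times> 'b::euclidean_space \<Rightarrow> real"
  assumes "integrable lborel f"
  shows "(LBINT x. (LBINT y. f (x, y))) = (LBINT z. f z)"
    and "(LBINT y. (LBINT x. f (x, y))) = (LBINT z. f z)"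
    and "integrable lborel (\<lambda>x. LBINT y. f (x, y))"
    and "integrable lborel (\<lambda>y. LBINT x. f (x, y))"
proof -
  have f: "integrable (lborel \<Otimes>\<^sub>M lborel) f" using assms by (simp add: lborel_prod)
  show "(LBINT x. (LBINT y. f (x, y))) = (LBINT z. f z)"
    using lborel_pair.integral_fst'[OF f] by (simp add: lborel_prod)
  show "(LBINT y. (LBINT x. f (x, y))) = (LBINT z. f z)"
    using lborel_pair.integral_snd[of "\<lambda>x y. f (x, y)"] f by (simp add: lborel_prod case_prod_eta)
  show "integrable lborel (\<lambda>x. LBINT y. f (x, y))"
    using lborel_pair.integrable_fst'[OF f] .
  show "integrable lborel (\<lambda>y. LBINT x. f (x, y))"
    using lborel_pair.integrable_snd[of "\<lambda>x y. f (x, y)"] f by (simp add: case_prod_eta)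
qed

lemma distr_reflect_snd:
  assumes "s = 1 \<or> s = (-1 :: real)"
  shows "distr lborel borel (\<lambda>z :: real \<times> real. (fst z, s * snd z)) = lborel"
proof (cases "s = 1")
  case True
  then show ?thesis by (simp add: distr_id2)
next
  case False
  then have s: "s = -1" using assms by simp
  define c :: "real \<times> real \<Rightarrow> real" where "c = (\<lambda>j. if j = (0, 1) then - 1 else 1)"
  have B: "(Basis :: (real \<times> real) set) = {(1,0), (0,1)}" by (auto simp: Basis_prod_def)
  have "(\<lambda>z. 0 + (\<Sum>j\<in>Basis. (c j * (z \<bullet> j)) *\<^sub>R j)) = (\<lambda>z :: real \<times> real. (fst z, s * snd z))"
    by (auto simp: B c_def s inner_prod_def fun_eq_iff)
  then have "lborel = density (distr lborel borel (\<lambda>z :: real \<times> real. (fst z, s * snd z))) (\<lambda>_. \<Prod>j\<in>Basis. \<bar>c j\<bar>)"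
    using lborel_affine_euclidean[of c 0] by (simp add: c_def)
  also have "(\<Prod>j\<in>Basis. \<bar>c j\<bar>) = 1" by (simp add: B c_def)
  finally show ?thesis by (simp add: density_1 one_ennreal_def[symmetric])
qed

section \<open>Approximate identities\<close>

lemma borel_measurable_fst [measurable (raw)]:
  fixes f :: "'c \<Rightarrow> 'a::euclidean_space \<times> 'b::euclidean_space"
  assumes "f \<in> borel_measurable M" shows "(\<lambda>x. fst (f x)) \<in> borel_measurable M"
  using measurable_compose[OF assms borel_measurable_continuous_onI[OF continuous_on_fst[OF continuous_on_id]]] .

lemma borel_measurable_snd [measurable (raw)]:
  fixes f :: "'c \<Rightarrow> 'a::euclidean_space \<times> 'b::euclidean_space"
  assumes "f \<in> borel_measurable M" shows "(\<lambda>x. snd (f x)) \<in> borel_measurable M"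
  using measurable_compose[OF assms borel_measurable_continuous_onI[OF continuous_on_snd[OF continuous_on_id]]] .

definition approx_id :: "real \<Rightarrow> ('a::euclidean_space \<Rightarrow> real) \<Rightarrow> bool" where
  "approx_id \<delta> K \<longleftrightarrow> has_bochner_integral lborel K 1 \<and> (\<exists>B. \<forall>h. K h \<le> B) \<and> (\<forall>h. 0 \<le> K h) \<and>
     (\<forall>h. K h \<noteq> 0 \<longrightarrow> norm h < \<delta>)"

text \<open>\<open>F\<close> is merely measurable, but it depends on its second argument only
  through \<open>v\<close>, in a Lipschitz way. After substituting \<open>w = z + h\<close>, the
  error is an average over \<open>h\<close> of the \<open>L1\<close> distance between
  \<open>v\<close> and its shift by \<open>h\<close>, localised to a ball. The threshold depends on
  \<open>F\<close> and \<open>v\<close> alone, hence serves every kernel of that support, whatever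
  its shape.\<close>

lemma approx_id_limit:
  fixes F :: "'a::euclidean_space \<times> 'a \<Rightarrow> real"
  assumes F[measurable]: "F \<in> borel_measurable borel" and v[measurable]: "v \<in> borel_measurable borel"
    and Fb: "\<And>p. \<bar>F p\<bar> \<le> M" and vb: "\<And>z. \<bar>v z\<bar> \<le> B"
    and S: "bounded S" and supp: "\<And>z w. z \<notin> S \<Longrightarrow> F (z, w) = 0"
    and lip: "\<And>z w. \<bar>F (z, w) - F (z, z)\<bar> \<le> C * \<bar>v w - v z\<bar>" and "0 < e"
  shows "\<exists>\<delta>>0. \<forall>K. approx_id \<delta> K \<longrightarrow>
     \<bar>(LBINT p. F p * K (snd p - fst p)) - (LBINT z. F (z, z))\<bar> \<le> e"
proof -
  \<comment> \<open>Made positive so that \<open>e / C'\<close> is a legitimate tolerance for every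
    \<open>C\<close>.\<close>
  define C' where "C' = max C 0 + 1"
  have C': "C' > 0" "C \<le> C'" by (auto simp: C'_def)
  obtain r where r: "0 < r" "S \<subseteq> ball 0 r"
    using S bounded_subset_ballD by blast
  \<comment> \<open>\<open>v\<close> need not be integrable. As \<open>z\<close> stays in the ball
    of radius \<open>r\<close> and shifts are shorter than 1, cutting off at \<open>r + 1\<close>
    does not change the values that occur.\<close>
  define g where "g z = v z * indicator (ball 0 (r + 1)) z" for z
  have "0 \<le> B" using vb[of undefined] by linarith
  then have gb: "\<bar>g z\<bar> \<le> B" for z using vb[of z] by (simp add: g_def indicator_def)
  have g_meas: "g \<in> borel_measurable borel" unfolding g_def[abs_def]
    by (intro borel_measurable_times v borel_measurable_indicator) simp
  have g: "integrable lborel g"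
    by (rule integrable_bounded_support[OF g_meas gb, where S="ball 0 (r + 1)"]) (simp_all add: g_def)
  obtain d where d: "d > 0" "\<And>h. norm h < d \<Longrightarrow> (LBINT x. \<bar>g (x + h) - g x\<bar>) < e / C'"
    using L1_translation_continuous[OF g, of "e / C'"] \<open>0 < e\<close> C' by auto
  have "\<bar>(LBINT p. F p * K (snd p - fst p)) - (LBINT z. F (z, z))\<bar> \<le> e"
    if K: "approx_id (min d 1) K" for K
  proof -
    have K1: "has_bochner_integral lborel K 1" and K0: "\<And>h. 0 \<le> K h"
      and Ks: "\<And>h. K h \<noteq> 0 \<Longrightarrow> norm h < min d 1" using K by (auto simp: approx_id_def)
    obtain BK where BK: "\<And>h. K h \<le> BK" using K by (auto simp: approx_id_def)
    have [measurable]: "K \<in> borel_measurable borel" using K1 by (auto simp: has_bochner_integral_iff)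
    have intK: "integrable lborel K" "(LBINT h. K h) = 1" using K1 by (auto simp: has_bochner_integral_iff)
    have M0: "0 \<le> M" using Fb[of undefined] by linarith
    have Sr: "F (z, w) = 0" if "z \<notin> ball 0 r" for z w
      using supp[of z w] that r(2) by blast
    have FK: "\<bar>F p * K h\<bar> \<le> M * BK" for p h
      unfolding abs_mult using Fb[of p] BK[of h] K0[of h] M0 by (intro mult_mono) auto
    have int1: "integrable lborel (\<lambda>p. F p * K (snd p - fst p))"
    proof (rule integrable_bounded_support[where S="ball 0 r \<times> ball 0 (r + 1)" and C="M * BK"])
      show "\<bar>F p * K (snd p - fst p)\<bar> \<le> M * BK" for p
        by (rule FK)
      show "bounded (ball (0::'a) r \<times> ball (0::'a) (r + 1))" by (intro bounded_Times bounded_ball)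
      fix p :: "'a \<times> 'a" assume p: "p \<notin> ball 0 r \<times> ball 0 (r + 1)"
      show "F p * K (snd p - fst p) = 0"
      proof (cases "K (snd p - fst p) = 0 \<or> fst p \<notin> ball 0 r")
        case True
        then show ?thesis using Sr[of "fst p" "snd p"] by auto
      next
        case False
        then have "norm (snd p - fst p) < 1" "norm (fst p) < r" using Ks by auto
        then have "norm (snd p) < r + 1" using norm_triangle_sub[of "snd p" "fst p"] by linarith
        then show ?thesis using p False by (cases p) auto
      qed
    qed measurable
    have int2: "integrable lborel (\<lambda>p. F (fst p, fst p + snd p) * K (snd p))"
    proof (rule integrable_bounded_support[where S="ball 0 r \<times> ball 0 1" and C="M * BK"])
      show "\<bar>F (fst p, fst p + snd p) * K (snd p)\<bar> \<le> M * BK" for p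
        by (rule FK)
      show "bounded (ball (0::'a) r \<times> ball (0::'a) 1)" by (intro bounded_Times bounded_ball)
      fix p :: "'a \<times> 'a" assume p: "p \<notin> ball 0 r \<times> ball 0 1"
      then show "F (fst p, fst p + snd p) * K (snd p) = 0"
        using Ks[of "snd p"] Sr[of "fst p"] by (cases p) auto
    qed measurable
    have int3: "integrable lborel (\<lambda>p. F (fst p, fst p) * K (snd p))"
    proof (rule integrable_bounded_support[where S="ball 0 r \<times> ball 0 1" and C="M * BK"])
      show "\<bar>F (fst p, fst p) * K (snd p)\<bar> \<le> M * BK" for p
        by (rule FK)
      show "bounded (ball (0::'a) r \<times> ball (0::'a) 1)" by (intro bounded_Times bounded_ball)
      fix p :: "'a \<times> 'a" assume p: "p \<notin> ball 0 r \<times> ball 0 1"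
      then show "F (fst p, fst p) * K (snd p) = 0"
        using Ks[of "snd p"] Sr[of "fst p"] by (cases p) auto
    qed measurable
    have intF: "integrable lborel (\<lambda>z. F (z, z + h))" for h
      by (rule integrable_bounded_support[where S="ball 0 r" and C=M]) (use Fb Sr in auto)
    have intF0: "integrable lborel (\<lambda>z. F (z, z))" using intF[of 0] by simp
    have "(LBINT p. F p * K (snd p - fst p)) = (LBINT z. LBINT w. F (z, w) * K (w - z))"
      using Fubini_lborel(1)[OF int1] by simp
    also have "\<dots> = (LBINT z. LBINT h. F (z, z + h) * K h)"
    proof (rule Bochner_Integration.integral_cong[OF refl])
      fix z
      show "(LBINT w. F (z, w) * K (w - z)) = (LBINT h. F (z, z + h) * K h)"
        using lborel_integral_translate[of "\<lambda>w. F (z, w) * K (w - z)" z] by (simp add: add.commute)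
    qed
    also have "\<dots> = (LBINT h. LBINT z. F (z, z + h) * K h)"
      using Fubini_lborel(1,2)[OF int2] by simp
    finally have e1: "(LBINT p. F p * K (snd p - fst p)) = (LBINT h. (LBINT z. F (z, z + h) * K h))" .
    have e2: "(LBINT z. F (z, z)) = (LBINT h. (LBINT z. F (z, z) * K h))"
      by (simp add: intK)
    have i1: "integrable lborel (\<lambda>h. LBINT z. F (z, z + h) * K h)"
      using Fubini_lborel(4)[OF int2] by simp
    have i2: "integrable lborel (\<lambda>h. LBINT z. F (z, z) * K h)"
      using Fubini_lborel(4)[OF int3] by simp
    have inner: "\<bar>(LBINT z. F (z, z + h) * K h) - (LBINT z. F (z, z) * K h)\<bar> \<le> e * K h" for h
    proof (cases "K h = 0")
      case False
      then have h: "norm h < d" "norm h < 1" using Ks[of h] by auto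
      have gi: "integrable lborel (\<lambda>z. \<bar>g (z + h) - g z\<bar>)"
        using g lborel_integrable_translate[OF g] by auto
      have "\<bar>(LBINT z. F (z, z + h)) - (LBINT z. F (z, z))\<bar> = \<bar>LBINT z. F (z, z + h) - F (z, z)\<bar>"
        using intF intF0 by simp
      also have "\<dots> \<le> (LBINT z. \<bar>F (z, z + h) - F (z, z)\<bar>)" by (rule integral_abs_bound)
      also have "\<dots> \<le> (LBINT z. C' * \<bar>g (z + h) - g z\<bar>)"
      proof (rule integral_mono)
        show "integrable lborel (\<lambda>z. \<bar>F (z, z + h) - F (z, z)\<bar>)" using intF intF0 by simp
        show "integrable lborel (\<lambda>z. C' * \<bar>g (z + h) - g z\<bar>)" using gi by simp
        fix z
        show "\<bar>F (z, z + h) - F (z, z)\<bar> \<le> C' * \<bar>g (z + h) - g z\<bar>"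
        proof (cases "z \<in> ball 0 r")
          case True
          then have "norm (z + h) < r + 1" using h(2) norm_triangle_ineq[of z h] by simp
          then have "g (z + h) = v (z + h)" "g z = v z" using True by (auto simp: g_def)
          moreover have "C * \<bar>v (z + h) - v z\<bar> \<le> C' * \<bar>v (z + h) - v z\<bar>" using C' by (intro mult_right_mono) auto
          ultimately show ?thesis using lip[of z "z + h"] by simp
        next
          case False
          then show ?thesis using Sr C' by simp
        qed
      qed
      also have "\<dots> \<le> e" using d(2)[OF h(1)] C'(1) by (simp add: field_simps)
      finally have "\<bar>(LBINT z. F (z, z + h)) - (LBINT z. F (z, z))\<bar> * K h \<le> e * K h"
        using K0 by (intro mult_right_mono)
      then show ?thesis using K0[of h] by (simp add: left_diff_distrib[symmetric] abs_mult)
    qed simp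
    have "\<bar>(LBINT h. (LBINT z. F (z, z + h) * K h) - (LBINT z. F (z, z) * K h))\<bar>
       \<le> (LBINT h. \<bar>(LBINT z. F (z, z + h) * K h) - (LBINT z. F (z, z) * K h)\<bar>)"
      by (rule integral_abs_bound)
    also have "\<dots> \<le> (LBINT h. e * K h)"
      by (intro integral_mono integrable_abs Bochner_Integration.integrable_diff i1 i2 integrable_mult_right intK inner)
    also have "\<dots> = e" by (simp add: intK)
    finally show ?thesis unfolding e1 e2 using i1 i2 by (simp only: Bochner_Integration.integral_diff)
  qed
  then show ?thesis using d(1) by (intro exI[of _ "min d 1"]) auto
qed

definition kn :: "real \<Rightarrow> real \<Rightarrow> real" where
  "kn e h = kern (h / e) / e"

lemma kn_borel [measurable]: "kn e \<in> borel_measurable borel"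
  unfolding kn_def[abs_def] by measurable

lemma kn_nonneg: "0 < e \<Longrightarrow> 0 \<le> kn e h"
  by (simp add: kn_def kern_nonneg)

lemma kn_eq_0: "0 < e \<Longrightarrow> h \<le> 0 \<or> e \<le> h \<Longrightarrow> kn e h = 0"
  by (auto simp: kn_def divide_nonpos_pos intro!: kern_eq_0)

lemma kn_integral:
  assumes "0 < e" shows "has_bochner_integral lborel (kn e) 1"
proof -
  have "has_bochner_integral lborel (\<lambda>x. kern (x / e)) e"
    using kern_integral lborel_has_bochner_integral_real_affine_iff[of "1/e" kern 1 0] assms by auto
  from has_bochner_integral_divide_zero[OF this, of e] show ?thesis
    using assms by (simp add: kn_def[abs_def])
qed

lemma approx_id_kn:
  assumes "0 < e" "e \<le> \<delta>"
  shows "approx_id \<delta> (kn e)"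
proof -
  obtain B where "\<And>x. kern x \<le> B" using kern_bounded by blast
  then have "\<exists>B. \<forall>h. kn e h \<le> B" using assms by (auto simp: kn_def divide_right_mono intro!: exI[of _ "B / e"])
  moreover have "norm h < \<delta>" if "kn e h \<noteq> 0" for h
  proof -
    have "\<not> (h \<le> 0 \<or> e \<le> h)" using kn_eq_0[OF assms(1)] that by blast
    then show ?thesis using assms(2) by simp
  qed
  ultimately show ?thesis using kn_integral kn_nonneg assms by (auto simp: approx_id_def)
qed

text \<open>The widths in time and in space are independent: the time width is later sent to 0 while
  the space width is kept fixed.\<close>

lemma approx_id_kn2:
  assumes "0 < e" "e \<le> \<delta> / 2" "0 < e'" "e' \<le> \<delta> / 2"
  shows "approx_id \<delta> (\<lambda>h. kn e (fst h) * kn e' (snd h))"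
proof -
  obtain B where B: "\<And>x. kern x \<le> B" using kern_bounded by blast
  have "0 \<le> B" using B[of 0] kern_nonneg[of 0] by linarith
  have le: "kn e h \<le> B / e" if "0 < e" for h e using that B by (simp add: kn_def divide_right_mono)
  have le2: "kn e (fst h) * kn e' (snd h) \<le> B / e * (B / e')" for h
    using assms le kn_nonneg \<open>0 \<le> B\<close> by (intro mult_mono) auto
  have supp: "norm h < \<delta>" if "kn e (fst h) * kn e' (snd h) \<noteq> 0" for h
  proof -
    have "\<not> (fst h \<le> 0 \<or> e \<le> fst h)" "\<not> (snd h \<le> 0 \<or> e' \<le> snd h)"
      using that kn_eq_0[OF assms(1), of "fst h"] kn_eq_0[OF assms(3), of "snd h"] by fastforce+
    then show ?thesis using norm_Pair_le[of "fst h" "snd h"] assms(2,4) by simp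
  qed
  have int: "integrable lborel (\<lambda>h. kn e (fst h) * kn e' (snd h))"
  proof (rule integrable_bounded_support[where S="ball 0 \<delta>" and C="B / e * (B / e')"])
    show "\<bar>kn e (fst x) * kn e' (snd x)\<bar> \<le> B / e * (B / e')" for x
      using le2 kn_nonneg assms by simp
  qed (use supp in \<open>auto simp: dist_norm\<close>)
  have "(LBINT h. kn e (fst h) * kn e' (snd h)) = 1"
    using Fubini_lborel(1)[OF int] kn_integral[OF assms(1)] kn_integral[OF assms(3)]
    by (simp add: has_bochner_integral_iff)
  with int have "has_bochner_integral lborel (\<lambda>h. kn e (fst h) * kn e' (snd h)) 1"
    by (simp add: has_bochner_integral_iff)
  moreover have "\<exists>C. \<forall>h. kn e (fst h) * kn e' (snd h) \<le> C" using le2 by blast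
  moreover have "0 \<le> kn e (fst h) * kn e' (snd h)" for h using kn_nonneg assms by simp
  ultimately show ?thesis using supp unfolding approx_id_def by blast
qed

section \<open>Test functions in product form\<close>

text \<open>One factor of a product test function. The interval may be empty, which admits the zero
  function for every \<open>\<Omega>\<close>.\<close>

definition test_fun :: "real set \<Rightarrow> (real \<Rightarrow> real) \<Rightarrow> bool" where
  "test_fun \<Omega> \<phi> \<longleftrightarrow> (\<forall>k. Ck k \<phi>) \<and> (\<forall>x. 0 \<le> \<phi> x) \<and> (\<exists>c d. {c..d} \<subseteq> \<Omega> \<and> (\<forall>x. x \<notin> {c..d} \<longrightarrow> \<phi> x = 0))"

lemma Ck_1D:
  assumes "Ck (Suc 0) \<phi>"
  shows "(\<phi> has_real_derivative deriv \<phi> x) (at x)" "continuous_on UNIV (deriv \<phi>)" "continuous_on UNIV \<phi>"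
proof -
  obtain \<phi>' where \<phi>': "\<And>x. (\<phi> has_real_derivative \<phi>' x) (at x)" "Ck 0 \<phi>'" using assms Ck_SucE by blast
  have "deriv \<phi> = \<phi>'" using \<phi>' by (auto intro: DERIV_imp_deriv)
  with \<phi>' show "(\<phi> has_real_derivative deriv \<phi> x) (at x)" "continuous_on UNIV (deriv \<phi>)" by auto
  show "continuous_on UNIV \<phi>" using Ck_Suc_imp_Ck[OF assms] by simp
qed

lemma deriv_eq_0_outside:
  fixes \<phi> :: "real \<Rightarrow> real"
  assumes "\<And>x. x \<notin> {c..d} \<Longrightarrow> \<phi> x = 0" "x \<notin> {c..d}"
  shows "deriv \<phi> x = 0"
proof (rule DERIV_imp_deriv)
  have "((\<lambda>_. 0) has_real_derivative 0) (at x)" by simp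
  then show "(\<phi> has_real_derivative 0) (at x)"
    by (rule has_field_derivative_transform_within_open[where S="- {c..d}"]) (use assms in auto)
qed

lemma test_funD:
  assumes "test_fun \<Omega> \<phi>"
  shows "(\<phi> has_real_derivative deriv \<phi> x) (at x)" "continuous_on UNIV (deriv \<phi>)" "continuous_on UNIV \<phi>"
    "0 \<le> \<phi> x" "Ck k \<phi>" "\<phi> \<in> borel_measurable borel" "deriv \<phi> \<in> borel_measurable borel"
proof -
  have 1: "Ck (Suc 0) \<phi>" using assms unfolding test_fun_def by blast
  show "(\<phi> has_real_derivative deriv \<phi> x) (at x)" "continuous_on UNIV (deriv \<phi>)" "continuous_on UNIV \<phi>"
    using Ck_1D[OF 1] by auto
  then show "\<phi> \<in> borel_measurable borel" "deriv \<phi> \<in> borel_measurable borel"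
    by (auto intro: borel_measurable_continuous_onI)
  show "0 \<le> \<phi> x" "Ck k \<phi>" using assms unfolding test_fun_def by auto
qed

lemma test_fun_support:
  assumes "test_fun \<Omega> \<phi>"
  shows "\<exists>c d. {c..d} \<subseteq> \<Omega> \<and> (\<forall>x. x \<notin> {c..d} \<longrightarrow> \<phi> x = 0 \<and> deriv \<phi> x = 0)"
proof -
  obtain c d where cd: "{c..d} \<subseteq> \<Omega>" "\<And>x. x \<notin> {c..d} \<Longrightarrow> \<phi> x = 0"
    using assms unfolding test_fun_def by blast
  show ?thesis using cd deriv_eq_0_outside[of c d \<phi>] by blast
qed

lemma test_funI:
  assumes "\<And>k. Ck k \<phi>" "\<And>x. 0 \<le> \<phi> x" "{c..d} \<subseteq> \<Omega>" "\<And>x. x \<notin> {c..d} \<Longrightarrow> \<phi> x = 0"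
  shows "test_fun \<Omega> \<phi>"
  using assms unfolding test_fun_def by blast

lemma test_fun_mult:
  assumes "test_fun \<Omega> \<phi>" "\<And>k. Ck k \<psi>" "\<And>x. 0 \<le> \<psi> x"
  shows "test_fun \<Omega> (\<lambda>x. \<phi> x * \<psi> x)"
proof -
  obtain c d where cd: "{c..d} \<subseteq> \<Omega>" "\<And>x. x \<notin> {c..d} \<Longrightarrow> \<phi> x = 0"
    using test_fun_support[OF assms(1)] by blast
  show ?thesis
  proof (rule test_funI[OF _ _ cd(1)])
    show "Ck k (\<lambda>x. \<phi> x * \<psi> x)" for k by (intro Ck_mult assms(2) test_funD(5)[OF assms(1)])
    show "0 \<le> \<phi> x * \<psi> x" for x using assms(3) test_funD(4)[OF assms(1)] by simp
    show "x \<notin> {c..d} \<Longrightarrow> \<phi> x * \<psi> x = 0" for x using cd(2)[of x] by simp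
  qed
qed

definition kn' :: "real \<Rightarrow> real \<Rightarrow> real" where
  "kn' e h = deriv kern (h / e) / e / e"

lemma kn_deriv: "(kn e has_real_derivative kn' e h) (at h)"
proof -
  have "((\<lambda>h. kern (h / e)) has_real_derivative deriv kern (h / e) * (1 / e)) (at h)"
    by (rule DERIV_chain2[OF Ck_1D(1)[OF Ck_kern]]) (rule DERIV_cdivide[OF DERIV_ident])
  from DERIV_cdivide[OF this, of e] show ?thesis by (simp add: kn_def[abs_def] kn'_def)
qed

lemma continuous_kn: "continuous_on UNIV (kn e)" "continuous_on UNIV (kn' e)"
proof -
  show "continuous_on UNIV (kn e)"
    using kn_deriv by (auto intro!: continuous_at_imp_continuous_on DERIV_isCont)
  show "continuous_on UNIV (kn' e)"
    unfolding kn'_def[abs_def] divide_inverse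
    by (intro continuous_intros continuous_on_compose2[OF Ck_1D(2)[OF Ck_kern]]) auto
qed

lemma Ck_kn: "Ck k (\<lambda>h. kn e (c * h + d))"
proof -
  have "Ck k (\<lambda>h. kern (1 / e * h + 0) * (1 / e))" by (intro Ck_mult Ck_const Ck_affine Ck_kern)
  then have "Ck k (kn e)" by (simp add: kn_def[abs_def])
  then show ?thesis by (rule Ck_affine)
qed

lemma kn'_eq_0:
  assumes "0 < e" "h < 0 \<or> e < h" shows "kn' e h = 0"
proof -
  have "h / e \<notin> {0..1}" using assms by (auto simp: field_simps)
  then have "deriv kern (h / e) = 0" using kern_eq_0 by (intro deriv_eq_0_outside[of 0 1]) auto
  then show ?thesis by (simp add: kn'_def)
qed

text \<open>An entropy inequality with density \<open>E\<close>, flux \<open>H\<close> and initial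
  density \<open>E0\<close>, abstract enough to hold for one solution against a constant as well as
  for two solutions against each other. The restriction to \<open>\<Omega>\<close> is imposed by the
  support of \<open>\<beta>\<close>, so \<open>E\<close> and \<open>H\<close> may live on the whole
  plane.\<close>

definition pos_ineq :: "real set \<Rightarrow> (real \<times> real \<Rightarrow> real) \<Rightarrow> (real \<times> real \<Rightarrow> real) \<Rightarrow> (real \<Rightarrow> real) \<Rightarrow> bool" where
  "pos_ineq \<Omega> E H E0 \<longleftrightarrow> (\<forall>\<alpha> \<beta>. test_fun UNIV \<alpha> \<longrightarrow> test_fun \<Omega> \<beta> \<longrightarrow>
     0 \<le> (LBINT z. indicator {0<..} (fst z) *
            (E z * (deriv \<alpha> (fst z) * \<beta> (snd z)) + H z * (\<alpha> (fst z) * deriv \<beta> (snd z))))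
         + \<alpha> 0 * (LBINT x. E0 x * \<beta> x))"

lemma integrable_mult_continuous:
  fixes g :: "'a::euclidean_space \<Rightarrow> real"
  assumes "a \<in> borel_measurable borel" "\<And>z. \<bar>a z\<bar> \<le> C" and g: "continuous_on UNIV g"
    and S: "bounded S" "\<And>z. z \<notin> S \<Longrightarrow> g z = 0"
  shows "integrable lborel (\<lambda>z. a z * g z)"
proof -
  obtain p q where pq: "S \<subseteq> cbox p q" using bounded_subset_cbox_symmetric[OF S(1)] by blast
  have "bounded (g ` cbox p q)"
    using g by (intro compact_imp_bounded compact_continuous_image) (auto intro: continuous_on_subset)
  then obtain B where B: "\<And>z. z \<in> cbox p q \<Longrightarrow> \<bar>g z\<bar> \<le> B" unfolding bounded_iff by auto
  have [measurable]: "g \<in> borel_measurable borel" using g by (rule borel_measurable_continuous_onI)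
  show ?thesis
  proof (rule integrable_bounded_support[where S="cbox p q" and C="C * max B 0"])
    fix z
    have g0: "g z = 0" if "z \<notin> cbox p q" using that pq S(2) by blast
    have gB: "\<bar>g z\<bar> \<le> max B 0"
    proof (cases "z \<in> cbox p q")
      case True
      then show ?thesis using B[of z] by simp
    qed (simp add: g0)
    show "\<bar>a z * g z\<bar> \<le> C * max B 0"
      unfolding abs_mult using assms(2)[of z] gB by (intro mult_mono) auto
    show "z \<notin> cbox p q \<Longrightarrow> a z * g z = 0" using g0 by simp
  qed (use assms in auto)
qed

section \<open>Doubling of variables\<close>

lemma pos_ineqD:
  assumes "pos_ineq \<Omega> E H E0" "test_fun UNIV \<alpha>" "test_fun \<Omega> \<beta>"
    and "\<And>t. (\<alpha> has_real_derivative \<alpha>' t) (at t)" "\<And>x. (\<beta> has_real_derivative \<beta>' x) (at x)"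
  shows "0 \<le> (LBINT z. indicator {0<..} (fst z) *
            (E z * (\<alpha>' (fst z) * \<beta> (snd z)) + H z * (\<alpha> (fst z) * \<beta>' (snd z))))
         + \<alpha> 0 * (LBINT x. E0 x * \<beta> x)"
proof -
  have "deriv \<alpha> = \<alpha>'" "deriv \<beta> = \<beta>'" by (rule ext, rule DERIV_imp_deriv, rule assms)+
  moreover note assms(1)[unfolded pos_ineq_def, rule_format, OF assms(2,3)]
  ultimately show ?thesis by simp
qed

lemma test_fun_bounded:
  assumes "test_fun \<Omega> \<phi>"
  shows "\<exists>C\<ge>0. \<forall>x. \<bar>\<phi> x\<bar> \<le> C \<and> \<bar>deriv \<phi> x\<bar> \<le> C"
proof -
  obtain c d where cd: "\<forall>x. x \<notin> {c..d} \<longrightarrow> \<phi> x = 0 \<and> deriv \<phi> x = 0"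
    using test_fun_support[OF assms] by blast
  have "bounded (\<phi> ` {c..d})" "bounded (deriv \<phi> ` {c..d})"
    using test_funD(2,3)[OF assms]
    by (auto intro!: compact_imp_bounded compact_continuous_image intro: continuous_on_subset)
  then obtain C1 C2 where C: "\<forall>x\<in>{c..d}. \<bar>\<phi> x\<bar> \<le> C1" "\<forall>x\<in>{c..d}. \<bar>deriv \<phi> x\<bar> \<le> C2"
    unfolding bounded_iff by auto
  show ?thesis
  proof (intro exI[of _ "max 0 (max C1 C2)"] conjI allI)
    fix x
    show "\<bar>\<phi> x\<bar> \<le> max 0 (max C1 C2)" "\<bar>deriv \<phi> x\<bar> \<le> max 0 (max C1 C2)"
      using C cd by (cases "x \<in> {c..d}"; force)+
  qed simp
qed

lemma borel_measurable_Q [measurable (raw)]: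
  assumes "continuous_on UNIV f" "a \<in> borel_measurable M" "b \<in> borel_measurable M"
  shows "(\<lambda>x. Q f (a x) (b x)) \<in> borel_measurable M"
proof -
  have [measurable]: "f \<in> borel_measurable borel" using assms(1) by (rule borel_measurable_continuous_onI)
  note [measurable] = assms(2,3)
  show ?thesis unfolding Q_def by measurable
qed

lemma continuous_on_compose_UNIV:
  "continuous_on UNIV g \<Longrightarrow> continuous_on S f \<Longrightarrow> continuous_on S (\<lambda>x. g (f x))"
  by (rule continuous_on_compose2) auto

text \<open>Two solutions on a road reflected to the positive half-line, as Borel functions on the
  whole plane. The bounds hold everywhere, so the doubling argument meets no null sets.\<close>

locale kruzhkov_pair =
  fixes f :: "real \<Rightarrow> real" and L B :: real and u1 u2 :: "real \<times> real \<Rightarrow> real" and v1 v2 :: "real \<Rightarrow> real"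
  assumes lip: "L-lipschitz_on UNIV f"
    and meas: "u1 \<in> borel_measurable borel" "u2 \<in> borel_measurable borel"
      "v1 \<in> borel_measurable borel" "v2 \<in> borel_measurable borel"
    and bd: "\<And>z. \<bar>u1 z\<bar> \<le> B" "\<And>z. \<bar>u2 z\<bar> \<le> B" "\<And>x. \<bar>v1 x\<bar> \<le> B" "\<And>x. \<bar>v2 x\<bar> \<le> B"
    and sol1: "\<And>k. pos_ineq {0<..} (\<lambda>z. \<bar>u1 z - k\<bar>) (\<lambda>z. Q f (u1 z) k) (\<lambda>x. \<bar>v1 x - k\<bar>)"
    and sol2: "\<And>k. pos_ineq {0<..} (\<lambda>z. \<bar>u2 z - k\<bar>) (\<lambda>z. Q f (u2 z) k) (\<lambda>x. \<bar>v2 x - k\<bar>)"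
begin

declare meas [measurable]

lemma L_nonneg: "0 \<le> L" using lip lipschitz_on_nonneg by blast

lemma B_nonneg: "0 \<le> B" using bd(3)[of 0] by linarith

lemma cont_f: "continuous_on UNIV f" using lip by (rule lipschitz_on_continuous_on)

lemma meas_Q [measurable (raw)]:
  "a \<in> borel_measurable M \<Longrightarrow> b \<in> borel_measurable M \<Longrightarrow> (\<lambda>x. Q f (a x) (b x)) \<in> borel_measurable M"
  by (rule borel_measurable_Q[OF cont_f])

lemma diff_bound: "\<bar>a\<bar> \<le> B \<Longrightarrow> \<bar>b\<bar> \<le> B \<Longrightarrow> \<bar>a - b\<bar> \<le> 2 * B" by linarith

lemma Q_bound: "\<bar>a\<bar> \<le> B \<Longrightarrow> \<bar>b\<bar> \<le> B \<Longrightarrow> \<bar>Q f a b\<bar> \<le> L * (2 * B)"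
  using Q_le[OF lip, of a b] mult_left_mono[OF diff_bound L_nonneg, of a b] by linarith

context
  fixes \<alpha> \<beta> :: "real \<Rightarrow> real"
  assumes \<alpha>: "test_fun UNIV \<alpha>" and \<beta>: "test_fun {0<..} \<beta>"
begin

text \<open>With \<open>Z = ((t, x), (s, y))\<close>: what survives of the doubled inequality when
  the derivatives of the kernel have cancelled.\<close>

definition "core e v Z = indicator {0<..} (fst (fst Z)) *
    (\<bar>u1 (fst Z) - u2 (snd Z)\<bar> * (deriv \<alpha> (fst (fst Z)) * \<beta> (snd (fst Z)))
      + Q f (u1 (fst Z)) (u2 (snd Z)) * (\<alpha> (fst (fst Z)) * deriv \<beta> (snd (fst Z))))
    * (kn e (fst (snd Z - fst Z)) * kn v (snd (snd Z - fst Z)))"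
  for Z :: "(real \<times> real) \<times> (real \<times> real)"

text \<open>With \<open>p = ((s, y), x)\<close>: the flux term that appears when the second
  solution, on the short time interval \<open>[0, e]\<close>, is compared with the constant
  \<open>v1 x\<close>.\<close>

definition "rest e v p = indicator {0<..} (fst (fst p)) * Q f (u2 (fst p)) (v1 (snd p))
    * ((1 - step (fst (fst p) / e)) * \<beta> (snd p) * kn' v (snd (fst p) - snd p))"
  for p :: "(real \<times> real) \<times> real"

text \<open>With \<open>p = (x, y)\<close>: the distance of the two data, still doubled in
  space.\<close>

definition "init v p = \<bar>v2 (snd p) - v1 (fst p)\<bar> * \<beta> (fst p) * kn v (snd p - fst p)"
  for p :: "real \<times> real"

lemma rest_borel: "rest e v \<in> borel_measurable borel"
proof -
  have [measurable]: "kn' v \<in> borel_measurable borel" by (rule borel_measurable_continuous_onI[OF continuous_kn(2)])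
  note [measurable] = test_funD(6)[OF \<beta>]
  show ?thesis unfolding rest_def[abs_def] by measurable
qed

text \<open>The majorant depends on \<open>v\<close> through \<open>kn' v\<close>, but not on
  \<open>e\<close>. This dictates the order of the limits: first the time width, for a fixed space
  width.\<close>

lemma rest_dominated:
  assumes v: "0 < v"
  shows "\<exists>w. integrable lborel w \<and> (\<forall>e p. 0 < e \<longrightarrow> e \<le> 1 \<longrightarrow> \<bar>rest e v p\<bar> \<le> w p)"
proof -
  obtain c d where cd: "\<forall>x. x \<notin> {c..d} \<longrightarrow> \<beta> x = 0 \<and> deriv \<beta> x = 0"
    using test_fun_support[OF \<beta>] by blast
  obtain C where C: "0 \<le> C" "\<forall>x. \<bar>\<beta> x\<bar> \<le> C \<and> \<bar>deriv \<beta> x\<bar> \<le> C" using test_fun_bounded[OF \<beta>] by blast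
  have "bounded (kn' v ` {0..v})"
    by (intro compact_imp_bounded compact_continuous_image continuous_on_subset[OF continuous_kn(2)]) auto
  then obtain D where D: "\<forall>h\<in>{0..v}. \<bar>kn' v h\<bar> \<le> D" unfolding bounded_iff by auto
  have knv: "kn' v h = 0" if "h \<notin> {0..v}" for h using kn'_eq_0[OF v] that by auto
  have D': "\<bar>kn' v h\<bar> \<le> max D 0" for h
  proof (cases "h \<in> {0..v}")
    case True
    then have "\<bar>kn' v h\<bar> \<le> D" using D by blast
    then show ?thesis by simp
  qed (simp add: knv)
  define T where "T = cbox ((0 :: real, c), c) ((1, d + v), d)"
  define K where "K = L * (2 * B) * (1 * C * max D 0)"
  have "integrable lborel (\<lambda>p. K * indicator T p)"
    unfolding T_def
    by (intro integrable_mult_right integrable_real_indicator)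
      (auto simp: emeasure_lborel_cbox_finite[unfolded infinity_ennreal_def])
  moreover have "\<bar>rest e v p\<bar> \<le> K * indicator T p" if e: "0 < e" "e \<le> 1" for e p
  proof (cases "p \<in> T")
    case True
    have 1: "\<bar>1 - step (fst (fst p) / e)\<bar> \<le> 1" using step_bounds[of "fst (fst p) / e"] by simp
    have 2: "\<bar>indicator {0<..} (fst (fst p)) * Q f (u2 (fst p)) (v1 (snd p))\<bar> \<le> L * (2 * B)"
      using Q_bound[OF bd(2,3), of "fst p" "snd p"] L_nonneg B_nonneg by (auto simp: indicator_def)
    have 3: "\<bar>\<beta> (snd p)\<bar> \<le> C" using C by blast
    have "\<bar>(1 - step (fst (fst p) / e)) * \<beta> (snd p) * kn' v (snd (fst p) - snd p)\<bar> \<le> 1 * C * max D 0"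
      unfolding abs_mult using C(1) by (intro mult_mono 1 3 D' mult_nonneg_nonneg) auto
    then have "\<bar>rest e v p\<bar> \<le> K"
      unfolding K_def rest_def abs_mult[of "indicator {0<..} (fst (fst p)) * Q f (u2 (fst p)) (v1 (snd p))"]
      using L_nonneg B_nonneg by (intro mult_mono[OF 2]) auto
    then show ?thesis using True by simp
  next
    case False
    then have "fst (fst p) \<notin> {0..1} \<or> snd p \<notin> {c..d} \<or> snd (fst p) - snd p \<notin> {0..v}"
      by (cases p) (auto simp: T_def cbox_Pair_eq)
    moreover have "rest e v p = 0" if "fst (fst p) \<notin> {0..1}"
    proof -
      have "fst (fst p) \<le> 0 \<or> fst (fst p) / e \<ge> 1" using that e by auto
      then show ?thesis using step_1[of "fst (fst p) / e"] by (auto simp: rest_def)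
    qed
    ultimately have "rest e v p = 0"
      using cd[rule_format, of "snd p"] knv[of "snd (fst p) - snd p"] by (auto simp: rest_def)
    then show ?thesis using False by simp
  qed
  ultimately show ?thesis by blast
qed

lemma rest_tendsto_0:
  assumes v: "0 < v" and e: "\<And>n. 0 < e n" "\<And>n. e n \<le> 1" "e \<longlonglongrightarrow> 0"
  shows "(\<lambda>n. LBINT p. rest (e n) v p) \<longlonglongrightarrow> 0"
proof -
  obtain w where w: "integrable lborel w" "\<And>e p. 0 < e \<Longrightarrow> e \<le> 1 \<Longrightarrow> \<bar>rest e v p\<bar> \<le> w p"
    using rest_dominated[OF v] by blast
  have "(\<lambda>n. LBINT p. rest (e n) v p) \<longlonglongrightarrow> (\<integral>p. 0 \<partial>(lborel :: ((real \<times> real) \<times> real) measure))"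
  proof (rule integral_dominated_convergence[OF _ _ w(1)])
    show "AE p in lborel. (\<lambda>n. rest (e n) v p) \<longlonglongrightarrow> 0"
    proof (rule AE_I2)
      fix p :: "(real \<times> real) \<times> real"
      show "(\<lambda>n. rest (e n) v p) \<longlonglongrightarrow> 0"
      proof (cases "0 < fst (fst p)")
        case True
        have "eventually (\<lambda>n. e n < fst (fst p)) sequentially"
          using order_tendstoD(2)[OF e(3) True] .
        then have "eventually (\<lambda>n. rest (e n) v p = 0) sequentially"
        proof eventually_elim
          case (elim n)
          then have "1 \<le> fst (fst p) / e n" using e(1)[of n] by simp
          then show ?case using step_1 by (simp add: rest_def)
        qed
        then show ?thesis by (rule tendsto_eventually)
      qed (simp add: rest_def)
    qed
    show "AE p in lborel. norm (rest (e n) v p) \<le> w p" for n using w(2)[OF e(1,2)] by simp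
  qed (use rest_borel in auto)
  then show ?thesis by simp
qed

lemma doubling_inequality:
  assumes e: "0 < e" and e1: "e \<le> 1" and v: "0 < v"
  shows "0 \<le> (LBINT Z. core e v Z) + \<alpha> 0 * ((LBINT p. rest e v p) + (LBINT p. init v p))"
proof -
  note [measurable] = test_funD(6,7)[OF \<alpha>] test_funD(6,7)[OF \<beta>]
  note cont[continuous_intros] = continuous_on_compose_UNIV[OF test_funD(2)[OF \<alpha>]] continuous_on_compose_UNIV[OF test_funD(3)[OF \<alpha>]]
     continuous_on_compose_UNIV[OF test_funD(2)[OF \<beta>]] continuous_on_compose_UNIV[OF test_funD(3)[OF \<beta>]]
     continuous_on_compose_UNIV[OF continuous_kn(1)] continuous_on_compose_UNIV[OF continuous_kn(2)]
     continuous_on_compose_UNIV[OF Ck.simps(1)[THEN iffD1, OF Ck_step]]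
  obtain p q where pq: "\<forall>x. x \<notin> {p..q} \<longrightarrow> \<alpha> x = 0 \<and> deriv \<alpha> x = 0"
    using test_fun_support[OF \<alpha>] by blast
  obtain c d where cd0: "{c..d} \<subseteq> {0<..}" and cd: "\<forall>x. x \<notin> {c..d} \<longrightarrow> \<beta> x = 0 \<and> deriv \<beta> x = 0"
    using test_fun_support[OF \<beta>] by blast
  let ?t = "\<lambda>Z :: (real \<times> real) \<times> (real \<times> real). fst (fst Z)" and ?x = "\<lambda>Z :: (real \<times> real) \<times> (real \<times> real). snd (fst Z)"
  let ?s = "\<lambda>Z :: (real \<times> real) \<times> (real \<times> real). fst (snd Z)" and ?y = "\<lambda>Z :: (real \<times> real) \<times> (real \<times> real). snd (snd Z)"
  define S where "S = ({p..q} \<times> {c..d}) \<times> ({p..q+e} \<times> {c..d+v})"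
  have bS: "bounded S" unfolding S_def by (intro bounded_Times) auto
  have kne: "kn e h = 0 \<and> kn' e h = 0" if "h \<notin> {0..e}" for h using kn_eq_0[OF e] kn'_eq_0[OF e] that by auto
  have knv: "kn v h = 0 \<and> kn' v h = 0" if "h \<notin> {0..v}" for h using kn_eq_0[OF v] kn'_eq_0[OF v] that by auto
  \<comment> \<open>Both time indicators are included so that the same integrands serve both
    solutions.\<close>
  define a where "a Z = indicator {0<..} (?t Z) * indicator {0<..} (?s Z) * \<bar>u1 (fst Z) - u2 (snd Z)\<bar>" for Z
  define b where "b Z = indicator {0<..} (?t Z) * indicator {0<..} (?s Z) * Q f (u1 (fst Z)) (u2 (snd Z))" for Z
  have ma: "a \<in> borel_measurable borel" unfolding a_def[abs_def] by measurable
  have mb: "b \<in> borel_measurable borel" unfolding b_def[abs_def] by measurable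
  have ba: "\<bar>a Z\<bar> \<le> 2 * B" for Z
    using diff_bound[OF bd(1,2), of "fst Z" "snd Z"] B_nonneg by (auto simp: a_def indicator_def)
  have bb: "\<bar>b Z\<bar> \<le> L * (2 * B)" for Z
    using Q_bound[OF bd(1,2), of "fst Z" "snd Z"] B_nonneg L_nonneg by (auto simp: b_def indicator_def)
  define g1 where "g1 Z = deriv \<alpha> (?t Z) * kn e (?s Z - ?t Z) * (\<beta> (?x Z) * kn v (?y Z - ?x Z))" for Z
  define g2 where "g2 Z = \<alpha> (?t Z) * kn' e (?s Z - ?t Z) * (\<beta> (?x Z) * kn v (?y Z - ?x Z))" for Z
  define g3 where "g3 Z = \<alpha> (?t Z) * kn e (?s Z - ?t Z) * (deriv \<beta> (?x Z) * kn v (?y Z - ?x Z))" for Z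
  define g4 where "g4 Z = \<alpha> (?t Z) * kn e (?s Z - ?t Z) * (\<beta> (?x Z) * kn' v (?y Z - ?x Z))" for Z
  have cg: "continuous_on UNIV g1" "continuous_on UNIV g2" "continuous_on UNIV g3" "continuous_on UNIV g4"
    unfolding g1_def[abs_def] g2_def[abs_def] g3_def[abs_def] g4_def[abs_def] by (intro continuous_intros)+
  have sg: "g1 Z = 0 \<and> g2 Z = 0 \<and> g3 Z = 0 \<and> g4 Z = 0" if "Z \<notin> S" for Z
  proof -
    have "?t Z \<notin> {p..q} \<or> ?x Z \<notin> {c..d} \<or> ?s Z - ?t Z \<notin> {0..e} \<or> ?y Z - ?x Z \<notin> {0..v}"
      using that by (cases Z) (auto simp: S_def)
    then show ?thesis
      using pq[rule_format, of "?t Z"] cd[rule_format, of "?x Z"] kne[of "?s Z - ?t Z"] knv[of "?y Z - ?x Z"]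
      by (auto simp: g1_def g2_def g3_def g4_def)
  qed
  have ia: "integrable lborel (\<lambda>Z. a Z * g1 Z)" "integrable lborel (\<lambda>Z. a Z * g2 Z)"
    by (rule integrable_mult_continuous[OF ma ba _ bS]; use cg sg in blast)+
  have ib: "integrable lborel (\<lambda>Z. b Z * g3 Z)" "integrable lborel (\<lambda>Z. b Z * g4 Z)"
    by (rule integrable_mult_continuous[OF mb bb _ bS]; use cg sg in blast)+
  define N1 where "N1 Z = (a Z * g1 Z - a Z * g2 Z) + (b Z * g3 Z - b Z * g4 Z)" for Z
  define N2 where "N2 Z = a Z * g2 Z + b Z * g4 Z" for Z
  have iN: "integrable lborel N1" "integrable lborel N2"
    unfolding N1_def[abs_def] N2_def[abs_def] using ia ib by auto
  \<comment> \<open>The initial term of the first solution: the kernel at \<open>t = 0\<close>, with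
    \<open>p = ((s, y), x)\<close>.\<close>
  define M where "M p = indicator {0<..} (fst (fst p)) * \<bar>v1 (snd p) - u2 (fst p)\<bar>
      * (kn e (fst (fst p)) * (\<beta> (snd p) * kn v (snd (fst p) - snd p)))" for p :: "(real \<times> real) \<times> real"
  define T where "T = ({0..e} \<times> {c..d+v}) \<times> {c..d}"
  have bT: "bounded T" unfolding T_def by (intro bounded_Times) auto
  have outT: "fst (fst p) \<notin> {0..e} \<or> snd p \<notin> {c..d} \<or> snd (fst p) - snd p \<notin> {0..v}" if "p \<notin> T" for p
    using that by (cases p) (auto simp: T_def)
  have iM: "integrable lborel M"
    unfolding M_def[abs_def]
  proof (rule integrable_mult_continuous[OF _ _ _ bT, where C="2 * B"])
    fix p :: "(real \<times> real) \<times> real"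
    show "\<bar>indicator {0<..} (fst (fst p)) * \<bar>v1 (snd p) - u2 (fst p)\<bar>\<bar> \<le> 2 * B"
      using diff_bound[OF bd(3,2), of "snd p" "fst p"] B_nonneg by (auto simp: indicator_def)
    show "kn e (fst (fst p)) * (\<beta> (snd p) * kn v (snd (fst p) - snd p)) = 0" if "p \<notin> T"
      using outT[OF that] cd[rule_format, of "snd p"] kne[of "fst (fst p)"] knv[of "snd (fst p) - snd p"] by auto
  qed (measurable, intro continuous_intros)
  have irest: "integrable lborel (rest e v)"
  proof -
    obtain w where w: "integrable lborel w" "\<And>e p. 0 < e \<Longrightarrow> e \<le> 1 \<Longrightarrow> \<bar>rest e v p\<bar> \<le> w p"
      using rest_dominated[OF v] by blast
    show ?thesis
    proof (rule Bochner_Integration.integrable_bound[OF w(1)])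
      show "AE p in lborel. norm (rest e v p) \<le> norm (w p)"
      proof (rule AE_I2)
        fix p show "norm (rest e v p) \<le> norm (w p)" using w(2)[OF e e1, of p] by simp
      qed
    qed (simp add: rest_borel)
  qed
  have iinit: "integrable lborel (init v)"
    unfolding init_def[abs_def] mult.assoc
  proof (rule integrable_mult_continuous[where S="{c..d} \<times> {c..d+v}" and C="2 * B"])
    show "bounded ({c..d} \<times> {c..d+v})" by (intro bounded_Times) auto
    fix p :: "real \<times> real"
    show "\<bar>\<bar>v2 (snd p) - v1 (fst p)\<bar>\<bar> \<le> 2 * B"
      using diff_bound[OF bd(4,3), of "snd p" "fst p"] by simp
    assume "p \<notin> {c..d} \<times> {c..d+v}"
    then have "fst p \<notin> {c..d} \<or> snd p - fst p \<notin> {0..v}" by (cases p) auto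
    then show "\<beta> (fst p) * kn v (snd p - fst p) = 0"
      using cd[rule_format, of "fst p"] knv[of "snd p - fst p"] by auto
  qed (measurable, intro continuous_intros)
  have dt: "((\<lambda>t. \<alpha> t * kn e (s - t)) has_real_derivative deriv \<alpha> t * kn e (s - t) - \<alpha> t * kn' e (s - t)) (at t)" for s t
    by (rule derivative_eq_intros DERIV_chain2[OF kn_deriv] test_funD(1)[OF \<alpha>] refl)+ simp
  have dx: "((\<lambda>x. \<beta> x * kn v (y - x)) has_real_derivative deriv \<beta> x * kn v (y - x) - \<beta> x * kn' v (y - x)) (at x)" for x y
    by (rule derivative_eq_intros DERIV_chain2[OF kn_deriv] test_funD(1)[OF \<beta>] refl)+ simp
  have ds: "((\<lambda>s. \<alpha> t * kn e (s - t)) has_real_derivative \<alpha> t * kn' e (s - t)) (at s)" for s t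
    by (rule derivative_eq_intros DERIV_chain2[OF kn_deriv] refl)+ simp
  have dy: "((\<lambda>y. \<beta> x * kn v (y - x)) has_real_derivative \<beta> x * kn' v (y - x)) (at y)" for x y
    by (rule derivative_eq_intros DERIV_chain2[OF kn_deriv] refl)+ simp
  have CK: "Ck k (\<lambda>t. kn r (s - t))" "Ck k (\<lambda>t. kn r (t - s))" for k r s
    using Ck_kn[of k r "-1" s] Ck_kn[of k r 1 "- s"] by simp_all
  have T1: "test_fun UNIV (\<lambda>t. \<alpha> t * kn e (s - t))" for s
    by (rule test_fun_mult[OF \<alpha> CK(1) kn_nonneg[OF e]])
  have T2: "test_fun {0<..} (\<lambda>x. \<beta> x * kn v (y - x))" for y
    by (rule test_fun_mult[OF \<beta> CK(1) kn_nonneg[OF v]])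
  have T3: "test_fun UNIV (\<lambda>s. \<alpha> t * kn e (s - t))" for t
  proof (rule test_funI[where c=t and d="t + e"])
    show "\<alpha> t * kn e (s - t) = 0" if "s \<notin> {t..t + e}" for s using kne[of "s - t"] that by auto
  qed (use test_funD(4)[OF \<alpha>] kn_nonneg[OF e] in \<open>auto intro!: Ck_mult Ck_const CK simp del: Ck.simps\<close>)
  \<comment> \<open>The kernel is nonzero only for \<open>y\<close> to the right of
    \<open>x\<close>, so the support in \<open>y\<close> stays inside the open half-line.\<close>
  have T4: "test_fun {0<..} (\<lambda>y. \<beta> x * kn v (y - x))" for x
  proof (cases "x \<in> {c..d}")
    case True
    then have "0 < x" using cd0 by auto
    show ?thesis
    proof (rule test_funI[where c=x and d="x + v"])
      show "\<beta> x * kn v (y - x) = 0" if "y \<notin> {x..x + v}" for y using knv[of "y - x"] that by auto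
      show "{x..x + v} \<subseteq> {0<..}" using \<open>0 < x\<close> by auto
    qed (use test_funD(4)[OF \<beta>] kn_nonneg[OF v] in \<open>auto intro!: Ck_mult Ck_const CK simp del: Ck.simps\<close>)
  next
    case False
    then have "\<beta> x = 0" using cd by blast
    then show ?thesis by (auto intro!: test_funI[where c=1 and d=0] Ck_const simp del: Ck.simps)
  qed
  have I1: "0 \<le> (LBINT z. N1 (z, w)) + \<alpha> 0 * (LBINT x. M (w, x))" for w
  proof -
    let ?i = "indicator {0<..} (fst w) :: real"
    let ?I = "LBINT z. indicator {0<..} (fst z) *
            (\<bar>u1 z - u2 w\<bar> * ((deriv \<alpha> (fst z) * kn e (fst w - fst z) - \<alpha> (fst z) * kn' e (fst w - fst z)) * (\<beta> (snd z) * kn v (snd w - snd z)))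
            + Q f (u1 z) (u2 w) * (\<alpha> (fst z) * kn e (fst w - fst z) * (deriv \<beta> (snd z) * kn v (snd w - snd z) - \<beta> (snd z) * kn' v (snd w - snd z))))"
    let ?J = "LBINT x. \<bar>v1 x - u2 w\<bar> * (\<beta> x * kn v (snd w - x))"
    have "0 \<le> ?I + \<alpha> 0 * kn e (fst w - 0) * ?J"
      by (rule pos_ineqD[OF sol1 T1 T2 dt dx])
    then have "0 \<le> ?i * (?I + \<alpha> 0 * kn e (fst w - 0) * ?J)" by simp
    also have "\<dots> = ?i * ?I + \<alpha> 0 * (?i * kn e (fst w) * ?J)" by (simp add: algebra_simps)
    also have "?i * ?I = (LBINT z. N1 (z, w))"
      unfolding integral_mult_right_zero[symmetric]
      by (intro Bochner_Integration.integral_cong refl) (simp add: N1_def a_def b_def g1_def g2_def g3_def g4_def algebra_simps)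
    also have "?i * kn e (fst w) * ?J = (LBINT x. M (w, x))"
      unfolding integral_mult_right_zero[symmetric]
      by (intro Bochner_Integration.integral_cong refl) (simp add: M_def algebra_simps)
    finally show ?thesis .
  qed
  \<comment> \<open>For \<open>t > 0\<close> the kernel \<open>kn e (0 - t)\<close> vanishes, and
    with it the initial term.\<close>
  have I2: "0 \<le> (LBINT w. N2 (z, w))" for z
  proof -
    let ?i = "indicator {0<..} (fst z) :: real"
    let ?I = "LBINT w. indicator {0<..} (fst w) *
            (\<bar>u2 w - u1 z\<bar> * ((\<alpha> (fst z) * kn' e (fst w - fst z)) * (\<beta> (snd z) * kn v (snd w - snd z)))
            + Q f (u2 w) (u1 z) * (\<alpha> (fst z) * kn e (fst w - fst z) * (\<beta> (snd z) * kn' v (snd w - snd z))))"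
    let ?J = "LBINT y. \<bar>v2 y - u1 z\<bar> * (\<beta> (snd z) * kn v (y - snd z))"
    have "0 \<le> ?I + \<alpha> (fst z) * kn e (0 - fst z) * ?J"
      by (rule pos_ineqD[OF sol2 T3 T4 ds dy])
    then have "0 \<le> ?i * (?I + \<alpha> (fst z) * kn e (0 - fst z) * ?J)" by simp
    also have "\<dots> = ?i * ?I" using kn_eq_0[OF e, of "- fst z"] by (simp add: indicator_def)
    also have "?i * ?I = (LBINT w. N2 (z, w))"
      unfolding integral_mult_right_zero[symmetric]
      by (intro Bochner_Integration.integral_cong refl)
        (simp add: N2_def a_def b_def g2_def g4_def algebra_simps abs_minus_commute Q_commute)
    finally show ?thesis .
  qed
  have I3: "(LBINT w. M (w, x)) \<le> (LBINT w. rest e v (w, x)) + (LBINT y. init v (x, y))" for x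
  proof -
    \<comment> \<open>For \<open>s > 0\<close> the derivative of \<open>?A\<close> is
      \<open>- kn e s\<close>, which reproduces \<open>M\<close> with a minus sign. The factor
      \<open>step (s + 2)\<close> makes the support compact on the side of negative times and equals
      1 from \<open>s = -1\<close> on.\<close>
    let ?A = "\<lambda>s. step (s + 2) * (1 - step (s / e))"
    let ?A' = "\<lambda>s. kern (s + 2) * (1 - step (s / e)) - step (s + 2) * kn e s"
    have dA: "(?A has_real_derivative ?A' s) (at s)" for s
    proof -
      have 1: "((\<lambda>s. step (s + 2)) has_real_derivative kern (s + 2) * 1) (at s)"
        by (rule DERIV_chain2[OF step_deriv]) (auto intro!: derivative_eq_intros)
      have 2: "((\<lambda>s. step (s / e)) has_real_derivative kern (s / e) * (1 / e)) (at s)"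
        by (rule DERIV_chain2[OF step_deriv]) (rule DERIV_cdivide[OF DERIV_ident])
      show ?thesis
        by (rule derivative_eq_intros 1 2 refl)+ (simp add: kn_def)
    qed
    have CA: "Ck k ?A" for k
    proof -
      have "Ck k (\<lambda>s. step (1 * s + 2) * (1 + (- 1) * step (1 / e * s + 0)))"
        by (intro Ck_mult Ck_add Ck_const Ck_affine Ck_step)
      then show ?thesis by simp
    qed
    have TA: "test_fun UNIV ?A"
    proof (rule test_funI[where c="-2" and d=e])
      show "0 \<le> ?A s" for s using step_bounds[of "s + 2"] step_bounds[of "s / e"] by simp
      show "?A s = 0" if "s \<notin> {-2..e}" for s
      proof (cases "s < -2")
        case True
        then show ?thesis using step_0[of "s + 2"] by simp
      next
        case False
        then have "1 \<le> s / e" using that e by auto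
        then show ?thesis using step_1[of "s / e"] by simp
      qed
    qed (use CA in auto)
    let ?I = "LBINT w. indicator {0<..} (fst w) *
            (\<bar>u2 w - v1 x\<bar> * (?A' (fst w) * (\<beta> x * kn v (snd w - x)))
            + Q f (u2 w) (v1 x) * (?A (fst w) * (\<beta> x * kn' v (snd w - x))))"
    let ?J = "LBINT y. \<bar>v2 y - v1 x\<bar> * (\<beta> x * kn v (y - x))"
    have p: "0 \<le> ?I + ?A 0 * ?J"
      by (rule pos_ineqD[OF sol2 TA T4 dA dy])
    have sl: "integrable lborel (\<lambda>w. M (w, x))" "integrable lborel (\<lambda>w. rest e v (w, x))"
    proof -
      show "integrable lborel (\<lambda>w. M (w, x))" unfolding M_def fst_conv snd_conv
      proof (rule integrable_mult_continuous[where S="{0..e} \<times> {x..x+v}" and C="2 * B"])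
        show "bounded ({0..e} \<times> {x..x+v})" by (intro bounded_Times) auto
        fix w :: "real \<times> real"
        show "\<bar>indicator {0<..} (fst w) * \<bar>v1 x - u2 w\<bar>\<bar> \<le> 2 * B"
          using diff_bound[OF bd(3,2), of x w] B_nonneg by (auto simp: indicator_def)
        assume "w \<notin> {0..e} \<times> {x..x+v}"
        then have "fst w \<notin> {0..e} \<or> snd w - x \<notin> {0..v}" by (cases w) auto
        then show "kn e (fst w) * (\<beta> x * kn v (snd w - x)) = 0"
          using kne[of "fst w"] knv[of "snd w - x"] by auto
      qed (measurable, intro continuous_intros)
      have eq: "rest e v (w, x) = (indicator {0<..} (fst w) * Q f (u2 w) (v1 x)) * (?A (fst w) * (\<beta> x * kn' v (snd w - x)))" for w
        using step_1[of "fst w + 2"] by (simp add: rest_def indicator_def)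
      show "integrable lborel (\<lambda>w. rest e v (w, x))" unfolding eq
      proof (rule integrable_mult_continuous[where S="{-2..e} \<times> {x..x+v}" and C="L * (2 * B)"])
        show "bounded ({-2..e} \<times> {x..x+v})" by (intro bounded_Times) auto
        fix w :: "real \<times> real"
        show "\<bar>indicator {0<..} (fst w) * Q f (u2 w) (v1 x)\<bar> \<le> L * (2 * B)"
          using Q_bound[OF bd(2,3), of w x] L_nonneg B_nonneg by (auto simp: indicator_def)
        assume "w \<notin> {-2..e} \<times> {x..x+v}"
        then have "fst w < -2 \<or> fst w > e \<or> snd w - x \<notin> {0..v}" by (cases w) auto
        then have "step (fst w + 2) = 0 \<or> step (fst w / e) = 1 \<or> kn' v (snd w - x) = 0"
          using knv[of "snd w - x"] step_0[of "fst w + 2"] step_1[of "fst w / e"] e by auto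
        then show "?A (fst w) * (\<beta> x * kn' v (snd w - x)) = 0" by auto
      next
        show "continuous_on UNIV (\<lambda>w :: real \<times> real. ?A (fst w) * (\<beta> x * kn' v (snd w - x)))"
          unfolding divide_inverse by (intro continuous_intros)
      qed measurable
    qed
    have "?I = (LBINT w. rest e v (w, x) - M (w, x))"
    proof (intro Bochner_Integration.integral_cong refl)
      fix w :: "real \<times> real"
      show "indicator {0<..} (fst w) *
            (\<bar>u2 w - v1 x\<bar> * (?A' (fst w) * (\<beta> x * kn v (snd w - x)))
            + Q f (u2 w) (v1 x) * (?A (fst w) * (\<beta> x * kn' v (snd w - x)))) = rest e v (w, x) - M (w, x)"
      proof (cases "0 < fst w")
        case True
        then have "step (fst w + 2) = 1" "kern (fst w + 2) = 0" using step_1 kern_eq_0 by simp_all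
        then show ?thesis using True by (simp add: rest_def M_def abs_minus_commute algebra_simps)
      qed (simp add: rest_def M_def)
    qed
    also have "\<dots> = (LBINT w. rest e v (w, x)) - (LBINT w. M (w, x))" using sl by simp
    finally have "0 \<le> (LBINT w. rest e v (w, x)) - (LBINT w. M (w, x)) + ?A 0 * ?J" using p by simp
    moreover have "?A 0 = 1" using step_1[of 2] step_0[of 0] by simp
    moreover have "?J = (LBINT y. init v (x, y))" by (simp add: init_def mult.assoc)
    ultimately show ?thesis by simp
  qed
  have "0 \<le> (LBINT w. (LBINT z. N1 (z, w)) + \<alpha> 0 * (LBINT x. M (w, x)))"
    by (intro Bochner_Integration.integral_nonneg I1)
  also have "\<dots> = (LBINT Z. N1 Z) + \<alpha> 0 * (LBINT p. M p)"
    using Fubini_lborel(2,4)[OF iN(1)] Fubini_lborel(1,3)[OF iM] by simp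
  finally have 1: "0 \<le> (LBINT Z. N1 Z) + \<alpha> 0 * (LBINT p. M p)" .
  have "0 \<le> (LBINT z. (LBINT w. N2 (z, w)))"
    by (intro Bochner_Integration.integral_nonneg I2)
  then have 2: "0 \<le> (LBINT Z. N2 Z)" using Fubini_lborel(1)[OF iN(2)] by simp
  have "(LBINT p. M p) = (LBINT x. (LBINT w. M (w, x)))"
    using Fubini_lborel(2)[OF iM] by simp
  also have "\<dots> \<le> (LBINT x. (LBINT w. rest e v (w, x)) + (LBINT y. init v (x, y)))"
    by (intro integral_mono I3 Bochner_Integration.integrable_add Fubini_lborel(4)[OF iM]
        Fubini_lborel(4)[OF irest] Fubini_lborel(3)[OF iinit])
  also have "\<dots> = (LBINT p. rest e v p) + (LBINT p. init v p)"
    using Fubini_lborel(2,4)[OF irest] Fubini_lborel(1,3)[OF iinit] by simp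
  finally have 3: "(LBINT p. M p) \<le> (LBINT p. rest e v p) + (LBINT p. init v p)" .
  \<comment> \<open>The kernel depends on \<open>s - t\<close> and \<open>y - x\<close> only, so the
    terms with \<open>g2\<close> and \<open>g4\<close> cancel.\<close>
  have "core e v Z = N1 Z + N2 Z" for Z
  proof -
    have "kn e (?s Z - ?t Z) = 0" if "0 < ?t Z" "\<not> 0 < ?s Z" using kn_eq_0[OF e, of "?s Z - ?t Z"] that by simp
    then show ?thesis
      by (cases "0 < ?t Z"; cases "0 < ?s Z")
        (auto simp: core_def N1_def N2_def a_def b_def g1_def g3_def algebra_simps)
  qed
  then have "(LBINT Z. core e v Z) = (LBINT Z. N1 Z) + (LBINT Z. N2 Z)" using iN by simp
  moreover have "\<alpha> 0 * (LBINT p. M p) \<le> \<alpha> 0 * ((LBINT p. rest e v p) + (LBINT p. init v p))"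
    using 3 test_funD(4)[OF \<alpha>] by (intro mult_left_mono)
  ultimately show ?thesis using 1 2 by linarith
qed

lemma kato_limit:
  "0 \<le> (LBINT z. indicator {0<..} (fst z) *
            (\<bar>u1 z - u2 z\<bar> * (deriv \<alpha> (fst z) * \<beta> (snd z)) + Q f (u1 z) (u2 z) * (\<alpha> (fst z) * deriv \<beta> (snd z))))
         + \<alpha> 0 * (LBINT x. \<bar>v1 x - v2 x\<bar> * \<beta> x)"
proof -
  note [measurable] = test_funD(6,7)[OF \<alpha>] test_funD(6,7)[OF \<beta>]
  obtain p q where pq: "\<forall>x. x \<notin> {p..q} \<longrightarrow> \<alpha> x = 0 \<and> deriv \<alpha> x = 0"
    using test_fun_support[OF \<alpha>] by blast
  obtain c d where cd: "\<forall>x. x \<notin> {c..d} \<longrightarrow> \<beta> x = 0 \<and> deriv \<beta> x = 0"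
    using test_fun_support[OF \<beta>] by blast
  obtain A where A: "0 \<le> A" "\<forall>x. \<bar>\<alpha> x\<bar> \<le> A \<and> \<bar>deriv \<alpha> x\<bar> \<le> A" using test_fun_bounded[OF \<alpha>] by blast
  obtain C where C: "0 \<le> C" "\<forall>x. \<bar>\<beta> x\<bar> \<le> C \<and> \<bar>deriv \<beta> x\<bar> \<le> C" using test_fun_bounded[OF \<beta>] by blast
  define F where "F Z = indicator {0<..} (fst (fst Z)) *
    (\<bar>u1 (fst Z) - u2 (snd Z)\<bar> * (deriv \<alpha> (fst (fst Z)) * \<beta> (snd (fst Z)))
      + Q f (u1 (fst Z)) (u2 (snd Z)) * (\<alpha> (fst (fst Z)) * deriv \<beta> (snd (fst Z))))" for Z
  define G where "G Z = \<bar>v2 (snd Z) - v1 (fst Z)\<bar> * \<beta> (fst Z)" for Z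
  have prod: "\<bar>deriv \<alpha> t * \<beta> x\<bar> \<le> A * C" "\<bar>\<alpha> t * deriv \<beta> x\<bar> \<le> A * C" for t x
    unfolding abs_mult using A C by (auto intro!: mult_mono)
  have F[measurable]: "F \<in> borel_measurable borel" unfolding F_def[abs_def] by measurable
  have G[measurable]: "G \<in> borel_measurable borel" unfolding G_def[abs_def] by measurable
  have "0 \<le> (LBINT z. F (z, z)) + \<alpha> 0 * (LBINT x. G (x, x)) + e" if "0 < e" for e
  proof -
    \<comment> \<open>\<open>rest\<close> and \<open>init\<close> are each allowed an error of
      \<open>r / 2\<close>, which costs \<open>\<alpha> 0 * r\<close>; adding 1 in the denominator
      covers \<open>\<alpha> 0 = 0\<close>.\<close>
    define r where "r = e / 3 / (\<alpha> 0 + 1)"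
    have \<alpha>0: "0 \<le> \<alpha> 0" using test_funD(4)[OF \<alpha>] .
    have "0 < r" using \<open>0 < e\<close> \<alpha>0 by (simp add: r_def)
    have \<alpha>r: "\<alpha> 0 * r \<le> e / 3" using \<open>0 < e\<close> \<alpha>0 by (simp add: r_def field_simps)
    have "\<exists>\<delta>>0. \<forall>K. approx_id \<delta> K \<longrightarrow> \<bar>(LBINT p. F p * K (snd p - fst p)) - (LBINT z. F (z, z))\<bar> \<le> e / 3"
    proof (rule approx_id_limit[where v=u2 and B=B and S="{p..q} \<times> {c..d}" and M="2 * B * (A * C) + L * (2 * B) * (A * C)" and C="A * C + 2 * L * (A * C)"])
      show "bounded ({p..q} \<times> {c..d})" by (intro bounded_Times) auto
      show "\<bar>F Z\<bar> \<le> 2 * B * (A * C) + L * (2 * B) * (A * C)" for Z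
      proof -
        have "\<bar>F Z\<bar> \<le> \<bar>u1 (fst Z) - u2 (snd Z)\<bar> * \<bar>deriv \<alpha> (fst (fst Z)) * \<beta> (snd (fst Z))\<bar>
          + \<bar>Q f (u1 (fst Z)) (u2 (snd Z))\<bar> * \<bar>\<alpha> (fst (fst Z)) * deriv \<beta> (snd (fst Z))\<bar>"
          unfolding F_def abs_mult[of "indicator _ _"]
          by (intro order_trans[OF mult_left_le_one_le] order_trans[OF abs_triangle_ineq]) (auto simp: abs_mult indicator_def)
        also have "\<dots> \<le> 2 * B * (A * C) + L * (2 * B) * (A * C)"
          using diff_bound[OF bd(1,2)] Q_bound[OF bd(1,2)] prod L_nonneg B_nonneg
          by (intro add_mono mult_mono) auto
        finally show ?thesis .
      qed
      show "F (z, w) = 0" if "z \<notin> {p..q} \<times> {c..d}" for z w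
      proof -
        have "fst z \<notin> {p..q} \<or> snd z \<notin> {c..d}" using that by (cases z) auto
        then show ?thesis using pq[rule_format, of "fst z"] cd[rule_format, of "snd z"] by (auto simp: F_def)
      qed
      show "\<bar>F (z, w) - F (z, z)\<bar> \<le> (A * C + 2 * L * (A * C)) * \<bar>u2 w - u2 z\<bar>" for z w
      proof -
        have "F (z, w) - F (z, z) = indicator {0<..} (fst z) *
          ((\<bar>u1 z - u2 w\<bar> - \<bar>u1 z - u2 z\<bar>) * (deriv \<alpha> (fst z) * \<beta> (snd z))
          + (Q f (u1 z) (u2 w) - Q f (u1 z) (u2 z)) * (\<alpha> (fst z) * deriv \<beta> (snd z)))"
          by (simp add: F_def algebra_simps)
        also have "\<bar>\<dots>\<bar> \<le> \<bar>\<bar>u1 z - u2 w\<bar> - \<bar>u1 z - u2 z\<bar>\<bar> * \<bar>deriv \<alpha> (fst z) * \<beta> (snd z)\<bar>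
          + \<bar>Q f (u1 z) (u2 w) - Q f (u1 z) (u2 z)\<bar> * \<bar>\<alpha> (fst z) * deriv \<beta> (snd z)\<bar>"
          unfolding abs_mult[of "indicator _ _"]
          by (intro order_trans[OF mult_left_le_one_le] order_trans[OF abs_triangle_ineq]) (auto simp: abs_mult indicator_def)
        also have "\<dots> \<le> \<bar>u2 w - u2 z\<bar> * (A * C) + (2 * L * \<bar>u2 w - u2 z\<bar>) * (A * C)"
          using prod Q_lipschitz[OF lip, of "u1 z" "u2 w" "u1 z" "u2 z"] L_nonneg
          by (intro add_mono mult_mono) auto
        finally show ?thesis by (simp add: algebra_simps)
      qed
    qed (use \<open>0 < e\<close> bd(2) F meas in auto)
    then obtain d1 where d1: "0 < d1" "\<And>K. approx_id d1 K \<Longrightarrow>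
      \<bar>(LBINT p. F p * K (snd p - fst p)) - (LBINT z. F (z, z))\<bar> \<le> e / 3" by blast
    have "\<exists>\<delta>>0. \<forall>K. approx_id \<delta> K \<longrightarrow> \<bar>(LBINT p. G p * K (snd p - fst p)) - (LBINT z. G (z, z))\<bar> \<le> r / 2"
    proof (rule approx_id_limit[where v=v2 and B=B and S="{c..d}" and M="2 * B * C" and C=C])
      show "\<bar>G Z\<bar> \<le> 2 * B * C" for Z
        unfolding G_def abs_mult abs_abs
        using diff_bound[OF bd(4,3), of "snd Z" "fst Z"] C(2)[rule_format, of "fst Z"] B_nonneg
        by (intro mult_mono) auto
      show "G (z, w) = 0" if "z \<notin> {c..d}" for z w using cd that by (simp add: G_def)
      show "\<bar>G (z, w) - G (z, z)\<bar> \<le> C * \<bar>v2 w - v2 z\<bar>" for z w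
      proof -
        have "G (z, w) - G (z, z) = \<beta> z * (\<bar>v2 w - v1 z\<bar> - \<bar>v2 z - v1 z\<bar>)" by (simp add: G_def algebra_simps)
        also have "\<bar>\<dots>\<bar> \<le> C * \<bar>v2 w - v2 z\<bar>"
          unfolding abs_mult using C(2)[rule_format, of z] C(1) by (intro mult_mono) auto
        finally show ?thesis .
      qed
    qed (use \<open>0 < r\<close> bd(4) G meas in auto)
    then obtain d2 where d2: "0 < d2" "\<And>K. approx_id d2 K \<Longrightarrow>
      \<bar>(LBINT p. G p * K (snd p - fst p)) - (LBINT z. G (z, z))\<bar> \<le> r / 2" by blast
    \<comment> \<open>The space width is fixed before the time width, small enough for both
      approximations; the rate at which \<open>rest\<close> vanishes depends on it.\<close>
    define v where "v = min (d1 / 2) d2"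
    have v: "0 < v" "v \<le> d1 / 2" "v \<le> d2" using d1(1) d2(1) by (auto simp: v_def)
    \<comment> \<open>At most 1 for the majorant of \<open>rest\<close>, at most
      \<open>d1 / 2\<close> for the kernel of \<open>core\<close>.\<close>
    define \<epsilon> where "\<epsilon> n = min 1 (d1 / 2) * inverse (real (Suc n))" for n
    have \<epsilon>: "0 < \<epsilon> n" "\<epsilon> n \<le> min 1 (d1 / 2)" for n
    proof -
      have "inverse (real (Suc n)) \<le> 1" by (simp add: inverse_le_1_iff)
      then show "\<epsilon> n \<le> min 1 (d1 / 2)" unfolding \<epsilon>_def using d1(1) by (intro mult_left_le) auto
      show "0 < \<epsilon> n" unfolding \<epsilon>_def using d1(1) by (intro mult_pos_pos) auto
    qed
    have "\<epsilon> \<longlonglongrightarrow> min 1 (d1 / 2) * 0" unfolding \<epsilon>_def[abs_def] by (intro tendsto_intros LIMSEQ_inverse_real_of_nat)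
    then have \<epsilon>0: "\<epsilon> \<longlonglongrightarrow> 0" by simp
    have \<epsilon>1: "\<epsilon> n \<le> 1" for n using \<epsilon>(2)[of n] by simp
    have "(\<lambda>n. LBINT p. rest (\<epsilon> n) v p) \<longlonglongrightarrow> 0"
      by (rule rest_tendsto_0[OF v(1) \<epsilon>(1) \<epsilon>1 \<epsilon>0])
    from LIMSEQ_D[OF this, of "r / 2"] \<open>0 < r\<close> obtain n where n: "\<bar>LBINT p. rest (\<epsilon> n) v p\<bar> < r / 2"
      by auto
    have "0 \<le> (LBINT Z. core (\<epsilon> n) v Z) + \<alpha> 0 * ((LBINT p. rest (\<epsilon> n) v p) + (LBINT p. init v p))"
      using \<epsilon>[of n] v by (intro doubling_inequality) auto
    moreover have "\<bar>(LBINT Z. core (\<epsilon> n) v Z) - (LBINT z. F (z, z))\<bar> \<le> e / 3"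
      using d1(2)[OF approx_id_kn2[of "\<epsilon> n" d1 v]] \<epsilon>[of n] v by (simp add: core_def F_def)
    moreover have "\<bar>(LBINT p. init v p) - (LBINT z. G (z, z))\<bar> \<le> r / 2"
      using d2(2)[OF approx_id_kn[OF v(1,3)]] by (simp add: init_def G_def)
    moreover have "\<alpha> 0 * ((LBINT p. rest (\<epsilon> n) v p) + (LBINT p. init v p))
        \<le> \<alpha> 0 * ((LBINT z. G (z, z)) + r)"
      using n calculation(3) \<alpha>0 by (intro mult_left_mono) linarith+
    ultimately show ?thesis using \<alpha>r \<open>0 < e\<close> unfolding distrib_left by linarith
  qed
  then have "0 \<le> (LBINT z. F (z, z)) + \<alpha> 0 * (LBINT x. G (x, x))" by (rule field_le_epsilon)
  then show ?thesis by (simp add: F_def G_def abs_minus_commute)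
qed

end

theorem kato_inequality:
  "pos_ineq {0<..} (\<lambda>z. \<bar>u1 z - u2 z\<bar>) (\<lambda>z. Q f (u1 z) (u2 z)) (\<lambda>x. \<bar>v1 x - v2 x\<bar>)"
  unfolding pos_ineq_def using kato_limit by blast

end

section \<open>Boundary layers\<close>

lemma integrable_exp_halfline:
  fixes \<mu> a :: real
  assumes "0 < \<mu>"
  shows "integrable lborel (\<lambda>x. exp (- (\<mu> * x)) * indicator {a..} x)"
proof -
  have "(\<integral>\<^sup>+x. ennreal (exp (- (\<mu> * x))) * indicator {a..} x \<partial>lborel) = ennreal (0 - - exp (- (\<mu> * a)) / \<mu>)"
  proof (rule nn_integral_FTC_atLeast[where F="\<lambda>x. - exp (- (\<mu> * x)) / \<mu>"])
    show "((\<lambda>x. - exp (- (\<mu> * x)) / \<mu>) \<longlongrightarrow> 0) at_top"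
    proof -
      have "filterlim (\<lambda>x. - (\<mu> * x)) at_bot at_top"
        using assms by (simp add: filterlim_uminus_at_bot filterlim_tendsto_pos_mult_at_top[OF tendsto_const _ filterlim_ident])
      then have "((\<lambda>x. exp (- (\<mu> * x))) \<longlongrightarrow> 0) at_top" by (rule filterlim_compose[OF exp_at_bot])
      from tendsto_divide[OF tendsto_minus[OF this] tendsto_const[of \<mu>]] assms show ?thesis by simp
    qed
  qed (use assms in \<open>auto intro!: derivative_eq_intros\<close>)
  moreover have "(\<integral>\<^sup>+x. ennreal (norm (exp (- (\<mu> * x)) * indicator {a..} x)) \<partial>lborel)
      = (\<integral>\<^sup>+x. ennreal (exp (- (\<mu> * x))) * indicator {a..} x \<partial>lborel)"
    by (intro nn_integral_cong) (simp add: indicator_def)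
  ultimately show ?thesis by (intro integrableI_bounded) auto
qed

lemma integrable_tensor:
  fixes f :: "'a::euclidean_space \<Rightarrow> real" and g :: "'b::euclidean_space \<Rightarrow> real"
  assumes "integrable lborel f" "integrable lborel g"
  shows "integrable lborel (\<lambda>z. f (fst z) * g (snd z))"
proof -
  have [measurable]: "f \<in> borel_measurable borel" "g \<in> borel_measurable borel" using assms by auto
  have "integrable (lborel \<Otimes>\<^sub>M lborel) (\<lambda>z. f (fst z) * g (snd z))"
  proof (rule lborel_pair.Fubini_integrable)
    show "integrable lborel (\<lambda>x. LBINT y. norm (f (fst (x, y)) * g (snd (x, y))))"
      using assms by (simp add: abs_mult)
    show "AE x in lborel. integrable lborel (\<lambda>y. f (fst (x, y)) * g (snd (x, y)))" using assms by simp
  qed measurable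
  then show ?thesis by (simp add: lborel_prod)
qed

text \<open>An exponential weight, switched on over \<open>[- c / j, (1 - c) / j]\<close> and
  switched off over \<open>[j, j + 1]\<close>. The offset \<open>c\<close> selects the side of 0:
  \<open>[1 / j, 2 / j]\<close> for \<open>c = -1\<close> and \<open>[- 2 / j, - 1 / j]\<close> for
  \<open>c = 2\<close>.\<close>

definition cut :: "real \<Rightarrow> real \<Rightarrow> nat \<Rightarrow> real \<Rightarrow> real" where
  "cut \<mu> c j x = exp (- (\<mu> * x)) * step (real j * x + c) * step (real j + 1 - x)"

text \<open>The part of the derivative of \<open>cut\<close> due to switching on: it has asymptotic
  mass 1 and concentrates at 0. \<open>tail\<close> is the part due to switching off.\<close>

definition layer :: "real \<Rightarrow> real \<Rightarrow> nat \<Rightarrow> real \<Rightarrow> real" where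
  "layer \<mu> c j x = exp (- (\<mu> * x)) * (real j * kern (real j * x + c))"

definition tail :: "real \<Rightarrow> real \<Rightarrow> nat \<Rightarrow> real \<Rightarrow> real" where
  "tail \<mu> c j x = exp (- (\<mu> * x)) * step (real j * x + c) * kern (real j + 1 - x)"

text \<open>Limit of \<open>cut\<close> as \<open>j\<close> grows. The value \<open>step c\<close>
  at 0 makes the convergence hold at every point, not just almost everywhere.\<close>

definition weight :: "real \<Rightarrow> real \<Rightarrow> real \<Rightarrow> real" where
  "weight \<mu> c x = exp (- (\<mu> * x)) * (if x > 0 then 1 else if x = 0 then step c else 0)"

lemma cut_borel [measurable]: "cut \<mu> c j \<in> borel_measurable borel"
  and layer_borel [measurable]: "layer \<mu> c j \<in> borel_measurable borel"
  and tail_borel [measurable]: "tail \<mu> c j \<in> borel_measurable borel"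
  and weight_borel [measurable]: "weight \<mu> c \<in> borel_measurable borel"
  unfolding cut_def[abs_def] layer_def[abs_def] tail_def[abs_def] weight_def[abs_def] by measurable

lemma scale_less:
  assumes "2 \<le> (j::nat)"
  shows "x < b / real j \<Longrightarrow> real j * x < b" "b / real j < x \<Longrightarrow> b < real j * x"
    "x \<le> b / real j \<Longrightarrow> real j * x \<le> b" "b / real j \<le> x \<Longrightarrow> b \<le> real j * x"
  using assms by (simp_all add: pos_less_divide_eq pos_divide_less_eq pos_le_divide_eq pos_divide_le_eq mult.commute)

lemma layer_eq_0:
  assumes c: "- 2 \<le> c" "c \<le> 2" and j: "2 \<le> j" and x: "x \<notin> {- c / real j..(1 - c) / real j}"
  shows "layer \<mu> c j x = 0"
proof -
  have "x < - c / real j \<or> (1 - c) / real j < x" using x by auto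
  then have "real j * x + c \<le> 0 \<or> 1 \<le> real j * x + c"
    using scale_less(1)[OF j, of x "- c"] scale_less(2)[OF j, of "1 - c" x] by auto
  then show ?thesis by (auto simp: layer_def kern_eq_0)
qed

lemma layer_nonneg: "0 \<le> layer \<mu> c j x"
  by (simp add: layer_def kern_nonneg)

lemma cut_deriv:
  assumes c: "- 2 \<le> c" "c \<le> 2" and j: "2 \<le> j"
  shows "(cut \<mu> c j has_real_derivative - \<mu> * cut \<mu> c j x + layer \<mu> c j x - tail \<mu> c j x) (at x)"
proof -
  have 1: "((\<lambda>x. step (real j * x + c)) has_real_derivative kern (real j * x + c) * real j) (at x)"
    by (rule DERIV_chain2[OF step_deriv]) (auto intro!: derivative_eq_intros)
  have 2: "((\<lambda>x. step (real j + 1 - x)) has_real_derivative kern (real j + 1 - x) * (-1)) (at x)"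
    by (rule DERIV_chain2[OF step_deriv]) (auto intro!: derivative_eq_intros)
  have 3: "((\<lambda>x. exp (- (\<mu> * x))) has_real_derivative - \<mu> * exp (- (\<mu> * x))) (at x)"
    by (auto intro!: derivative_eq_intros)
  \<comment> \<open>The layer ends at \<open>3 / 2\<close> at the latest, while the far cut-off is
    still 1 up to \<open>j\<close>, which is at least 2.\<close>
  have 4: "layer \<mu> c j x * step (real j + 1 - x) = layer \<mu> c j x"
  proof (cases "x \<le> real j")
    case True
    then show ?thesis using step_1[of "real j + 1 - x"] by simp
  next
    case False
    have "(1 - c) / real j \<le> 3 / 2" using c j by (simp add: field_simps)
    moreover have "2 \<le> real j" using j by simp
    ultimately have "\<not> x \<le> (1 - c) / real j" using False by linarith
    then have "x \<notin> {- c / real j..(1 - c) / real j}" by simp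
    then show ?thesis using layer_eq_0[OF c j] by simp
  qed
  have "(cut \<mu> c j has_real_derivative - \<mu> * cut \<mu> c j x + layer \<mu> c j x * step (real j + 1 - x) - tail \<mu> c j x) (at x)"
    unfolding cut_def[abs_def]
    by (rule derivative_eq_intros 1 2 3 refl)+ (simp add: cut_def layer_def tail_def algebra_simps)
  then show ?thesis by (simp only: 4)
qed

lemma cut_supp:
  assumes j: "2 \<le> j" and x: "x \<notin> {- c / real j..real j + 1}"
  shows "cut \<mu> c j x = 0"
proof (cases "x > real j + 1")
  case True
  then show ?thesis by (simp add: cut_def step_0)
next
  case False
  then have "x < - c / real j" using x by auto
  then have "real j * x + c \<le> 0" using scale_less(1)[OF j, of x "- c"] by simp
  then show ?thesis by (simp add: cut_def step_0)
qed

lemma test_fun_cut: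
  assumes j: "2 \<le> j" and sub: "{- c / real j..real j + 1} \<subseteq> \<Omega>"
  shows "test_fun \<Omega> (cut \<mu> c j)"
proof (rule test_funI[OF _ _ sub])
  have "Ck k (\<lambda>x. exp ((- \<mu>) * x) * step (real j * x + c) * step ((- 1) * x + (real j + 1)))" for k
    by (intro Ck_mult Ck_exp Ck_affine Ck_step)
  then show "Ck k (cut \<mu> c j)" for k by (simp add: cut_def[abs_def] algebra_simps)
  show "0 \<le> cut \<mu> c j x" for x by (simp add: cut_def step_bounds)
  show "cut \<mu> c j x = 0" if "x \<notin> {- c / real j..real j + 1}" for x using cut_supp[OF j that] .
qed

text \<open>A majorant common to all \<open>j\<close>: for \<open>c <= 2\<close> and
  \<open>j >= 2\<close> the support begins at \<open>-1\<close> at the earliest.\<close>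

lemma cut_le:
  assumes c: "- 2 \<le> c" "c \<le> 2" and j: "2 \<le> j"
  shows "\<bar>cut \<mu> c j x\<bar> \<le> exp (- (\<mu> * x)) * indicator {-1..} x"
proof (cases "x < - 1")
  case True
  have "- 1 \<le> - c / real j" using c j by (simp add: field_simps)
  then have "cut \<mu> c j x = 0" using True by (intro cut_supp[OF j]) auto
  then show ?thesis by simp
next
  case False
  have "step (real j * x + c) * step (real j + 1 - x) \<le> 1"
    using step_bounds by (intro mult_le_one) auto
  then have "exp (- (\<mu> * x)) * (step (real j * x + c) * step (real j + 1 - x)) \<le> exp (- (\<mu> * x)) * 1"
    by (intro mult_left_mono) auto
  then show ?thesis using False by (simp add: cut_def step_bounds mult.assoc abs_mult)
qed

lemma tail_le:
  assumes c: "- 2 \<le> c" "c \<le> 2" and j: "2 \<le> j" and B: "\<And>x. kern x \<le> B"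
  shows "\<bar>tail \<mu> c j x\<bar> \<le> B * (exp (- (\<mu> * x)) * indicator {-1..} x)"
proof (cases "x < - 1")
  case True
  have "- 1 \<le> - c / real j" using c j by (simp add: field_simps)
  then have "x < - c / real j" using True by linarith
  then have "real j * x + c \<le> 0" using scale_less(1)[OF j, of x "- c"] by simp
  then show ?thesis using True by (simp add: tail_def step_0)
next
  case False
  have "step (real j * x + c) * kern (real j + 1 - x) \<le> 1 * B"
    using step_bounds kern_nonneg B by (intro mult_mono) auto
  then have "exp (- (\<mu> * x)) * (step (real j * x + c) * kern (real j + 1 - x)) \<le> exp (- (\<mu> * x)) * B"
    by (intro mult_left_mono) auto
  then show ?thesis using False by (simp add: tail_def step_bounds kern_nonneg mult.assoc abs_mult mult.commute)
qed

lemma eventually_real_ge: "eventually (\<lambda>j::nat. a \<le> real j) sequentially"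
  using filterlim_real_sequentially by (simp add: filterlim_at_top)

lemma cut_tendsto: "(\<lambda>j. cut \<mu> c j x) \<longlonglongrightarrow> weight \<mu> c x"
proof -
  have "eventually (\<lambda>j. cut \<mu> c j x = weight \<mu> c x) sequentially"
    using eventually_real_ge[of x] eventually_real_ge[of "(1 - c) / x"] eventually_real_ge[of "- c / x"]
  proof eventually_elim
    case (elim j)
    have s: "step (real j + 1 - x) = 1" using elim(1) by (intro step_1) simp
    consider "x > 0" | "x = 0" | "x < 0" by linarith
    then show ?case
    proof cases
      case 1
      then have "1 \<le> real j * x + c" using elim(2) pos_divide_le_eq[of x "1 - c" "real j"] by linarith
      then show ?thesis using 1 s by (simp add: cut_def weight_def step_1)
    next
      case 2
      then show ?thesis using s by (simp add: cut_def weight_def)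
    next
      case 3
      then have "real j * x + c \<le> 0" using elim(3) neg_divide_le_eq[of x "- c" "real j"] by linarith
      then show ?thesis using 3 by (simp add: cut_def weight_def step_0)
    qed
  qed
  then show ?thesis by (rule tendsto_eventually)
qed

lemma tail_tendsto: "(\<lambda>j. tail \<mu> c j x) \<longlonglongrightarrow> 0"
proof -
  have "eventually (\<lambda>j. tail \<mu> c j x = 0) sequentially"
    using eventually_real_ge[of x]
  proof eventually_elim
    case (elim j)
    then have "kern (real j + 1 - x) = 0" by (intro kern_eq_0) simp
    then show ?case by (simp add: tail_def)
  qed
  then show ?thesis by (rule tendsto_eventually)
qed

text \<open>Substituting \<open>y = j x + c\<close> turns the layer into \<open>kern\<close> times
  \<open>exp (- \<mu> (y - c) / j)\<close>, and this factor tends to 1. On the support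
  \<open>(y - c) / j\<close> is at least \<open>-2\<close>, whence the bound.\<close>

lemma layer_mass:
  assumes "0 < \<mu>" and c: "- 2 \<le> c" "c \<le> 2"
  shows "2 \<le> j \<Longrightarrow> integrable lborel (layer \<mu> c j)"
    and "(\<lambda>j. LBINT x. layer \<mu> c j x) \<longlonglongrightarrow> 1"
    and "2 \<le> j \<Longrightarrow> (LBINT x. layer \<mu> c j x) \<le> exp (2 * \<mu>)"
proof -
  define k where "k j y = exp (- (\<mu> * ((y - c) / real j))) * kern y" for j y
  have k_eq: "layer \<mu> c j (- c / real j + 1 / real j * y) = real j * k j y" if "2 \<le> j" for j y
    using that by (simp add: layer_def k_def field_simps)
  have kb: "\<bar>k j y\<bar> \<le> exp (2 * \<mu>) * kern y" if "2 \<le> j" for j y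
  proof (cases "y \<in> {0..1}")
    case True
    have "- 2 * real j \<le> y - c" "0 < real j" using True c that by auto
    then have "- 2 \<le> (y - c) / real j" using pos_le_divide_eq[of "real j" "- 2" "y - c"] by blast
    then have "\<mu> * (- 2) \<le> \<mu> * ((y - c) / real j)" using \<open>0 < \<mu>\<close> by (intro mult_left_mono) auto
    then show ?thesis using kern_nonneg[of y] by (auto simp: k_def abs_mult intro!: mult_right_mono)
  next
    case False
    then show ?thesis using kern_eq_0[of y] by (auto simp: k_def)
  qed
  have k_meas[measurable]: "k j \<in> borel_measurable borel" for j unfolding k_def[abs_def] by measurable
  have ik: "integrable lborel (\<lambda>y. exp (2 * \<mu>) * kern y)" "integrable lborel kern" "(LBINT y. kern y) = 1"
    using kern_integral by (auto simp: has_bochner_integral_iff)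
  have ikj: "integrable lborel (k j)" if "2 \<le> j" for j
    by (rule Bochner_Integration.integrable_bound[OF ik(1)])
      (use kb[OF that] in \<open>auto intro!: AE_I2 order_trans[OF kb[OF that] abs_ge_self]\<close>)
  have il: "integrable lborel (layer \<mu> c j)" if "2 \<le> j" for j
  proof -
    have "integrable lborel (\<lambda>y. layer \<mu> c j (- c / real j + 1 / real j * y))"
      unfolding k_eq[OF that] using ikj[OF that] by simp
    then show ?thesis using that by (subst (asm) lborel_integrable_real_affine_iff) auto
  qed
  then show "2 \<le> j \<Longrightarrow> integrable lborel (layer \<mu> c j)" by blast
  have mass: "(LBINT x. layer \<mu> c j x) = (LBINT y. k j y)" if "2 \<le> j" for j
  proof -
    have "(LBINT x. layer \<mu> c j x) = \<bar>1 / real j\<bar> *\<^sub>R (LBINT y. layer \<mu> c j (- c / real j + 1 / real j * y))"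
      using that by (intro lborel_integral_real_affine) auto
    also have "\<dots> = (LBINT y. k j y)" unfolding k_eq[OF that] using that by simp
    finally show ?thesis .
  qed
  show "2 \<le> j \<Longrightarrow> (LBINT x. layer \<mu> c j x) \<le> exp (2 * \<mu>)"
  proof -
    assume j: "2 \<le> j"
    have "(LBINT y. k j y) \<le> (LBINT y. exp (2 * \<mu>) * kern y)"
    proof (rule integral_mono[OF ikj[OF j] ik(1)])
      show "k j y \<le> exp (2 * \<mu>) * kern y" for y using kb[OF j, of y] by linarith
    qed
    then show ?thesis unfolding mass[OF j] using ik by simp
  qed
  have "(\<lambda>j. LBINT y. k (j + 2) y) \<longlonglongrightarrow> (LBINT y. kern y)"
  proof (rule integral_dominated_convergence[OF _ _ ik(1)])
    show "AE y in lborel. (\<lambda>j. k (j + 2) y) \<longlonglongrightarrow> kern y"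
    proof (rule AE_I2)
      fix y
      have "(\<lambda>j. (y - c) / real j) \<longlonglongrightarrow> 0" by (rule lim_const_over_n)
      then have "(\<lambda>j. (y - c) / real (j + 2)) \<longlonglongrightarrow> 0" by (rule LIMSEQ_ignore_initial_segment)
      then have "(\<lambda>j. exp (- (\<mu> * ((y - c) / real (j + 2)))) * kern y) \<longlonglongrightarrow> exp (- (\<mu> * 0)) * kern y"
        by (intro tendsto_intros)
      then show "(\<lambda>j. k (j + 2) y) \<longlonglongrightarrow> kern y" by (simp add: k_def)
    qed
    show "AE y in lborel. norm (k (j + 2) y) \<le> exp (2 * \<mu>) * kern y" for j
      using kb[of "j + 2"] by simp
  qed auto
  then have "(\<lambda>j. LBINT x. layer \<mu> c (j + 2) x) \<longlonglongrightarrow> 1" using mass ik by simp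
  then show "(\<lambda>j. LBINT x. layer \<mu> c j x) \<longlonglongrightarrow> 1" by (rule LIMSEQ_offset)
qed

lemma eventually_ess_at0:
  "eventually P (ess_at0 \<Omega>) \<longleftrightarrow> (\<exists>d>0. AE x in lborel. x \<in> \<Omega> \<longrightarrow> x \<noteq> 0 \<longrightarrow> \<bar>x\<bar> < d \<longrightarrow> P x)"
proof
  assume "eventually P (ess_at0 \<Omega>)"
  then obtain R S where RS: "eventually R (at 0 within \<Omega>)" "AE x in lborel. S x" "\<forall>x. R x \<and> S x \<longrightarrow> P x"
    unfolding ess_at0_def eventually_inf by blast
  obtain d where d: "d > 0" "\<And>x. x \<in> \<Omega> \<Longrightarrow> x \<noteq> 0 \<Longrightarrow> dist x 0 < d \<Longrightarrow> R x"
    using RS(1) unfolding eventually_at by blast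
  from RS(2) have "AE x in lborel. x \<in> \<Omega> \<longrightarrow> x \<noteq> 0 \<longrightarrow> \<bar>x\<bar> < d \<longrightarrow> P x"
  proof eventually_elim
    case (elim x)
    then show ?case using d(2)[of x] RS(3) by (simp add: dist_real_def)
  qed
  then show "\<exists>d>0. AE x in lborel. x \<in> \<Omega> \<longrightarrow> x \<noteq> 0 \<longrightarrow> \<bar>x\<bar> < d \<longrightarrow> P x" using d(1) by blast
next
  assume "\<exists>d>0. AE x in lborel. x \<in> \<Omega> \<longrightarrow> x \<noteq> 0 \<longrightarrow> \<bar>x\<bar> < d \<longrightarrow> P x"
  then obtain d where d: "d > 0" "AE x in lborel. x \<in> \<Omega> \<longrightarrow> x \<noteq> 0 \<longrightarrow> \<bar>x\<bar> < d \<longrightarrow> P x" by blast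
  have "eventually (\<lambda>x. x \<in> \<Omega> \<and> x \<noteq> 0 \<and> \<bar>x\<bar> < d) (at 0 within \<Omega>)"
    unfolding eventually_at using d(1) by (auto simp: dist_real_def)
  then show "eventually P (ess_at0 \<Omega>)"
    unfolding ess_at0_def eventually_inf using d(2) by blast
qed

text \<open>The layer lies to the right of \<open>0\<close> for \<open>c = -1\<close> and to the left of \<open>0\<close> for \<open>c = 2\<close>.\<close>

definition side :: "real \<Rightarrow> real set" where
  "side c = (if c < 0 then {0<..} else {..<0})"

lemma layer_limit:
  assumes \<mu>: "0 < \<mu>" and c: "c = -1 \<or> c = 2" and g[measurable]: "g \<in> borel_measurable borel"
    and gb: "\<And>x. \<bar>g x\<bar> \<le> C" and lim: "(g \<longlongrightarrow> g0) (ess_at0 (side c))"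
  shows "(\<lambda>j. LBINT x. layer \<mu> c j x * g x) \<longlonglongrightarrow> g0"
proof -
  have c2: "- 2 \<le> c" "c \<le> 2" using c by auto
  have ig: "integrable lborel (\<lambda>x. layer \<mu> c j x * g x)" if "2 \<le> j" for j
  proof (rule Bochner_Integration.integrable_bound)
    show "integrable lborel (\<lambda>x. C * layer \<mu> c j x)" using layer_mass(1)[OF \<mu> c2 that] by simp
    show "AE x in lborel. norm (layer \<mu> c j x * g x) \<le> norm (C * layer \<mu> c j x)"
    proof (rule AE_I2)
      fix x
      have "\<bar>g x\<bar> \<le> \<bar>C\<bar>" using gb[of x] by linarith
      then show "norm (layer \<mu> c j x * g x) \<le> norm (C * layer \<mu> c j x)"
        using mult_right_mono[OF _ layer_nonneg[of \<mu> c j x]] layer_nonneg[of \<mu> c j x] by (simp add: abs_mult mult.commute)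
    qed
  qed simp
  \<comment> \<open>The mass of the layer is 1 only in the limit, so \<open>g0\<close> is compared
    with its own average first.\<close>
  have "(\<lambda>j. (LBINT x. layer \<mu> c j x * g x) - g0 * (LBINT x. layer \<mu> c j x)) \<longlonglongrightarrow> 0"
  proof (rule LIMSEQ_I)
    fix r :: real assume "0 < r"
    define e where "e = r / 2 / exp (2 * \<mu>)"
    have e: "0 < e" "e * exp (2 * \<mu>) < r" using \<open>0 < r\<close> by (auto simp: e_def)
    obtain d where d: "d > 0" "AE x in lborel. x \<in> side c \<longrightarrow> x \<noteq> 0 \<longrightarrow> \<bar>x\<bar> < d \<longrightarrow> dist (g x) g0 < e"
      using tendstoD[OF lim e(1)] unfolding eventually_ess_at0 by blast
    \<comment> \<open>The layer reaches up to distance \<open>2 / j\<close> from 0, strictly less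
      than \<open>3 / j\<close> and hence than \<open>d\<close>.\<close>
    have "eventually (\<lambda>j. 2 \<le> j \<and> 3 / d \<le> real j) sequentially"
      using eventually_ge_at_top[of 2] eventually_real_ge[of "3 / d"] by eventually_elim auto
    then obtain N where N: "\<And>j. j \<ge> N \<Longrightarrow> 2 \<le> j \<and> 3 / d \<le> real j" unfolding eventually_sequentially by blast
    have "norm ((LBINT x. layer \<mu> c j x * g x) - g0 * (LBINT x. layer \<mu> c j x) - 0) < r" if "j \<ge> N" for j
    proof -
      have j: "2 \<le> j" "3 / d \<le> real j" using N[OF that] by auto
      have il: "integrable lborel (layer \<mu> c j)" using layer_mass(1)[OF \<mu> c2 j(1)] .
      have "\<bar>(LBINT x. layer \<mu> c j x * g x) - g0 * (LBINT x. layer \<mu> c j x)\<bar>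
         = \<bar>LBINT x. layer \<mu> c j x * g x - g0 * layer \<mu> c j x\<bar>"
        using il ig[OF j(1)] by simp
      also have "\<dots> \<le> (LBINT x. \<bar>layer \<mu> c j x * g x - g0 * layer \<mu> c j x\<bar>)" by (rule integral_abs_bound)
      also have "\<dots> \<le> (LBINT x. e * layer \<mu> c j x)"
      proof (rule integral_mono_AE)
        show "integrable lborel (\<lambda>x. \<bar>layer \<mu> c j x * g x - g0 * layer \<mu> c j x\<bar>)"
          using il ig[OF j(1)] by simp
        show "integrable lborel (\<lambda>x. e * layer \<mu> c j x)" using il by simp
        from d(2) show "AE x in lborel. \<bar>layer \<mu> c j x * g x - g0 * layer \<mu> c j x\<bar> \<le> e * layer \<mu> c j x"
        proof eventually_elim
          case (elim x)
          have eq: "\<bar>layer \<mu> c j x * g x - g0 * layer \<mu> c j x\<bar> = \<bar>g x - g0\<bar> * layer \<mu> c j x"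
          proof -
            have "layer \<mu> c j x * g x - g0 * layer \<mu> c j x = (g x - g0) * layer \<mu> c j x" by (simp add: algebra_simps)
            then show ?thesis using layer_nonneg[of \<mu> c j x] by (simp add: abs_mult)
          qed
          show ?case
          proof (cases "x \<in> {- c / real j..(1 - c) / real j}")
            case True
            have j0: "0 < real j" using j(1) by simp
            have dj: "3 \<le> d * real j" using j(2) d(1) by (simp add: pos_divide_le_eq mult.commute)
            have m: "- c \<le> x * real j" "x * real j \<le> 1 - c"
              using True scale_less(3)[OF j(1), of x "1 - c"] scale_less(4)[OF j(1), of "- c" x]
              by (simp_all add: mult.commute)
            have xj: "\<bar>x\<bar> * real j = \<bar>x * real j\<bar>" using j0 by (simp add: abs_mult)
            have "\<bar>x\<bar> * real j < d * real j" unfolding xj using c m dj by auto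
            then have "\<bar>x\<bar> < d" using j0 by simp
            moreover have "x \<in> side c \<and> x \<noteq> 0"
            proof (cases "c = -1")
              case True
              then have "0 < x * real j" using m by simp
              then show ?thesis using True j0 by (simp add: side_def zero_less_mult_iff)
            next
              case False
              then have c: "c = 2" using c by simp
              then have "x * real j < 0" using m by simp
              then show ?thesis using c j0 by (simp add: side_def mult_less_0_iff)
            qed
            ultimately have "\<bar>g x - g0\<bar> \<le> e" using elim by (simp add: dist_real_def)
            then show ?thesis unfolding eq using layer_nonneg[of \<mu> c j x] by (intro mult_right_mono)
          next
            case False
            then show ?thesis using layer_eq_0[OF c2 j(1) False] by simp
          qed
        qed
      qed
      also have "\<dots> \<le> e * exp (2 * \<mu>)"
        using layer_mass(3)[OF \<mu> c2 j(1)] e(1) by (simp add: mult_left_mono)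
      finally show ?thesis using e(2) by simp
    qed
    then show "\<exists>N. \<forall>j\<ge>N. norm ((LBINT x. layer \<mu> c j x * g x) - g0 * (LBINT x. layer \<mu> c j x) - 0) < r" by blast
  qed
  from tendsto_add[OF this tendsto_mult[OF tendsto_const[of g0] layer_mass(2)[OF \<mu> c2]]]
  show ?thesis by simp
qed

text \<open>\<open>pos_ineq\<close> is tested with \<open>cut\<close> and \<open>j\<close> tends to
  infinity. Of the three terms in the derivative of \<open>cut\<close>, the tail vanishes in the
  limit, the weight term \<open>- \<mu> * H\<close> is absorbed by \<open>L * \<mu> * E\<close>
  because the flux is dominated by the entropy, and the layer term is left as an assumed limit
  \<open>l\<close>. The reason for assuming it is that pointwise and time-averaged traces require
  different arguments.\<close>

lemma halfline_limit:
  fixes E H :: "real \<times> real \<Rightarrow> real" and E0 :: "real \<Rightarrow> real"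
  assumes \<mu>: "0 < \<mu>" and c: "- 2 \<le> c" "c \<le> 2" and L: "0 \<le> L"
    and meas[measurable]: "E \<in> borel_measurable borel" "H \<in> borel_measurable borel" "E0 \<in> borel_measurable borel"
    and Eb: "\<And>z. \<bar>E z\<bar> \<le> C" and HE: "\<And>z. \<bar>H z\<bar> \<le> L * E z" and E0b: "\<And>x. \<bar>E0 x\<bar> \<le> C0"
    and pos: "pos_ineq \<Omega> E H E0" and sub: "\<And>j. 2 \<le> j \<Longrightarrow> {- c / real j..real j + 1} \<subseteq> \<Omega>"
    and \<alpha>: "test_fun UNIV \<alpha>"
    and lim: "(\<lambda>j. LBINT z. indicator {0<..} (fst z) * (H z * (\<alpha> (fst z) * layer \<mu> c j (snd z)))) \<longlonglongrightarrow> l"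
  shows "0 \<le> (LBINT z. indicator {0<..} (fst z) * (E z * ((deriv \<alpha> (fst z) + L * \<mu> * \<alpha> (fst z)) * weight \<mu> c (snd z))))
           + l + \<alpha> 0 * (LBINT x. E0 x * weight \<mu> c x)"
    and "integrable lborel (\<lambda>z. indicator {0<..} (fst z) * (E z * ((deriv \<alpha> (fst z) + L * \<mu> * \<alpha> (fst z)) * weight \<mu> c (snd z))))"
    and "integrable lborel (\<lambda>x. E0 x * weight \<mu> c x)"
proof -
  note [measurable] = test_funD(6,7)[OF \<alpha>]
  obtain p q where pq: "\<forall>x. x \<notin> {p..q} \<longrightarrow> \<alpha> x = 0 \<and> deriv \<alpha> x = 0"
    using test_fun_support[OF \<alpha>] by blast
  obtain A where A: "0 \<le> A" "\<forall>x. \<bar>\<alpha> x\<bar> \<le> A \<and> \<bar>deriv \<alpha> x\<bar> \<le> A" using test_fun_bounded[OF \<alpha>] by blast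
  obtain K where K: "\<And>x. kern x \<le> K" using kern_bounded by blast
  have K0: "0 \<le> K" using K[of 0] kern_nonneg[of 0] by linarith
  have C0: "0 \<le> C" using Eb[of undefined] by linarith
  define ex where "ex x = exp (- (\<mu> * x)) * indicator {-1..} x" for x
  have iex: "integrable lborel ex" unfolding ex_def[abs_def] by (rule integrable_exp_halfline[OF \<mu>])
  have [measurable]: "ex \<in> borel_measurable borel" using iex by auto
  have ex0: "0 \<le> ex x" for x by (simp add: ex_def)
  \<comment> \<open>Common majorant: bounded time support from \<open>\<alpha>\<close>, exponential
    decay in space from \<open>\<mu> > 0\<close>.\<close>
  define D where "D z = indicator {p..q} (fst z) * ex (snd z)" for z
  have iD: "integrable lborel D" unfolding D_def[abs_def]
    by (intro integrable_tensor iex integrable_real_indicator)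
      (auto simp: emeasure_lborel_Icc_eq)
  have Hb: "\<bar>H z\<bar> \<le> L * C" for z
    using HE[of z] mult_left_mono[OF order_trans[OF abs_ge_self Eb[of z]] L] by linarith
  have cutD: "\<bar>cut \<mu> c j x\<bar> \<le> ex x" if "2 \<le> j" for j x using cut_le[OF c that] by (simp add: ex_def)
  have tailD: "\<bar>tail \<mu> c j x\<bar> \<le> K * ex x" if "2 \<le> j" for j x using tail_le[OF c that K] by (simp add: ex_def)
  have wtD: "\<bar>weight \<mu> c x\<bar> \<le> ex x" for x
    using step_bounds[of c] by (auto simp: weight_def ex_def)
  have dom: "\<bar>indicator {0<..} (fst z) * (m * (a (fst z) * b))\<bar> \<le> M * A * N * D z"
    if "\<bar>m\<bar> \<le> M" "\<bar>b\<bar> \<le> N * ex (snd z)" "a = \<alpha> \<or> a = deriv \<alpha>" for m M b N and a :: "real \<Rightarrow> real" and z :: "real \<times> real"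
  proof (cases "fst z \<in> {p..q}")
    case True
    have "\<bar>indicator {0<..} (fst z) * (m * (a (fst z) * b))\<bar> \<le> \<bar>m * (a (fst z) * b)\<bar>"
      by (simp add: indicator_def)
    also have "\<dots> \<le> M * (A * (N * ex (snd z)))"
      unfolding abs_mult using that A by (intro mult_mono mult_nonneg_nonneg) auto
    finally show ?thesis using True by (simp add: D_def mult.assoc)
  next
    case False
    then show ?thesis using that(3) pq by (auto simp: D_def)
  qed
  have int1: "integrable lborel (\<lambda>z. indicator {0<..} (fst z) * (E z * (a (fst z) * b (snd z))))"
    if "a = \<alpha> \<or> a = deriv \<alpha>" and b: "\<And>x. \<bar>b x\<bar> \<le> N * ex x" and [measurable]: "b \<in> borel_measurable borel" for a b N
  proof (rule Bochner_Integration.integrable_bound)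
    show "integrable lborel (\<lambda>z. C * A * N * D z)" using iD by simp
    have [measurable]: "a \<in> borel_measurable borel" using that(1) test_funD(6,7)[OF \<alpha>] by blast
    show "(\<lambda>z. indicator {0<..} (fst z) * (E z * (a (fst z) * b (snd z)))) \<in> borel_measurable lborel" by measurable
    show "AE z in lborel. norm (indicator {0<..} (fst z) * (E z * (a (fst z) * b (snd z)))) \<le> norm (C * A * N * D z)"
    proof (rule AE_I2)
      fix z show "norm (indicator {0<..} (fst z) * (E z * (a (fst z) * b (snd z)))) \<le> norm (C * A * N * D z)"
        using dom[OF Eb b that(1), of z z] by simp
    qed
  qed
  have int2: "integrable lborel (\<lambda>z. indicator {0<..} (fst z) * (H z * (a (fst z) * b (snd z))))"
    if "a = \<alpha> \<or> a = deriv \<alpha>" and b: "\<And>x. \<bar>b x\<bar> \<le> N * ex x" and [measurable]: "b \<in> borel_measurable borel" for a b N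
  proof (rule Bochner_Integration.integrable_bound)
    show "integrable lborel (\<lambda>z. L * C * A * N * D z)" using iD by simp
    have [measurable]: "a \<in> borel_measurable borel" using that(1) test_funD(6,7)[OF \<alpha>] by blast
    show "(\<lambda>z. indicator {0<..} (fst z) * (H z * (a (fst z) * b (snd z)))) \<in> borel_measurable lborel" by measurable
    show "AE z in lborel. norm (indicator {0<..} (fst z) * (H z * (a (fst z) * b (snd z)))) \<le> norm (L * C * A * N * D z)"
    proof (rule AE_I2)
      fix z show "norm (indicator {0<..} (fst z) * (H z * (a (fst z) * b (snd z)))) \<le> norm (L * C * A * N * D z)"
        using dom[OF Hb b that(1), of z z] by simp
    qed
  qed
  have cutD1: "\<bar>cut \<mu> c j x\<bar> \<le> 1 * ex x" if "2 \<le> j" for j x using cutD[OF that] by simp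
  have wtD1: "\<bar>weight \<mu> c x\<bar> \<le> 1 * ex x" for x using wtD by simp
  define I where "I j = (LBINT z. indicator {0<..} (fst z) * (E z * (deriv \<alpha> (fst z) * cut \<mu> c j (snd z))))" for j
  define J where "J j = (LBINT z. indicator {0<..} (fst z) * (H z * (\<alpha> (fst z) * cut \<mu> c j (snd z))))" for j
  define K' where "K' j = (LBINT z. indicator {0<..} (fst z) * (H z * (\<alpha> (fst z) * layer \<mu> c j (snd z))))" for j
  define T where "T j = (LBINT z. indicator {0<..} (fst z) * (H z * (\<alpha> (fst z) * tail \<mu> c j (snd z))))" for j
  define V where "V j = (LBINT x. E0 x * cut \<mu> c j x)" for j
  have ineq: "0 \<le> I j - \<mu> * J j + K' j - T j + \<alpha> 0 * V j" if j: "2 \<le> j" for j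
  proof -
    have layD: "\<bar>layer \<mu> c j x\<bar> \<le> real j * K * ex x" for x
    proof (cases "x < -1")
      case True
      have "- 1 \<le> - c / real j" using c j by (simp add: field_simps)
      then have "x \<notin> {- c / real j..(1 - c) / real j}" using True by auto
      then show ?thesis using layer_eq_0[OF c j] K0 ex0 by simp
    next
      case False
      have "exp (- (\<mu> * x)) * (real j * kern (real j * x + c)) \<le> exp (- (\<mu> * x)) * (real j * K)"
        using K by (intro mult_left_mono) auto
      then show ?thesis using False layer_nonneg[of \<mu> c j x] by (simp add: ex_def layer_def mult.commute)
    qed
    note i = int1[OF disjI2[OF refl] cutD1[OF j]] int2[OF disjI1[OF refl] cutD1[OF j]]
       int2[OF disjI1[OF refl] layD] int2[OF disjI1[OF refl] tailD[OF j]]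
    have "0 \<le> (LBINT z. indicator {0<..} (fst z) * (E z * (deriv \<alpha> (fst z) * cut \<mu> c j (snd z))
        + H z * (\<alpha> (fst z) * (- \<mu> * cut \<mu> c j (snd z) + layer \<mu> c j (snd z) - tail \<mu> c j (snd z)))))
        + \<alpha> 0 * (LBINT x. E0 x * cut \<mu> c j x)"
      by (rule pos_ineqD[OF pos \<alpha> test_fun_cut[OF j sub[OF j]] test_funD(1)[OF \<alpha>] cut_deriv[OF c j]])
    also have "(LBINT z. indicator {0<..} (fst z) * (E z * (deriv \<alpha> (fst z) * cut \<mu> c j (snd z))
        + H z * (\<alpha> (fst z) * (- \<mu> * cut \<mu> c j (snd z) + layer \<mu> c j (snd z) - tail \<mu> c j (snd z)))))
      = (LBINT z. indicator {0<..} (fst z) * (E z * (deriv \<alpha> (fst z) * cut \<mu> c j (snd z)))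
         - \<mu> * (indicator {0<..} (fst z) * (H z * (\<alpha> (fst z) * cut \<mu> c j (snd z))))
         + indicator {0<..} (fst z) * (H z * (\<alpha> (fst z) * layer \<mu> c j (snd z)))
         - indicator {0<..} (fst z) * (H z * (\<alpha> (fst z) * tail \<mu> c j (snd z))))"
      by (intro Bochner_Integration.integral_cong refl) (simp add: algebra_simps)
    also have "\<dots> = I j - \<mu> * J j + K' j - T j"
      unfolding I_def J_def K'_def T_def using i by simp
    finally show ?thesis by (simp add: V_def)
  qed
  \<comment> \<open>The estimates on \<open>cut\<close> require \<open>j >= 2\<close>, hence the
    index shift by 2 here and in the following limits.\<close>
  have lI: "I \<longlonglongrightarrow> (LBINT z. indicator {0<..} (fst z) * (E z * (deriv \<alpha> (fst z) * weight \<mu> c (snd z))))"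
    unfolding I_def
  proof (rule LIMSEQ_offset[where k=2], rule integral_dominated_convergence[where w="\<lambda>z. C * A * 1 * D z"])
    show "AE z in lborel. (\<lambda>j. indicator {0<..} (fst z) * (E z * (deriv \<alpha> (fst z) * cut \<mu> c (j + 2) (snd z))))
       \<longlonglongrightarrow> indicator {0<..} (fst z) * (E z * (deriv \<alpha> (fst z) * weight \<mu> c (snd z)))"
      by (intro AE_I2 tendsto_intros LIMSEQ_ignore_initial_segment cut_tendsto)
    fix j :: nat
    show "AE z in lborel. norm (indicator {0<..} (fst z) * (E z * (deriv \<alpha> (fst z) * cut \<mu> c (j + 2) (snd z)))) \<le> C * A * 1 * D z"
      unfolding real_norm_def by (intro AE_I2 dom Eb cutD1) auto
  qed (use iD in \<open>simp_all, measurable\<close>)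
  have lJ: "J \<longlonglongrightarrow> (LBINT z. indicator {0<..} (fst z) * (H z * (\<alpha> (fst z) * weight \<mu> c (snd z))))"
    unfolding J_def
  proof (rule LIMSEQ_offset[where k=2], rule integral_dominated_convergence[where w="\<lambda>z. L * C * A * 1 * D z"])
    show "AE z in lborel. (\<lambda>j. indicator {0<..} (fst z) * (H z * (\<alpha> (fst z) * cut \<mu> c (j + 2) (snd z))))
       \<longlonglongrightarrow> indicator {0<..} (fst z) * (H z * (\<alpha> (fst z) * weight \<mu> c (snd z)))"
      by (intro AE_I2 tendsto_intros LIMSEQ_ignore_initial_segment cut_tendsto)
    fix j :: nat
    show "AE z in lborel. norm (indicator {0<..} (fst z) * (H z * (\<alpha> (fst z) * cut \<mu> c (j + 2) (snd z)))) \<le> L * C * A * 1 * D z"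
      unfolding real_norm_def by (intro AE_I2 dom Hb cutD1) auto
  qed (use iD in \<open>simp_all, measurable\<close>)
  have "T \<longlonglongrightarrow> (LBINT z. indicator {0<..} (fst z) * (H z * (\<alpha> (fst z) * 0)))"
    unfolding T_def
  proof (rule LIMSEQ_offset[where k=2], rule integral_dominated_convergence[where w="\<lambda>z. L * C * A * K * D z"])
    show "AE z in lborel. (\<lambda>j. indicator {0<..} (fst z) * (H z * (\<alpha> (fst z) * tail \<mu> c (j + 2) (snd z))))
       \<longlonglongrightarrow> indicator {0<..} (fst z) * (H z * (\<alpha> (fst z) * 0))"
      by (intro AE_I2 tendsto_intros LIMSEQ_ignore_initial_segment tail_tendsto)
    fix j :: nat
    show "AE z in lborel. norm (indicator {0<..} (fst z) * (H z * (\<alpha> (fst z) * tail \<mu> c (j + 2) (snd z)))) \<le> L * C * A * K * D z"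
      unfolding real_norm_def by (intro AE_I2 dom Hb tailD) auto
  qed (use iD in \<open>simp_all, measurable\<close>)
  then have lT: "T \<longlonglongrightarrow> 0" by simp
  have dom0: "\<bar>E0 x * b\<bar> \<le> C0 * ex x" if "\<bar>b\<bar> \<le> ex x" for x b
    unfolding abs_mult using E0b[of x] that by (intro mult_mono) auto
  have lV: "V \<longlonglongrightarrow> (LBINT x. E0 x * weight \<mu> c x)"
    unfolding V_def
  proof (rule LIMSEQ_offset[where k=2], rule integral_dominated_convergence[where w="\<lambda>x. C0 * ex x"])
    show "AE x in lborel. (\<lambda>j. E0 x * cut \<mu> c (j + 2) x) \<longlonglongrightarrow> E0 x * weight \<mu> c x"
      by (intro AE_I2 tendsto_intros LIMSEQ_ignore_initial_segment cut_tendsto)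
    fix j :: nat
    show "AE x in lborel. norm (E0 x * cut \<mu> c (j + 2) x) \<le> C0 * ex x"
      unfolding real_norm_def by (intro AE_I2 dom0 cutD) auto
  qed (use iex in \<open>simp_all, measurable\<close>)
  show "integrable lborel (\<lambda>x. E0 x * weight \<mu> c x)"
  proof (rule Bochner_Integration.integrable_bound)
    show "integrable lborel (\<lambda>x. C0 * ex x)" using iex by simp
    show "AE x in lborel. norm (E0 x * weight \<mu> c x) \<le> norm (C0 * ex x)"
    proof (rule AE_I2)
      fix x show "norm (E0 x * weight \<mu> c x) \<le> norm (C0 * ex x)" using dom0[OF wtD[of x]] by simp
    qed
  qed simp
  note i1 = int1[OF disjI2[OF refl] wtD1 weight_borel] and i2 = int1[OF disjI1[OF refl] wtD1 weight_borel]
    and i3 = int2[OF disjI1[OF refl] wtD1 weight_borel]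
  have eq: "(\<lambda>z. indicator {0<..} (fst z) * (E z * ((deriv \<alpha> (fst z) + L * \<mu> * \<alpha> (fst z)) * weight \<mu> c (snd z))))
     = (\<lambda>z. indicator {0<..} (fst z) * (E z * (deriv \<alpha> (fst z) * weight \<mu> c (snd z)))
        + L * \<mu> * (indicator {0<..} (fst z) * (E z * (\<alpha> (fst z) * weight \<mu> c (snd z)))))"
    by (rule ext) (simp add: algebra_simps)
  show "integrable lborel (\<lambda>z. indicator {0<..} (fst z) * (E z * ((deriv \<alpha> (fst z) + L * \<mu> * \<alpha> (fst z)) * weight \<mu> c (snd z))))"
    unfolding eq using i1 i2 by simp
  have "(\<lambda>j. I j - \<mu> * J j + K' j - T j + \<alpha> 0 * V j) \<longlonglongrightarrow>
      (LBINT z. indicator {0<..} (fst z) * (E z * (deriv \<alpha> (fst z) * weight \<mu> c (snd z))))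
      - \<mu> * (LBINT z. indicator {0<..} (fst z) * (H z * (\<alpha> (fst z) * weight \<mu> c (snd z)))) + l - 0
      + \<alpha> 0 * (LBINT x. E0 x * weight \<mu> c x)"
    using lim[folded K'_def] by (intro tendsto_intros lI lJ lT lV)
  then have "0 \<le> (LBINT z. indicator {0<..} (fst z) * (E z * (deriv \<alpha> (fst z) * weight \<mu> c (snd z))))
      - \<mu> * (LBINT z. indicator {0<..} (fst z) * (H z * (\<alpha> (fst z) * weight \<mu> c (snd z)))) + l - 0
      + \<alpha> 0 * (LBINT x. E0 x * weight \<mu> c x)"
    by (rule tendsto_lowerbound) (auto intro!: exI[of _ 2] ineq simp: eventually_sequentially)
  \<comment> \<open>Here the weight is paid for: the flux through it is at most \<open>L\<close>
    times the weighted entropy.\<close>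
  moreover have "- (LBINT z. indicator {0<..} (fst z) * (H z * (\<alpha> (fst z) * weight \<mu> c (snd z))))
      \<le> L * (LBINT z. indicator {0<..} (fst z) * (E z * (\<alpha> (fst z) * weight \<mu> c (snd z))))"
    unfolding Bochner_Integration.integral_minus[symmetric] integral_mult_right_zero[symmetric]
  proof (rule integral_mono)
    fix z :: "real \<times> real"
    have w: "0 \<le> indicator {0<..} (fst z) * (\<alpha> (fst z) * weight \<mu> c (snd z))"
      using test_funD(4)[OF \<alpha>] step_bounds by (auto simp: weight_def indicator_def)
    have "- H z \<le> L * E z" using HE[of z] by linarith
    from mult_right_mono[OF this w]
    show "- (indicator {0<..} (fst z) * (H z * (\<alpha> (fst z) * weight \<mu> c (snd z))))
        \<le> L * (indicator {0<..} (fst z) * (E z * (\<alpha> (fst z) * weight \<mu> c (snd z))))"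
      by (simp add: algebra_simps)
  qed (use i2 i3 in simp_all)
  from mult_left_mono[OF this less_imp_le[OF \<mu>]]
  have "- (\<mu> * (LBINT z. indicator {0<..} (fst z) * (H z * (\<alpha> (fst z) * weight \<mu> c (snd z)))))
      \<le> L * \<mu> * (LBINT z. indicator {0<..} (fst z) * (E z * (\<alpha> (fst z) * weight \<mu> c (snd z))))"
    by (simp add: algebra_simps)
  moreover have "(LBINT z. indicator {0<..} (fst z) * (E z * ((deriv \<alpha> (fst z) + L * \<mu> * \<alpha> (fst z)) * weight \<mu> c (snd z))))
    = (LBINT z. indicator {0<..} (fst z) * (E z * (deriv \<alpha> (fst z) * weight \<mu> c (snd z))))
      + L * \<mu> * (LBINT z. indicator {0<..} (fst z) * (E z * (\<alpha> (fst z) * weight \<mu> c (snd z))))"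
    unfolding eq using i1 i2 by simp
  ultimately show "0 \<le> (LBINT z. indicator {0<..} (fst z) * (E z * ((deriv \<alpha> (fst z) + L * \<mu> * \<alpha> (fst z)) * weight \<mu> c (snd z))))
           + l + \<alpha> 0 * (LBINT x. E0 x * weight \<mu> c x)" by linarith
qed

section \<open>Traces and boundary conditions\<close>

text \<open>An integrating factor for the term \<open>C * \<alpha>\<close> produced by the spatial
  weight.\<close>

lemma exp_weight_test_fun:
  assumes \<gamma>: "test_fun UNIV \<gamma>"
  shows "test_fun UNIV (\<lambda>t. \<gamma> t * exp (- (C * t)))"
    and "deriv (\<lambda>t. \<gamma> t * exp (- (C * t))) t + C * (\<gamma> t * exp (- (C * t))) = deriv \<gamma> t * exp (- (C * t))"
proof -
  have "Ck k (\<lambda>t. exp (- (C * t)))" for k using Ck_exp[of k "- C"] by simp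
  then show "test_fun UNIV (\<lambda>t. \<gamma> t * exp (- (C * t)))" by (rule test_fun_mult[OF \<gamma>]) simp
  have "((\<lambda>t. exp (- (C * t))) has_real_derivative - C * exp (- (C * t))) (at t)"
    by (auto intro!: derivative_eq_intros)
  from DERIV_imp_deriv[OF DERIV_mult[OF test_funD(1)[OF \<gamma>] this]]
  show "deriv (\<lambda>t. \<gamma> t * exp (- (C * t))) t + C * (\<gamma> t * exp (- (C * t))) = deriv \<gamma> t * exp (- (C * t))"
    by (simp add: algebra_simps)
qed

text \<open>For \<open>\<tau> >= 0\<close> and \<open>e > 0\<close>: equal to 1 from
  \<open>-1\<close> to \<open>\<tau>\<close>, then falling to 0 within time \<open>e\<close>. The
  other factor cuts off at negative times, for compact support.\<close>

definition down :: "real \<Rightarrow> real \<Rightarrow> real \<Rightarrow> real" where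
  "down \<tau> e t = step (t + 2) * (1 - step ((t - \<tau>) / e))"

lemma down_test_fun:
  assumes "0 < e" shows "test_fun UNIV (down \<tau> e)"
proof (rule test_funI[where c="-2" and d="\<tau> + e"])
  have "Ck k (\<lambda>t. step (1 * t + 2) * (1 + (- 1) * step (1 / e * t + (- \<tau> / e))))" for k
    by (intro Ck_mult Ck_add Ck_const Ck_affine Ck_step)
  then show "Ck k (down \<tau> e)" for k by (simp add: down_def[abs_def] diff_divide_distrib)
  show "0 \<le> down \<tau> e t" for t
    using step_bounds[of "t + 2"] step_bounds[of "(t - \<tau>) / e"] by (simp add: down_def)
  show "down \<tau> e t = 0" if "t \<notin> {-2..\<tau> + e}" for t
  proof (cases "t < -2")
    case True
    then show ?thesis using step_0[of "t + 2"] by (simp add: down_def)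
  next
    case False
    then have "1 \<le> (t - \<tau>) / e" using that assms by auto
    then show ?thesis using step_1 by (simp add: down_def)
  qed
qed auto

lemma down_deriv:
  assumes "0 < t"
  shows "deriv (down \<tau> e) t = - kn e (t - \<tau>)"
proof -
  have 1: "((\<lambda>t. step (t + 2)) has_real_derivative kern (t + 2) * 1) (at t)"
    by (rule DERIV_chain2[OF step_deriv]) (auto intro!: derivative_eq_intros)
  have 2: "((\<lambda>t. step ((t - \<tau>) / e)) has_real_derivative kern ((t - \<tau>) / e) * (1 / e)) (at t)"
    by (rule DERIV_chain2[OF step_deriv]) (rule DERIV_cdivide, auto intro!: derivative_eq_intros)
  have "(down \<tau> e has_real_derivative kern (t + 2) * (1 - step ((t - \<tau>) / e)) - step (t + 2) * kn e (t - \<tau>)) (at t)"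
    unfolding down_def[abs_def] by (rule derivative_eq_intros 1 2 refl)+ (simp add: kn_def)
  moreover have "kern (t + 2) = 0" "step (t + 2) = 1" using assms by (auto intro: kern_eq_0 step_1)
  ultimately show ?thesis by (intro DERIV_imp_deriv) simp
qed

lemma kruzhkov_borel [measurable (raw)]:
  assumes [measurable]: "a \<in> borel_measurable M"
  shows "(\<lambda>x. kruzhkov p q k (a x)) \<in> borel_measurable M"
  unfolding kruzhkov_def by measurable

lemma isCont_kruzhkov_flux:
  assumes "L-lipschitz_on UNIV f" "0 \<le> p" "0 \<le> q"
  shows "isCont (kruzhkov_flux f p q k) u"
  using lipschitz_on_continuous_on[OF kruzhkov_flux_lipschitz[OF assms, of k]]
  by (simp add: continuous_on_eq_continuous_at)

lemma kruzhkov_flux_borel: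
  assumes "L-lipschitz_on UNIV f" "0 \<le> p" "0 \<le> q" "a \<in> borel_measurable M"
  shows "(\<lambda>x. kruzhkov_flux f p q k (a x)) \<in> borel_measurable M"
  using measurable_compose[OF assms(4) borel_measurable_continuous_onI[OF
      lipschitz_on_continuous_on[OF kruzhkov_flux_lipschitz[OF assms(1-3), of k]]]] .

lemma kruzhkov_bound:
  assumes "\<bar>u\<bar> \<le> B" "0 \<le> p" "0 \<le> q"
  shows "\<bar>kruzhkov p q k u\<bar> \<le> (p + q) * (B + \<bar>k\<bar>)"
proof -
  have "p * max 0 (k - u) \<le> p * (B + \<bar>k\<bar>)" "q * max 0 (u - k) \<le> q * (B + \<bar>k\<bar>)"
    using assms by (intro mult_left_mono; auto)+
  then show ?thesis using kruzhkov_nonneg[OF assms(2,3), of k u] by (simp add: kruzhkov_def distrib_right)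
qed

text \<open>Test functions supported in \<open>(0,\<infinity>)\<close> up to a thin layer on the left of \<open>0\<close>: the layer sees only
  the trace \<open>\<sigma>\<close>, and the rest of the inequality has a sign because the data on the right is \<open>\<rho>\<close>.\<close>

lemma boundary_entropy_nonneg:
  assumes lip: "L-lipschitz_on UNIV f" and r[measurable]: "r \<in> borel_measurable borel" and rb: "\<And>z. \<bar>r z\<bar> \<le> B"
    and pq: "0 \<le> p" "0 \<le> q"
    and pos: "pos_ineq UNIV (\<lambda>z. kruzhkov p q k (r z)) (\<lambda>z. kruzhkov_flux f p q k (r z))
        (\<lambda>x. kruzhkov p q k (if x < 0 then \<sigma> else \<rho>))"
    and \<rho>: "kruzhkov p q k \<rho> = 0"
    and tr: "AE t in lborel. t > 0 \<longrightarrow> ((\<lambda>x. r (t, x)) \<longlongrightarrow> \<sigma>) (ess_at0 {..<0})"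
  shows "0 \<le> kruzhkov_flux f p q k \<sigma>"
proof -
  have L: "0 \<le> L" using lip lipschitz_on_nonneg by blast
  \<comment> \<open>The weight is used with \<open>\<mu> = 1\<close>, so the factor
    \<open>exp (- L t)\<close> compensates it exactly and the time derivative leaves only
    \<open>- kn 1 (t - 1)\<close>, which has a sign.\<close>
  define \<alpha> where "\<alpha> t = down 1 1 t * exp (- (L * t))" for t
  have \<alpha>: "test_fun UNIV \<alpha>" unfolding \<alpha>_def[abs_def] by (intro exp_weight_test_fun down_test_fun) simp
  note [measurable] = test_funD(6,7)[OF \<alpha>]
  have \<alpha>': "deriv \<alpha> t + L * \<alpha> t = - kn 1 (t - 1) * exp (- (L * t))" if "0 < t" for t
    using exp_weight_test_fun(2)[OF down_test_fun[of 1 1], of L t] down_deriv[OF that, of 1 1]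
    by (simp add: \<alpha>_def[abs_def])
  obtain c d where cd: "\<forall>x. x \<notin> {c..d} \<longrightarrow> \<alpha> x = 0 \<and> deriv \<alpha> x = 0"
    using test_fun_support[OF \<alpha>] by blast
  obtain A where A: "0 \<le> A" "\<forall>x. \<bar>\<alpha> x\<bar> \<le> A \<and> \<bar>deriv \<alpha> x\<bar> \<le> A" using test_fun_bounded[OF \<alpha>] by blast
  have i\<alpha>: "integrable lborel \<alpha>"
    by (rule integrable_bounded_support[where S="{c..d}" and C=A]) (use A cd in auto)
  have i\<alpha>0: "integrable lborel (\<lambda>t. indicator {0<..} t * \<alpha> t)"
    by (rule Bochner_Integration.integrable_bound[OF i\<alpha>]) (auto simp: indicator_def)
  define fl where "fl = kruzhkov_flux f p q k"
  define E where "E z = kruzhkov p q k (r z)" for z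
  define H where "H z = fl (r z)" for z
  have [measurable]: "E \<in> borel_measurable borel" unfolding E_def[abs_def] by measurable
  have [measurable]: "H \<in> borel_measurable borel" unfolding H_def[abs_def] fl_def
    by (rule kruzhkov_flux_borel[OF lip pq r])
  define C where "C = (p + q) * (B + \<bar>k\<bar>)"
  have Eb: "\<bar>E z\<bar> \<le> C" for z unfolding E_def C_def by (rule kruzhkov_bound[OF rb pq])
  have HE: "\<bar>H z\<bar> \<le> L * E z" for z unfolding H_def E_def fl_def by (rule kruzhkov_flux_le[OF lip pq])
  have Hb: "\<bar>H z\<bar> \<le> L * C" for z
    using HE[of z] mult_left_mono[OF order_trans[OF abs_ge_self Eb[of z]] L] by linarith
  have LC: "0 \<le> L * C" using Hb[of undefined] by linarith
  \<comment> \<open>The trace is attained for almost every fixed time, so the space integral is done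
    first and dominated convergence is applied in time.\<close>
  have lim: "(\<lambda>j. LBINT z. indicator {0<..} (fst z) * (H z * (\<alpha> (fst z) * layer 1 2 j (snd z))))
      \<longlonglongrightarrow> (LBINT t. indicator {0<..} t * \<alpha> t * fl \<sigma>)"
  proof (rule LIMSEQ_offset[where k=2])
    have eq: "(LBINT z. indicator {0<..} (fst z) * (H z * (\<alpha> (fst z) * layer 1 2 (j + 2) (snd z))))
        = (LBINT t. indicator {0<..} t * \<alpha> t * (LBINT x. layer 1 2 (j + 2) x * H (t, x)))" for j
    proof -
      have "integrable lborel (\<lambda>z. indicator {0<..} (fst z) * (H z * (\<alpha> (fst z) * layer 1 2 (j + 2) (snd z))))"
      proof (rule Bochner_Integration.integrable_bound)
        show "integrable lborel (\<lambda>z. L * C * (\<alpha> (fst z) * layer 1 2 (j + 2) (snd z)))"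
          using integrable_tensor[OF i\<alpha> layer_mass(1)[of 1 2 "j + 2"]] by simp
        show "AE z in lborel. norm (indicator {0<..} (fst z) * (H z * (\<alpha> (fst z) * layer 1 2 (j + 2) (snd z))))
           \<le> norm (L * C * (\<alpha> (fst z) * layer 1 2 (j + 2) (snd z)))"
        proof (rule AE_I2)
          fix z :: "real \<times> real"
          have "\<bar>H z\<bar> * \<bar>\<alpha> (fst z) * layer 1 2 (j + 2) (snd z)\<bar> \<le> L * C * \<bar>\<alpha> (fst z) * layer 1 2 (j + 2) (snd z)\<bar>"
            by (rule mult_right_mono[OF Hb]) simp
          then show "norm (indicator {0<..} (fst z) * (H z * (\<alpha> (fst z) * layer 1 2 (j + 2) (snd z))))
             \<le> norm (L * C * (\<alpha> (fst z) * layer 1 2 (j + 2) (snd z)))"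
            using LC by (simp add: abs_mult[of "L * C"] abs_mult[of "H z"] indicator_def)
        qed
      qed measurable
      from Fubini_lborel(1)[OF this]
      have "(LBINT z. indicator {0<..} (fst z) * (H z * (\<alpha> (fst z) * layer 1 2 (j + 2) (snd z))))
        = (LBINT t. (LBINT x. indicator {0<..} t * (H (t, x) * (\<alpha> t * layer 1 2 (j + 2) x))))" by simp
      also have "\<dots> = (LBINT t. (LBINT x. indicator {0<..} t * \<alpha> t * (layer 1 2 (j + 2) x * H (t, x))))"
        by (intro Bochner_Integration.integral_cong refl) (simp add: algebra_simps)
      finally show ?thesis by simp
    qed
    show "(\<lambda>j. LBINT z. indicator {0<..} (fst z) * (H z * (\<alpha> (fst z) * layer 1 2 (j + 2) (snd z))))
        \<longlonglongrightarrow> (LBINT t. indicator {0<..} t * \<alpha> t * fl \<sigma>)"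
      unfolding eq
    proof (rule integral_dominated_convergence[where w="\<lambda>t. L * C * exp 2 * \<bar>\<alpha> t\<bar>"])
      show "integrable lborel (\<lambda>t. L * C * exp 2 * \<bar>\<alpha> t\<bar>)" using i\<alpha> by simp
      from tr show "AE t in lborel. (\<lambda>j. indicator {0<..} t * \<alpha> t * (LBINT x. layer 1 2 (j + 2) x * H (t, x)))
          \<longlonglongrightarrow> indicator {0<..} t * \<alpha> t * fl \<sigma>"
      proof eventually_elim
        case (elim t)
        show ?case
        proof (cases "0 < t")
          case True
          then have "((\<lambda>x. r (t, x)) \<longlongrightarrow> \<sigma>) (ess_at0 {..<0})" using elim by simp
          then have "((\<lambda>x. H (t, x)) \<longlongrightarrow> fl \<sigma>) (ess_at0 (side 2))"
            using isCont_tendsto_compose[OF isCont_kruzhkov_flux[OF lip pq, where k=k and u=\<sigma>]]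
            by (simp add: H_def fl_def side_def)
          then have "(\<lambda>j. LBINT x. layer 1 2 j x * H (t, x)) \<longlonglongrightarrow> fl \<sigma>"
            by (intro layer_limit[OF _ _ _ Hb]) auto
          then show ?thesis by (intro tendsto_intros LIMSEQ_ignore_initial_segment)
        qed simp
      qed
      fix j :: nat
      show "AE t in lborel. norm (indicator {0<..} t * \<alpha> t * (LBINT x. layer 1 2 (j + 2) x * H (t, x))) \<le> L * C * exp 2 * \<bar>\<alpha> t\<bar>"
      proof (rule AE_I2)
        fix t
        have il: "integrable lborel (layer 1 2 (j + 2))" using layer_mass(1)[of 1 2 "j + 2"] by simp
        have "\<bar>LBINT x. layer 1 2 (j + 2) x * H (t, x)\<bar> \<le> (LBINT x. \<bar>layer 1 2 (j + 2) x * H (t, x)\<bar>)"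
          by (rule integral_abs_bound)
        also have "\<dots> \<le> (LBINT x. L * C * layer 1 2 (j + 2) x)"
        proof (rule Bochner_Integration.integral_mono')
          show "integrable lborel (\<lambda>x. L * C * layer 1 2 (j + 2) x)" using il by simp
          fix x
          show "\<bar>layer 1 2 (j + 2) x * H (t, x)\<bar> \<le> L * C * layer 1 2 (j + 2) x"
            using mult_right_mono[OF Hb[of "(t, x)"] layer_nonneg[of 1 2 "j + 2" x]] layer_nonneg[of 1 2 "j + 2" x]
            by (simp add: abs_mult mult.commute)
          show "0 \<le> L * C * layer 1 2 (j + 2) x" using LC layer_nonneg by simp
        qed
        also have "\<dots> \<le> L * C * exp 2"
          using layer_mass(3)[of 1 2 "j + 2"] LC by (simp add: mult_left_mono)
        finally have "\<bar>LBINT x. layer 1 2 (j + 2) x * H (t, x)\<bar> \<le> L * C * exp 2" .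
        from mult_left_mono[OF this abs_ge_zero[of "\<alpha> t"]]
        show "norm (indicator {0<..} t * \<alpha> t * (LBINT x. layer 1 2 (j + 2) x * H (t, x))) \<le> L * C * exp 2 * \<bar>\<alpha> t\<bar>"
          using LC by (simp add: indicator_def abs_mult mult.commute)
      qed
    qed measurable
  qed
  have E0m: "(\<lambda>x :: real. kruzhkov p q k (if x < 0 then \<sigma> else \<rho>)) \<in> borel_measurable borel" by measurable
  have E0b: "\<bar>kruzhkov p q k (if x < 0 then \<sigma> else \<rho>)\<bar> \<le> kruzhkov p q k \<sigma>" for x :: real
    using kruzhkov_nonneg[OF pq] \<rho> by simp
  have "0 \<le> (LBINT z. indicator {0<..} (fst z) * (E z * ((deriv \<alpha> (fst z) + L * 1 * \<alpha> (fst z)) * weight 1 2 (snd z))))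
      + (LBINT t. indicator {0<..} t * \<alpha> t * fl \<sigma>)
      + \<alpha> 0 * (LBINT x. kruzhkov p q k (if x < 0 then \<sigma> else \<rho>) * weight 1 2 x)"
    by (rule halfline_limit(1)[OF _ _ _ L _ _ E0m Eb HE E0b pos[folded fl_def, folded E_def H_def] _ \<alpha> lim]) auto
  moreover have "(LBINT z. indicator {0<..} (fst z) * (E z * ((deriv \<alpha> (fst z) + L * 1 * \<alpha> (fst z)) * weight 1 2 (snd z)))) \<le> 0"
  proof -
    have "0 \<le> (LBINT z. - (indicator {0<..} (fst z) * (E z * ((deriv \<alpha> (fst z) + L * 1 * \<alpha> (fst z)) * weight 1 2 (snd z)))))"
    proof (rule Bochner_Integration.integral_nonneg)
      fix z :: "real \<times> real"
      show "0 \<le> - (indicator {0<..} (fst z) * (E z * ((deriv \<alpha> (fst z) + L * 1 * \<alpha> (fst z)) * weight 1 2 (snd z))))"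
      proof (cases "0 < fst z")
        case True
        have "0 \<le> E z" "0 \<le> weight 1 2 (snd z)" "0 \<le> kn 1 (fst z - 1)"
          using kruzhkov_nonneg[OF pq] step_bounds kn_nonneg by (auto simp: E_def weight_def)
        then show ?thesis using True \<alpha>'[OF True] by simp
      qed simp
    qed
    then show ?thesis by simp
  qed
  \<comment> \<open>For \<open>x < 0\<close> the weight vanishes, and for \<open>x >= 0\<close> the
    datum is \<open>\<rho>\<close>, where the entropy is zero.\<close>
  moreover have "(LBINT x. kruzhkov p q k (if x < 0 then \<sigma> else \<rho>) * weight 1 2 x) = 0"
  proof -
    have "kruzhkov p q k (if x < 0 then \<sigma> else \<rho>) * weight 1 2 x = 0" for x using \<rho> by (simp add: weight_def)
    then show ?thesis by (simp only: Bochner_Integration.integral_zero)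
  qed
  ultimately have "0 \<le> (LBINT t. indicator {0<..} t * \<alpha> t) * fl \<sigma>" by simp
  moreover have "0 < (LBINT t. indicator {0<..} t * \<alpha> t)"
  proof -
    \<comment> \<open>On \<open>[1/2, 1]\<close> the factor \<open>down 1 1\<close> equals 1, so
      \<open>\<alpha>\<close> is at least \<open>exp (- L)\<close> there.\<close>
    have "exp (- L) / 2 = (LBINT t. exp (- L) * indicator {1/2..1::real} t)" by simp
    also have "\<dots> \<le> (LBINT t. indicator {0<..} t * \<alpha> t)"
    proof (rule integral_mono[OF _ i\<alpha>0])
      show "integrable lborel (\<lambda>t. exp (- L) * indicator {1/2..1::real} t)"
        by (intro integrable_mult_right integrable_real_indicator)
          (simp_all add: emeasure_lborel_cbox_finite[of "1/2" "1::real", simplified])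
      fix t :: real
      show "exp (- L) * indicator {1/2..1} t \<le> indicator {0<..} t * \<alpha> t"
      proof (cases "t \<in> {1/2..1}")
        case True
        then have "down 1 1 t = 1" using step_1[of "t + 2"] step_0[of "t - 1"] by (simp add: down_def)
        moreover have "L * t \<le> L * 1" using True L by (intro mult_left_mono) auto
        ultimately show ?thesis using True by (simp add: \<alpha>_def)
      next
        case False
        then have "indicator {1/2..1} t = (0 :: real)" by simp
        then show ?thesis using test_funD(4)[OF \<alpha>, of t] by simp
      qed
    qed
    finally show ?thesis using exp_gt_zero[of "- L"] by linarith
  qed
  ultimately show ?thesis by (simp add: zero_le_mult_iff fl_def)
qed

text \<open>The Bardos-LeRoux-Nedelec condition for the trace \<open>\<sigma>\<close> on the left of
  the exterior state \<open>\<rho>\<close>. It says that \<open>g \<sigma>\<close> is the Godunov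
  flux of the two states: the minimum of \<open>g\<close> over \<open>[\<sigma>, \<rho>]\<close>, or
  the maximum over \<open>[\<rho>, \<sigma>]\<close>.\<close>

definition godunov :: "(real \<Rightarrow> real) \<Rightarrow> real \<Rightarrow> real \<Rightarrow> bool" where
  "godunov g \<sigma> \<rho> \<longleftrightarrow> (\<forall>k. (\<sigma> < k \<and> k \<le> \<rho> \<longrightarrow> g \<sigma> \<le> g k) \<and> (\<rho> \<le> k \<and> k \<le> \<sigma> \<longrightarrow> g k \<le> g \<sigma>))"

text \<open>For \<open>\<sigma>1 <= \<sigma>2\<close> this is an equality by the definition of
  \<open>Q\<close>. Otherwise \<open>g \<sigma>2 <= g \<sigma>1\<close> is needed, and the order of
  the exterior states provides a state between the traces that both conditions reach; it may be one
  of the traces itself.\<close>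

lemma godunov_ordered:
  assumes "godunov g \<sigma>1 \<rho>1" "godunov g \<sigma>2 \<rho>2" "\<rho>1 \<le> \<rho>2"
  shows "g \<sigma>2 - g \<sigma>1 \<le> Q g \<sigma>1 \<sigma>2"
proof -
  have "g \<sigma>2 \<le> g \<sigma>1" if "\<sigma>2 < \<sigma>1"
  proof -
    have up: "g \<sigma> \<le> g k" if "godunov g \<sigma> \<rho>" "\<sigma> \<le> k" "k \<le> \<rho>" for \<sigma> \<rho> k
      using that by (cases "\<sigma> = k") (auto simp: godunov_def)
    have dn: "g k \<le> g \<sigma>" if "godunov g \<sigma> \<rho>" "\<rho> \<le> k" "k \<le> \<sigma>" for \<sigma> \<rho> k
      using that by (auto simp: godunov_def)
    consider "\<rho>1 \<le> \<sigma>1" "\<sigma>2 \<le> \<rho>2" | "\<rho>2 < \<sigma>2" | "\<sigma>1 < \<rho>1" by linarith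
    then show ?thesis
    proof cases
      case 1
      \<comment> \<open>It lies in \<open>[\<rho>1, \<sigma>1]\<close> and in
        \<open>[\<sigma>2, \<rho>2]\<close>, where the two conditions apply.\<close>
      define k where "k = max \<rho>1 \<sigma>2"
      have "g k \<le> g \<sigma>1" using 1 that by (intro dn[OF assms(1)]) (auto simp: k_def)
      moreover have "g \<sigma>2 \<le> g k" using 1 that assms(3) by (intro up[OF assms(2)]) (auto simp: k_def)
      ultimately show ?thesis by simp
    next
      case 2
      then show ?thesis using that assms(3) by (intro dn[OF assms(1)]) auto
    next
      case 3
      then show ?thesis using that assms(3) by (intro up[OF assms(2)]) auto
    qed
  qed
  then show ?thesis by (cases "\<sigma>2 < \<sigma>1") (auto simp: Q_def sgn_if)
qed

text \<open>Only the fluxes relative to the fixed state \<open>m\<close> are known to converge.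
  Replacing \<open>u1\<close> by \<open>\<sigma>1\<close> and then \<open>u2\<close> by
  \<open>\<sigma>2\<close> changes the flux of the pair by no more than these fluxes change,
  according to \<open>uni\<close>. Convergence is local in the open time half-line, so times near 0
  are treated by boundedness.\<close>

lemma trace_flux_limit:
  fixes u1 u2 :: "real \<times> real \<Rightarrow> real" and \<sigma>1 \<sigma>2 :: "real \<Rightarrow> real"
  assumes lip: "L-lipschitz_on UNIV f"
    and meas[measurable]: "u1 \<in> borel_measurable borel" "u2 \<in> borel_measurable borel"
      "\<sigma>1 \<in> borel_measurable borel" "\<sigma>2 \<in> borel_measurable borel"
    and rng: "\<And>z. u1 z \<in> {a..b}" "\<And>z. u2 z \<in> {a..b}" "\<And>t. \<sigma>1 t \<in> {a..b}" "\<And>t. \<sigma>2 t \<in> {a..b}"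
    and uni: "\<And>u u' v. u \<in> {a..b} \<Longrightarrow> u' \<in> {a..b} \<Longrightarrow> v \<in> {a..b} \<Longrightarrow> \<bar>Q f u v - Q f u' v\<bar> \<le> \<bar>Q f u m - Q f u' m\<bar>"
    and tr1: "\<And>c d. 0 < c \<Longrightarrow> c \<le> d \<Longrightarrow>
       ((\<lambda>x. L1_dist {c..d} (\<lambda>t. Q f (u1 (t, x)) m) (\<lambda>t. Q f (\<sigma>1 t) m)) \<longlongrightarrow> 0) (ess_at0 {0<..})"
    and tr2: "\<And>c d. 0 < c \<Longrightarrow> c \<le> d \<Longrightarrow>
       ((\<lambda>x. L1_dist {c..d} (\<lambda>t. Q f (u2 (t, x)) m) (\<lambda>t. Q f (\<sigma>2 t) m)) \<longlongrightarrow> 0) (ess_at0 {0<..})"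
    and \<alpha>: "test_fun UNIV \<alpha>"
  shows "((\<lambda>x. LBINT t. indicator {0<..} t * (Q f (u1 (t, x)) (u2 (t, x)) * \<alpha> t))
      \<longlongrightarrow> (LBINT t. indicator {0<..} t * (Q f (\<sigma>1 t) (\<sigma>2 t) * \<alpha> t))) (ess_at0 {0<..})"
proof (rule tendstoI)
  fix e :: real assume "0 < e"
  note [measurable] = test_funD(6)[OF \<alpha>] borel_measurable_Q[OF lipschitz_on_continuous_on[OF lip]]
  obtain p q where pq: "\<forall>x. x \<notin> {p..q} \<longrightarrow> \<alpha> x = 0 \<and> deriv \<alpha> x = 0"
    using test_fun_support[OF \<alpha>] by blast
  obtain A where A: "0 \<le> A" "\<forall>x. \<bar>\<alpha> x\<bar> \<le> A \<and> \<bar>deriv \<alpha> x\<bar> \<le> A" using test_fun_bounded[OF \<alpha>] by blast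
  have L: "0 \<le> L" using lip lipschitz_on_nonneg by blast
  have ab: "a \<le> b" using rng(3)[of 0] by simp
  define M where "M = L * (b - a)"
  have M: "0 \<le> M" using L ab by (simp add: M_def)
  have Qb: "\<bar>Q f u v\<bar> \<le> M" if "u \<in> {a..b}" "v \<in> {a..b}" for u v
  proof -
    have "L * \<bar>u - v\<bar> \<le> L * (b - a)" using that L by (intro mult_left_mono) auto
    then show ?thesis using Q_le[OF lip, of u v] by (simp add: M_def)
  qed
  \<comment> \<open>The flux difference is at most \<open>2 * M\<close> and \<open>\<alpha>\<close>
    at most \<open>A\<close>, so times before \<open>c\<close> contribute at most
    \<open>2 * M * A * c\<close>, a third of \<open>e\<close>; adding 1 avoids a zero
    denominator.\<close>
  define c where "c = e / 3 / (2 * M * A + 1)"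
  have D: "0 < 2 * M * A + 1" using M A(1) by (simp add: add_nonneg_pos)
  have c: "0 < c" "2 * M * A * c \<le> e / 3"
  proof -
    show "0 < c" using \<open>0 < e\<close> D by (simp add: c_def)
    have "c * (2 * M * A + 1) = e / 3" using D unfolding c_def by (intro nonzero_eq_divide_eq[THEN iffD1]) auto
    then show "2 * M * A * c \<le> e / 3" using \<open>0 < c\<close> by (simp add: algebra_simps)
  qed
  \<comment> \<open>\<open>\<alpha>\<close> vanishes beyond \<open>q\<close>; the maximum with
    \<open>c\<close> guarantees the nonempty interval that the trace hypotheses ask for.\<close>
  define d where "d = max c q"
  define e' where "e' = e / 3 / (A + 1)"
  have e': "0 < e'" "A * e' < e / 3" 
  proof -
    show "0 < e'" using \<open>0 < e\<close> A(1) by (simp add: e'_def)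
    have "e' * (A + 1) = e / 3" using A(1) unfolding e'_def by (intro nonzero_eq_divide_eq[THEN iffD1]) auto
    then show "A * e' < e / 3" using \<open>0 < e'\<close> by (simp add: algebra_simps)
  qed
  have cd: "c \<le> d" "q \<le> d" by (auto simp: d_def)
  have ev: "eventually (\<lambda>x. L1_dist {c..d} (\<lambda>t. Q f (u1 (t, x)) m) (\<lambda>t. Q f (\<sigma>1 t) m) < ennreal e'
      \<and> L1_dist {c..d} (\<lambda>t. Q f (u2 (t, x)) m) (\<lambda>t. Q f (\<sigma>2 t) m) < ennreal e') (ess_at0 {0<..})"
    using order_tendstoD(2)[OF tr1[OF c(1) cd(1)], of "ennreal e'"]
      order_tendstoD(2)[OF tr2[OF c(1) cd(1)], of "ennreal e'"] e'(1)
    by (intro eventually_conj) auto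
  have small: "integrable lborel (\<lambda>t. indicator {c..d} t * \<bar>Q f (u t) m - Q f (\<sigma> t) m\<bar>)
     \<and> (LBINT t. indicator {c..d} t * \<bar>Q f (u t) m - Q f (\<sigma> t) m\<bar>) < e'"
    if "L1_dist {c..d} (\<lambda>t. Q f (u t) m) (\<lambda>t. Q f (\<sigma> t) m) < ennreal e'"
      and [measurable]: "u \<in> borel_measurable borel" "\<sigma> \<in> borel_measurable borel"
      and r: "\<And>t. u t \<in> {a..b}" "\<And>t. \<sigma> t \<in> {a..b}" for u \<sigma>
  proof
    show i: "integrable lborel (\<lambda>t. indicator {c..d} t * \<bar>Q f (u t) m - Q f (\<sigma> t) m\<bar>)"
    proof (rule integrable_bounded_support[where S="{c..d}" and C="2 * L * (b - a)"])
      fix t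
      have "2 * L * \<bar>u t - \<sigma> t\<bar> \<le> 2 * L * (b - a)" using r[of t] L by (intro mult_left_mono) auto
      then have "\<bar>Q f (u t) m - Q f (\<sigma> t) m\<bar> \<le> 2 * L * (b - a)"
        using Q_lipschitz[OF lip, of "u t" m "\<sigma> t" m] by simp
      then show "\<bar>indicator {c..d} t * \<bar>Q f (u t) m - Q f (\<sigma> t) m\<bar>\<bar> \<le> 2 * L * (b - a)"
        using L ab by (auto simp: indicator_def)
    qed auto
    have "ennreal (LBINT t. indicator {c..d} t * \<bar>Q f (u t) m - Q f (\<sigma> t) m\<bar>)
       = (\<integral>\<^sup>+t. ennreal (indicator {c..d} t * \<bar>Q f (u t) m - Q f (\<sigma> t) m\<bar>) \<partial>lborel)"
      by (rule nn_integral_eq_integral[symmetric, OF i]) auto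
    also have "\<dots> = L1_dist {c..d} (\<lambda>t. Q f (u t) m) (\<lambda>t. Q f (\<sigma> t) m)"
      unfolding L1_dist_def by (intro nn_integral_cong) (auto simp: indicator_def)
    finally have "ennreal (LBINT t. indicator {c..d} t * \<bar>Q f (u t) m - Q f (\<sigma> t) m\<bar>) < ennreal e'"
      using that(1) by simp
    moreover have "0 \<le> (LBINT t. indicator {c..d} t * \<bar>Q f (u t) m - Q f (\<sigma> t) m\<bar>)"
      by (rule Bochner_Integration.integral_nonneg) simp
    ultimately show "(LBINT t. indicator {c..d} t * \<bar>Q f (u t) m - Q f (\<sigma> t) m\<bar>) < e'"
      by (simp add: ennreal_less_iff)
  qed
  have iq: "integrable lborel (\<lambda>t. indicator {0<..} t * (Q f (u t) (v t) * \<alpha> t))"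
    if [measurable]: "u \<in> borel_measurable borel" "v \<in> borel_measurable borel"
      and r: "\<And>t. u t \<in> {a..b}" "\<And>t. v t \<in> {a..b}" for u v
  proof (rule integrable_bounded_support[where S="{p..q}" and C="M * A"])
    fix t
    have "\<bar>Q f (u t) (v t)\<bar> * \<bar>\<alpha> t\<bar> \<le> M * A" using Qb[OF r(1) r(2)] A M by (intro mult_mono) auto
    then show "\<bar>indicator {0<..} t * (Q f (u t) (v t) * \<alpha> t)\<bar> \<le> M * A"
      using M A by (simp add: abs_mult indicator_def)
  qed (use pq in auto)
  from ev show "eventually (\<lambda>x. dist (LBINT t. indicator {0<..} t * (Q f (u1 (t, x)) (u2 (t, x)) * \<alpha> t))
      (LBINT t. indicator {0<..} t * (Q f (\<sigma>1 t) (\<sigma>2 t) * \<alpha> t)) < e) (ess_at0 {0<..})"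
  proof eventually_elim
    case (elim x)
    define h1 where "h1 t = indicator {c..d} t * \<bar>Q f (u1 (t, x)) m - Q f (\<sigma>1 t) m\<bar>" for t
    define h2 where "h2 t = indicator {c..d} t * \<bar>Q f (u2 (t, x)) m - Q f (\<sigma>2 t) m\<bar>" for t
    have h1: "integrable lborel h1" "(LBINT t. h1 t) < e'"
      using small[of "\<lambda>t. u1 (t, x)" \<sigma>1] elim rng unfolding h1_def[abs_def] by auto
    have h2: "integrable lborel h2" "(LBINT t. h2 t) < e'"
      using small[of "\<lambda>t. u2 (t, x)" \<sigma>2] elim rng unfolding h2_def[abs_def] by auto
    have i1: "integrable lborel (\<lambda>t. indicator {0<..} t * (Q f (u1 (t, x)) (u2 (t, x)) * \<alpha> t))"
      by (rule iq) (use rng in auto)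
    have i2: "integrable lborel (\<lambda>t. indicator {0<..} t * (Q f (\<sigma>1 t) (\<sigma>2 t) * \<alpha> t))"
      by (rule iq) (use rng in auto)
    have i3: "integrable lborel (\<lambda>t. 2 * M * A * indicator {0..c} t :: real)"
      by (intro integrable_mult_right integrable_real_indicator) (auto simp: emeasure_lborel_Icc_eq)
    have "\<bar>(LBINT t. indicator {0<..} t * (Q f (u1 (t, x)) (u2 (t, x)) * \<alpha> t))
        - (LBINT t. indicator {0<..} t * (Q f (\<sigma>1 t) (\<sigma>2 t) * \<alpha> t))\<bar>
      = \<bar>LBINT t. indicator {0<..} t * (Q f (u1 (t, x)) (u2 (t, x)) * \<alpha> t) - indicator {0<..} t * (Q f (\<sigma>1 t) (\<sigma>2 t) * \<alpha> t)\<bar>"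
      using i1 i2 by simp
    also have "\<dots> \<le> (LBINT t. \<bar>indicator {0<..} t * (Q f (u1 (t, x)) (u2 (t, x)) * \<alpha> t) - indicator {0<..} t * (Q f (\<sigma>1 t) (\<sigma>2 t) * \<alpha> t)\<bar>)"
      by (rule integral_abs_bound)
    also have "\<dots> \<le> (LBINT t. 2 * M * A * indicator {0..c} t + A * (h1 t + h2 t))"
    proof (rule integral_mono)
      show "integrable lborel (\<lambda>t. \<bar>indicator {0<..} t * (Q f (u1 (t, x)) (u2 (t, x)) * \<alpha> t) - indicator {0<..} t * (Q f (\<sigma>1 t) (\<sigma>2 t) * \<alpha> t)\<bar>)"
        using i1 i2 by simp
      show "integrable lborel (\<lambda>t. 2 * M * A * indicator {0..c} t + A * (h1 t + h2 t))"
        using i3 h1(1) h2(1) by simp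
      fix t :: real
      let ?D = "Q f (u1 (t, x)) (u2 (t, x)) - Q f (\<sigma>1 t) (\<sigma>2 t)"
      have eq: "\<bar>indicator {0<..} t * (Q f (u1 (t, x)) (u2 (t, x)) * \<alpha> t) - indicator {0<..} t * (Q f (\<sigma>1 t) (\<sigma>2 t) * \<alpha> t)\<bar>
          = indicator {0<..} t * (\<bar>?D\<bar> * \<bar>\<alpha> t\<bar>)"
        by (simp add: abs_mult indicator_def flip: left_diff_distrib)
      have h0: "0 \<le> A * (h1 t + h2 t)" using A(1) by (simp add: h1_def h2_def)
      have At: "\<bar>\<alpha> t\<bar> \<le> A" using A(2) by blast
      consider "t \<le> 0" | "0 < t" "t < c" | "c \<le> t" "t \<le> d" | "d < t" "0 < t" using c(1) cd by linarith
      then show "\<bar>indicator {0<..} t * (Q f (u1 (t, x)) (u2 (t, x)) * \<alpha> t) - indicator {0<..} t * (Q f (\<sigma>1 t) (\<sigma>2 t) * \<alpha> t)\<bar>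
          \<le> 2 * M * A * indicator {0..c} t + A * (h1 t + h2 t)"
        unfolding eq
      proof cases
        case 1
        then show "indicator {0<..} t * (\<bar>?D\<bar> * \<bar>\<alpha> t\<bar>) \<le> 2 * M * A * indicator {0..c} t + A * (h1 t + h2 t)"
          using h0 M A(1) by (simp add: indicator_def)
      next
        case 2
        have "\<bar>?D\<bar> \<le> 2 * M"
          using Qb[OF rng(1) rng(2), of "(t, x)" "(t, x)"] Qb[OF rng(3) rng(4), of t t] by linarith
        then have "\<bar>?D\<bar> * \<bar>\<alpha> t\<bar> \<le> 2 * M * A" using At M by (intro mult_mono) auto
        then show "indicator {0<..} t * (\<bar>?D\<bar> * \<bar>\<alpha> t\<bar>) \<le> 2 * M * A * indicator {0..c} t + A * (h1 t + h2 t)"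
          using 2 h0 by simp
      next
        case 3
        have "\<bar>Q f (u1 (t, x)) (u2 (t, x)) - Q f (\<sigma>1 t) (u2 (t, x))\<bar> \<le> \<bar>Q f (u1 (t, x)) m - Q f (\<sigma>1 t) m\<bar>"
          by (rule uni[OF rng(1) rng(3) rng(2)])
        moreover have "\<bar>Q f (u2 (t, x)) (\<sigma>1 t) - Q f (\<sigma>2 t) (\<sigma>1 t)\<bar> \<le> \<bar>Q f (u2 (t, x)) m - Q f (\<sigma>2 t) m\<bar>"
          by (rule uni[OF rng(2) rng(4) rng(3)])
        ultimately have "\<bar>?D\<bar> \<le> h1 t + h2 t"
          using 3 by (simp add: h1_def h2_def Q_commute[of f _ "\<sigma>1 t"])
        then have le: "\<bar>?D\<bar> * \<bar>\<alpha> t\<bar> \<le> (h1 t + h2 t) * A" using At by (intro mult_mono) auto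
        have one: "indicator {0<..} t = (1 :: real)" using 3 c(1) by simp
        have "0 \<le> 2 * M * A * (indicator {0..c} t :: real)" using M A(1) by simp
        then show "indicator {0<..} t * (\<bar>?D\<bar> * \<bar>\<alpha> t\<bar>) \<le> 2 * M * A * indicator {0..c} t + A * (h1 t + h2 t)"
          unfolding one mult_1_left using le by (simp only: mult.commute[of A])
      next
        case 4
        then have "\<alpha> t = 0" using pq cd(2) by auto
        then show "indicator {0<..} t * (\<bar>?D\<bar> * \<bar>\<alpha> t\<bar>) \<le> 2 * M * A * indicator {0..c} t + A * (h1 t + h2 t)"
          using h0 M A(1) by simp
      qed
    qed
    also have "\<dots> = 2 * M * A * c + A * ((LBINT t. h1 t) + (LBINT t. h2 t))"
      using i3 h1(1) h2(1) c(1) by simp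
    also have "\<dots> \<le> e / 3 + A * (e' + e')"
      using c(2) h1(2) h2(2) A(1) by (intro add_mono mult_left_mono) auto
    also have "\<dots> < e" using e'(2) by (simp add: distrib_left)
    finally show ?case by (simp add: dist_real_def)
  qed
qed

section \<open>Contraction on one road\<close>

text \<open>\<open>halfline_limit\<close> applied to the Kato inequality. Its test functions are
  supported in the open half-line, so the layer is placed inside the road,
  \<open>c = -1\<close>.\<close>

lemma road_contraction:
  assumes kp: "kruzhkov_pair f L B u1 u2 v1 v2" and L': "L \<le> L'" and \<mu>: "0 < \<mu>" and \<alpha>: "test_fun UNIV \<alpha>"
    and tr: "((\<lambda>x. LBINT t. indicator {0<..} t * (Q f (u1 (t, x)) (u2 (t, x)) * \<alpha> t)) \<longlongrightarrow> l) (ess_at0 {0<..})"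
  shows "0 \<le> (LBINT z. indicator {0<..} (fst z) * (\<bar>u1 z - u2 z\<bar> * ((deriv \<alpha> (fst z) + L' * \<mu> * \<alpha> (fst z)) * weight \<mu> (-1) (snd z))))
           + l + \<alpha> 0 * (LBINT x. \<bar>v1 x - v2 x\<bar> * weight \<mu> (-1) x)"
    and "integrable lborel (\<lambda>z. indicator {0<..} (fst z) * (\<bar>u1 z - u2 z\<bar> * ((deriv \<alpha> (fst z) + L' * \<mu> * \<alpha> (fst z)) * weight \<mu> (-1) (snd z))))"
    and "integrable lborel (\<lambda>x. \<bar>v1 x - v2 x\<bar> * weight \<mu> (-1) x)"
proof -
  interpret kruzhkov_pair f L B u1 u2 v1 v2 by (rule kp)
  note [measurable] = test_funD(6,7)[OF \<alpha>]
  obtain c d where cd: "\<forall>x. x \<notin> {c..d} \<longrightarrow> \<alpha> x = 0 \<and> deriv \<alpha> x = 0"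
    using test_fun_support[OF \<alpha>] by blast
  obtain A where A: "0 \<le> A" "\<forall>x. \<bar>\<alpha> x\<bar> \<le> A \<and> \<bar>deriv \<alpha> x\<bar> \<le> A" using test_fun_bounded[OF \<alpha>] by blast
  have i\<alpha>: "integrable lborel \<alpha>"
    by (rule integrable_bounded_support[where S="{c..d}" and C=A]) (use A cd in auto)
  define H where "H z = Q f (u1 z) (u2 z)" for z
  have [measurable]: "H \<in> borel_measurable borel" unfolding H_def[abs_def] by measurable
  have Hb: "\<bar>H z\<bar> \<le> L * (2 * B)" for z unfolding H_def by (rule Q_bound[OF bd(1,2)])
  have LB: "0 \<le> L * (2 * B)" using L_nonneg B_nonneg by simp
  have HE: "\<bar>H z\<bar> \<le> L' * \<bar>u1 z - u2 z\<bar>" for z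
    using Q_le[OF lip, of "u1 z" "u2 z"] mult_right_mono[OF L' abs_ge_zero[of "u1 z - u2 z"]] by (simp add: H_def)
  \<comment> \<open>The time integral is done first: for a fixed time the flux of the pair may have
    no limit at 0, but its time averages against \<open>\<alpha>\<close> do.\<close>
  define g where "g x = (LBINT t. indicator {0<..} t * (H (t, x) * \<alpha> t))" for x
  have g_meas: "g \<in> borel_measurable borel" unfolding g_def[abs_def] by measurable
  have gb: "\<bar>g x\<bar> \<le> L * (2 * B) * (LBINT t. \<bar>\<alpha> t\<bar>)" for x
  proof -
    have "\<bar>g x\<bar> \<le> (LBINT t. \<bar>indicator {0<..} t * (H (t, x) * \<alpha> t)\<bar>)"
      unfolding g_def by (rule integral_abs_bound)
    also have "\<dots> \<le> (LBINT t. L * (2 * B) * \<bar>\<alpha> t\<bar>)"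
    proof (rule Bochner_Integration.integral_mono')
      show "integrable lborel (\<lambda>t. L * (2 * B) * \<bar>\<alpha> t\<bar>)" using i\<alpha> by simp
      fix t
      show "0 \<le> L * (2 * B) * \<bar>\<alpha> t\<bar>" using LB by simp
      show "\<bar>indicator {0<..} t * (H (t, x) * \<alpha> t)\<bar> \<le> L * (2 * B) * \<bar>\<alpha> t\<bar>"
        using mult_right_mono[OF Hb[of "(t, x)"] abs_ge_zero[of "\<alpha> t"]] LB by (simp add: abs_mult indicator_def)
    qed
    finally show ?thesis by simp
  qed
  have "(g \<longlongrightarrow> l) (ess_at0 (side (-1)))" using tr by (simp add: g_def[abs_def] H_def side_def)
  then have lg: "(\<lambda>j. LBINT x. layer \<mu> (-1) j x * g x) \<longlonglongrightarrow> l"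
    by (intro layer_limit[OF \<mu> _ g_meas gb]) auto
  have eq: "(LBINT z. indicator {0<..} (fst z) * (H z * (\<alpha> (fst z) * layer \<mu> (-1) j (snd z))))
      = (LBINT x. layer \<mu> (-1) j x * g x)" if j: "2 \<le> j" for j
  proof -
    have "integrable lborel (\<lambda>z. indicator {0<..} (fst z) * (H z * (\<alpha> (fst z) * layer \<mu> (-1) j (snd z))))"
    proof (rule Bochner_Integration.integrable_bound)
      show "integrable lborel (\<lambda>z. L * (2 * B) * (\<alpha> (fst z) * layer \<mu> (-1) j (snd z)))"
        using integrable_tensor[OF i\<alpha> layer_mass(1)[OF \<mu>, of "-1" j]] j by simp
      show "AE z in lborel. norm (indicator {0<..} (fst z) * (H z * (\<alpha> (fst z) * layer \<mu> (-1) j (snd z))))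
         \<le> norm (L * (2 * B) * (\<alpha> (fst z) * layer \<mu> (-1) j (snd z)))"
      proof (rule AE_I2)
        fix z :: "real \<times> real"
        have "\<bar>H z\<bar> * \<bar>\<alpha> (fst z) * layer \<mu> (-1) j (snd z)\<bar> \<le> L * (2 * B) * \<bar>\<alpha> (fst z) * layer \<mu> (-1) j (snd z)\<bar>"
          by (rule mult_right_mono[OF Hb]) simp
        then show "norm (indicator {0<..} (fst z) * (H z * (\<alpha> (fst z) * layer \<mu> (-1) j (snd z))))
           \<le> norm (L * (2 * B) * (\<alpha> (fst z) * layer \<mu> (-1) j (snd z)))"
          unfolding real_norm_def abs_mult[of "L * (2 * B)"] abs_of_nonneg[OF LB]
          using LB by (simp add: abs_mult[of "H z"] indicator_def)
      qed
    qed measurable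
    from Fubini_lborel(2)[OF this]
    have "(LBINT z. indicator {0<..} (fst z) * (H z * (\<alpha> (fst z) * layer \<mu> (-1) j (snd z))))
      = (LBINT x. (LBINT t. indicator {0<..} t * (H (t, x) * (\<alpha> t * layer \<mu> (-1) j x))))" by simp
    also have "\<dots> = (LBINT x. (LBINT t. layer \<mu> (-1) j x * (indicator {0<..} t * (H (t, x) * \<alpha> t))))"
      by (intro Bochner_Integration.integral_cong refl) (simp add: algebra_simps)
    finally show ?thesis by (simp add: g_def)
  qed
  have "eventually (\<lambda>j. (LBINT x. layer \<mu> (-1) j x * g x)
      = (LBINT z. indicator {0<..} (fst z) * (H z * (\<alpha> (fst z) * layer \<mu> (-1) j (snd z))))) sequentially"
    using eventually_ge_at_top[of 2] by eventually_elim (simp add: eq)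
  from Lim_transform_eventually[OF lg this]
  have lim: "(\<lambda>j. LBINT z. indicator {0<..} (fst z) * (H z * (\<alpha> (fst z) * layer \<mu> (-1) j (snd z)))) \<longlonglongrightarrow> l" .
  have L'0: "0 \<le> L'" using L' L_nonneg by simp
  have Eb: "\<bar>\<bar>u1 z - u2 z\<bar>\<bar> \<le> 2 * B" for z using diff_bound[OF bd(1,2), of z z] by simp
  have E0b: "\<bar>\<bar>v1 x - v2 x\<bar>\<bar> \<le> 2 * B" for x using diff_bound[OF bd(3,4), of x x] by simp
  have sub: "{- (-1) / real j..real j + 1} \<subseteq> {0<..}" if "2 \<le> j" for j :: nat
  proof -
    have j: "0 < 1 / real j" using that by simp
    show ?thesis
    proof
      fix x assume "x \<in> {- (-1) / real j..real j + 1}"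
      then have "1 / real j \<le> x" by simp
      with j have "0 < x" by linarith
      then show "x \<in> {0<..}" by simp
    qed
  qed
  have me: "(\<lambda>z. \<bar>u1 z - u2 z\<bar>) \<in> borel_measurable borel" "(\<lambda>x. \<bar>v1 x - v2 x\<bar>) \<in> borel_measurable borel"
    by measurable
  have Hm: "H \<in> borel_measurable borel" by measurable
  note hl = halfline_limit[OF \<mu> _ _ L'0 me(1) Hm me(2) Eb HE E0b kato_inequality[folded H_def] sub \<alpha> lim]
  show "0 \<le> (LBINT z. indicator {0<..} (fst z) * (\<bar>u1 z - u2 z\<bar> * ((deriv \<alpha> (fst z) + L' * \<mu> * \<alpha> (fst z)) * weight \<mu> (-1) (snd z))))
           + l + \<alpha> 0 * (LBINT x. \<bar>v1 x - v2 x\<bar> * weight \<mu> (-1) x)"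
    by (rule hl(1)) auto
  show "integrable lborel (\<lambda>z. indicator {0<..} (fst z) * (\<bar>u1 z - u2 z\<bar> * ((deriv \<alpha> (fst z) + L' * \<mu> * \<alpha> (fst z)) * weight \<mu> (-1) (snd z))))"
    by (rule hl(2)) auto
  show "integrable lborel (\<lambda>x. \<bar>v1 x - v2 x\<bar> * weight \<mu> (-1) x)"
    by (rule hl(3)) auto
qed

text \<open>The test functions \<open>down\<close> with the integrating factor bound all forward
  averages of \<open>N t * exp (- C t)\<close> by \<open>D\<close>. An almost-everywhere bound
  follows by integrating these averages over the set where it fails and letting the averaging width
  tend to 0 in the mean.\<close>

lemma gronwall_weak:
  assumes N[measurable]: "N \<in> borel_measurable borel" and Nb: "\<And>t. \<bar>N t\<bar> \<le> B" and C: "0 \<le> C"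
    and ineq: "\<And>\<alpha>. test_fun UNIV \<alpha> \<Longrightarrow>
      0 \<le> (LBINT t. indicator {0<..} t * (N t * (deriv \<alpha> t + C * \<alpha> t))) + \<alpha> 0 * D"
  shows "AE t in lborel. t > 0 \<longrightarrow> N t \<le> exp (C * t) * D"
proof -
  define n where "n t = indicator {0<..} t * (N t * exp (- (C * t)))" for t
  have n[measurable]: "n \<in> borel_measurable borel" unfolding n_def[abs_def] by measurable
  have nb: "\<bar>n t\<bar> \<le> B" for t
  proof (cases "0 < t")
    case True
    have "\<bar>N t\<bar> * exp (- (C * t)) \<le> B * 1"
      using Nb[of t] True C by (intro mult_mono) auto
    then show ?thesis using True by (simp add: n_def abs_mult)
  next
    case False
    then show ?thesis using Nb[of t] by (simp add: n_def)
  qed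
  \<comment> \<open>\<open>\<tau> >= 0\<close> ensures that the test function equals 1 at time 0, so
    that \<open>D\<close> enters with factor 1.\<close>
  have avg: "(LBINT t. n t * kn e (t - \<tau>)) \<le> D" if "0 \<le> \<tau>" "0 < e" for \<tau> e
  proof -
    have eq: "indicator {0<..} t * (N t * (deriv (\<lambda>t. down \<tau> e t * exp (- (C * t))) t + C * (down \<tau> e t * exp (- (C * t)))))
        = - (n t * kn e (t - \<tau>))" for t
      unfolding exp_weight_test_fun(2)[OF down_test_fun[OF that(2)]]
      using down_deriv[of t \<tau> e] by (cases "0 < t") (simp_all add: n_def)
    have "down \<tau> e 0 = 1"
    proof -
      have "(0 - \<tau>) / e \<le> 0" using that by (simp add: divide_nonpos_pos)
      then show ?thesis using step_1[of 2] step_0[of "(0 - \<tau>) / e"] by (simp add: down_def)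
    qed
    then show ?thesis
      using ineq[OF exp_weight_test_fun(1)[OF down_test_fun[OF that(2), of \<tau>], of C]] by (simp add: eq)
  qed
  have main: "AE t in lborel. 0 \<le> t \<and> t \<le> T \<longrightarrow> n t \<le> D" for T
  proof -
    \<comment> \<open>Indicator of the bad set within \<open>[0, T]\<close>. The averages give
      \<open>\<psi> * n\<close> an integral of at most \<open>D\<close> times that of
      \<open>\<psi>\<close>, although \<open>n > D\<close> on the bad set, which is therefore
      null.\<close>
    define \<psi> where "\<psi> t = (if 0 \<le> t \<and> t \<le> T \<and> D < n t then 1 else 0 :: real)" for t
    have [measurable]: "\<psi> \<in> borel_measurable borel" unfolding \<psi>_def[abs_def] by measurable
    have \<psi>01: "0 \<le> \<psi> t" "\<psi> t \<le> 1" for t by (auto simp: \<psi>_def)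
    have i\<psi>: "integrable lborel \<psi>"
      by (rule integrable_bounded_support[where S="{0..T}" and C=1]) (auto simp: \<psi>_def)
    have i\<psi>n: "integrable lborel (\<lambda>t. \<psi> t * n t)"
    proof (rule integrable_bounded_support[where S="{0..T}" and C=B])
      show "\<bar>\<psi> t * n t\<bar> \<le> B" for t using nb[of t] by (auto simp: \<psi>_def)
    qed (auto simp: \<psi>_def)
    have "(LBINT t. \<psi> t * n t) \<le> D * (LBINT t. \<psi> t) + e" if "0 < e" for e
    proof -
      define F where "F p = \<psi> (fst p) * n (snd p)" for p
      have [measurable]: "F \<in> borel_measurable borel" unfolding F_def[abs_def] by measurable
      have "\<exists>\<delta>>0. \<forall>K. approx_id \<delta> K \<longrightarrow> \<bar>(LBINT p. F p * K (snd p - fst p)) - (LBINT z. F (z, z))\<bar> \<le> e"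
      proof (rule approx_id_limit[where v=n and B=B and M=B and S="{0..T}" and C=1])
        show "\<bar>F p\<bar> \<le> B" for p using nb[of "snd p"] by (auto simp: F_def \<psi>_def)
        show "\<bar>F (z, w) - F (z, z)\<bar> \<le> 1 * \<bar>n w - n z\<bar>" for z w by (auto simp: F_def \<psi>_def)
        show "F (z, w) = 0" if "z \<notin> {0..T}" for z w using that by (auto simp: F_def \<psi>_def)
      qed (use nb \<open>0 < e\<close> n in auto)
      then obtain \<delta> where \<delta>: "0 < \<delta>" "\<And>K. approx_id \<delta> K \<Longrightarrow>
        \<bar>(LBINT p. F p * K (snd p - fst p)) - (LBINT z. F (z, z))\<bar> \<le> e" by blast
      have close: "\<bar>(LBINT p. F p * kn \<delta> (snd p - fst p)) - (LBINT z. F (z, z))\<bar> \<le> e"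
        by (rule \<delta>(2)[OF approx_id_kn[OF \<delta>(1) order_refl]])
      obtain K where K: "\<And>h. kn \<delta> h \<le> K"
        using approx_id_kn[OF \<delta>(1) order_refl] unfolding approx_id_def by blast
      have iF: "integrable lborel (\<lambda>p. F p * kn \<delta> (snd p - fst p))"
      proof (rule integrable_bounded_support[where S="{0..T} \<times> {0..T + \<delta>}" and C="B * K"])
        show "bounded ({0..T} \<times> {0..T + \<delta>})" by (intro bounded_Times) auto
        fix p :: "real \<times> real"
        have "\<bar>F p\<bar> \<le> B" using nb[of "snd p"] by (auto simp: F_def \<psi>_def)
        then show "\<bar>F p * kn \<delta> (snd p - fst p)\<bar> \<le> B * K"
          unfolding abs_mult using K[of "snd p - fst p"] kn_nonneg[OF \<delta>(1), of "snd p - fst p"]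
          by (intro mult_mono) auto
        assume "p \<notin> {0..T} \<times> {0..T + \<delta>}"
        then have "fst p \<notin> {0..T} \<or> snd p - fst p \<le> 0 \<or> \<delta> \<le> snd p - fst p" by (cases p) auto
        then show "F p * kn \<delta> (snd p - fst p) = 0"
          using kn_eq_0[OF \<delta>(1), of "snd p - fst p"] by (auto simp: F_def \<psi>_def)
      qed measurable
      have "(LBINT p. F p * kn \<delta> (snd p - fst p)) = (LBINT \<tau>. \<psi> \<tau> * (LBINT t. n t * kn \<delta> (t - \<tau>)))"
        using Fubini_lborel(1)[OF iF] by (simp add: F_def mult.assoc)
      also have "\<dots> \<le> (LBINT \<tau>. D * \<psi> \<tau>)"
      proof (rule integral_mono)
        show "integrable lborel (\<lambda>\<tau>. \<psi> \<tau> * (LBINT t. n t * kn \<delta> (t - \<tau>)))"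
          using Fubini_lborel(3)[OF iF] by (simp add: F_def mult.assoc)
        show "integrable lborel (\<lambda>\<tau>. D * \<psi> \<tau>)" using i\<psi> by simp
        show "\<psi> \<tau> * (LBINT t. n t * kn \<delta> (t - \<tau>)) \<le> D * \<psi> \<tau>" for \<tau>
          using avg[OF _ \<delta>(1), of \<tau>] by (auto simp: \<psi>_def)
      qed
      finally show ?thesis using close by (simp add: F_def)
    qed
    then have "(LBINT t. \<psi> t * n t) \<le> D * (LBINT t. \<psi> t)" by (rule field_le_epsilon)
    then have le: "(LBINT t. \<psi> t * n t - D * \<psi> t) \<le> 0" using i\<psi> i\<psi>n by simp
    have nn: "0 \<le> \<psi> t * n t - D * \<psi> t" for t by (auto simp: \<psi>_def)
    have "(LBINT t. \<psi> t * n t - D * \<psi> t) = 0"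
      using le Bochner_Integration.integral_nonneg[of lborel "\<lambda>t. \<psi> t * n t - D * \<psi> t", OF nn] by simp
    then have "AE t in lborel. \<psi> t * n t - D * \<psi> t = 0"
      using i\<psi> i\<psi>n nn by (subst (asm) integral_nonneg_eq_0_iff_AE) auto
    then show ?thesis by eventually_elim (auto simp: \<psi>_def split: if_splits)
  qed
  \<comment> \<open>Integer horizons suffice and keep the union of exceptional sets
    countable.\<close>
  have "AE t in lborel. \<forall>T::nat. 0 \<le> t \<and> t \<le> real T \<longrightarrow> n t \<le> D"
    unfolding AE_all_countable using main by blast
  then show ?thesis
  proof eventually_elim
    case (elim t)
    show ?case
    proof
      assume t: "0 < t"
      obtain T :: nat where "t \<le> real T" using real_arch_simple by blast
      then have "n t \<le> D" using elim[rule_format, of T] t by simp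
      then have "N t * exp (- (C * t)) \<le> D" using t by (simp add: n_def)
      then have "N t * exp (- (C * t)) * exp (C * t) \<le> D * exp (C * t)" by (rule mult_right_mono) simp
      moreover have "exp (- (C * t)) * exp (C * t) = 1" by (simp flip: exp_add)
      ultimately show "N t \<le> exp (C * t) * D" by (simp add: mult.assoc mult.commute[of D])
    qed
  qed
qed

section \<open>Reflection of roads\<close>

lemma AE_reflect:
  assumes "s = 1 \<or> s = (-1 :: real)" and "AE z in lborel. P (z :: real \<times> real)"
  shows "AE z in lborel. P (fst z, s * snd z)"
proof -
  have "AE z in distr lborel borel (\<lambda>z :: real \<times> real. (fst z, s * snd z)). P z"
    unfolding distr_reflect_snd[OF assms(1)] by (rule assms(2))
  from AE_distrD[OF _ this] show ?thesis by simp
qed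

lemma distr_reflect:
  assumes "s = 1 \<or> s = (-1 :: real)"
  shows "distr lborel borel ((*) s) = lborel"
  using assms by (auto simp: distr_id2 lborel_distr_mult density_1 one_ennreal_def[symmetric])

lemma AE_reflect1:
  assumes "s = 1 \<or> s = (-1 :: real)" and "AE x in lborel. P x"
  shows "AE x in lborel. P (s * x)"
proof -
  have "AE x in distr lborel borel ((*) s). P x"
    unfolding distr_reflect[OF assms(1)] by (rule assms(2))
  from AE_distrD[OF _ this] show ?thesis by simp
qed

lemma integral_reflect:
  assumes "s = 1 \<or> s = (-1 :: real)" and [measurable]: "P \<in> borel_measurable borel"
  shows "(LBINT z. P (fst z, s * snd z)) = (\<integral>z. (P z :: real) \<partial>(lborel :: (real \<times> real) measure))"
proof -
  have "(LBINT z. P z) = (\<integral>z. P z \<partial>(distr lborel borel (\<lambda>z :: real \<times> real. (fst z, s * snd z))))"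
    unfolding distr_reflect_snd[OF assms(1)] ..
  also have "\<dots> = (LBINT z. P (fst z, s * snd z))" by (rule integral_distr) auto
  finally show ?thesis ..
qed

text \<open>\<open>P\<close> may define a nonmeasurable set, so the sections are taken of a
  measurable null set that contains its complement; exchanging the quantifiers requires
  measurability.\<close>

lemma AE_sections:
  assumes "AE z in (lborel :: (real \<times> real) measure). P z"
  shows "AE t in lborel. AE x in lborel. P (t, x)" "AE x in lborel. AE t in lborel. P (t, x)"
proof -
  obtain N where N: "{z \<in> space lborel. \<not> P z} \<subseteq> N" "emeasure lborel N = 0" "N \<in> sets lborel"
    using assms by (rule AE_E)
  have PN: "P z" if "z \<notin> N" for z using N(1) that by auto
  have "AE z in lborel \<Otimes>\<^sub>M lborel. z \<notin> N"
    unfolding lborel_prod using N(2,3) by (intro AE_not_in null_setsI)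
  then have "AE t in lborel. AE x in lborel. (t, x) \<notin> N" by (rule lborel_pair.AE_pair)
  moreover have "{z \<in> space (lborel \<Otimes>\<^sub>M lborel). (fst z, snd z) \<notin> N} \<in> sets (lborel \<Otimes>\<^sub>M lborel)"
  proof -
    have "{z \<in> space (lborel \<Otimes>\<^sub>M lborel). (fst z, snd z) \<notin> N} = - N" by (auto simp: space_pair_measure)
    then show ?thesis using N(3) unfolding lborel_prod by auto
  qed
  ultimately have 1: "AE t in lborel. AE x in lborel. (t, x) \<notin> N" and 2: "AE x in lborel. AE t in lborel. (t, x) \<notin> N"
    using lborel_pair.AE_commute[of "\<lambda>t x. (t, x) \<notin> N"] by blast+
  show "AE t in lborel. AE x in lborel. P (t, x)"
    using 1 by eventually_elim (auto elim: eventually_mono intro: PN)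
  show "AE x in lborel. AE t in lborel. P (t, x)"
    using 2 by eventually_elim (auto elim: eventually_mono intro: PN)
qed

lemma filterlim_reflect:
  assumes s: "s = 1 \<or> s = (-1 :: real)"
  shows "filterlim ((*) s) (ess_at0 R) (ess_at0 {x. s * x \<in> R})"
  unfolding filterlim_iff
proof (intro allI impI)
  fix P assume "eventually P (ess_at0 R)"
  then obtain d where d: "d > 0" "AE x in lborel. x \<in> R \<longrightarrow> x \<noteq> 0 \<longrightarrow> \<bar>x\<bar> < d \<longrightarrow> P x"
    unfolding eventually_ess_at0 by blast
  have "\<bar>s * x\<bar> = \<bar>x\<bar>" "s * x \<noteq> 0 \<longleftrightarrow> x \<noteq> 0" for x using s by auto
  then have "AE x in lborel. x \<in> {x. s * x \<in> R} \<longrightarrow> x \<noteq> 0 \<longrightarrow> \<bar>x\<bar> < d \<longrightarrow> P (s * x)"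
    using AE_reflect1[OF s d(2)] by simp
  then show "eventually (\<lambda>x. P (s * x)) (ess_at0 {x. s * x \<in> R})"
    unfolding eventually_ess_at0 using d(1) by blast
qed

lemma tendsto_ess_cong:
  assumes "(g \<longlongrightarrow> l) (ess_at0 R)" and "AE x in lborel. x \<in> R \<longrightarrow> g x = g' x"
  shows "(g' \<longlongrightarrow> l) (ess_at0 R)"
proof (rule Lim_transform_eventually[OF assms(1)])
  show "eventually (\<lambda>x. g x = g' x) (ess_at0 R)"
    unfolding eventually_ess_at0 using assms(2) by (intro exI[of _ 1]) (auto elim: eventually_mono)
qed

text \<open>A representative on the whole plane of the density on the reflected road. Values off the
  road, at nonpositive times or outside \<open>[a, b]\<close> are replaced by \<open>a\<close>, so
  that range and measurability hold everywhere.\<close>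

definition reflected :: "real \<Rightarrow> real \<Rightarrow> real \<Rightarrow> real set \<Rightarrow> (real \<Rightarrow> real \<Rightarrow> real) \<Rightarrow> real \<times> real \<Rightarrow> real" where
  "reflected a b s \<Omega> \<rho> z =
     (if fst z > 0 \<and> s * snd z \<in> \<Omega> \<and> \<rho> (fst z) (s * snd z) \<in> {a..b} then \<rho> (fst z) (s * snd z) else a)"

definition reflected0 :: "real \<Rightarrow> real \<Rightarrow> real \<Rightarrow> real set \<Rightarrow> (real \<Rightarrow> real) \<Rightarrow> real \<Rightarrow> real" where
  "reflected0 a b s \<Omega> v x = (if s * x \<in> \<Omega> \<and> v (s * x) \<in> {a..b} then v (s * x) else a)"

lemma reflected_range: "a \<le> b \<Longrightarrow> reflected a b s \<Omega> \<rho> z \<in> {a..b}"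
  and reflected0_range: "a \<le> b \<Longrightarrow> reflected0 a b s \<Omega> v x \<in> {a..b}"
  by (auto simp: reflected_def reflected0_def)

lemma reflected_borel:
  assumes "set_borel_measurable lborel ({0<..} \<times> \<Omega>) (\<lambda>(t, x). \<rho> t x)" and [measurable]: "\<Omega> \<in> sets borel"
  shows "reflected a b s \<Omega> \<rho> \<in> borel_measurable borel"
proof -
  define r where "r z = indicator ({0<..} \<times> \<Omega>) z * \<rho> (fst z) (snd z)" for z
  have [measurable]: "r \<in> borel_measurable borel"
    using assms(1) by (simp add: set_borel_measurable_def r_def[abs_def] case_prod_beta)
  have "reflected a b s \<Omega> \<rho> = (\<lambda>z. if fst z > 0 \<and> s * snd z \<in> \<Omega> \<and> r (fst z, s * snd z) \<in> {a..b}
      then r (fst z, s * snd z) else a)"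
    by (rule ext) (auto simp: reflected_def r_def indicator_times)
  then show ?thesis by simp
qed

lemma reflected0_borel:
  assumes "set_borel_measurable lborel \<Omega> v" and [measurable]: "\<Omega> \<in> sets borel"
  shows "reflected0 a b s \<Omega> v \<in> borel_measurable borel"
proof -
  define r where "r x = indicator \<Omega> x * v x" for x
  have [measurable]: "r \<in> borel_measurable borel"
    using assms(1) by (simp add: set_borel_measurable_def r_def[abs_def])
  have "reflected0 a b s \<Omega> v = (\<lambda>x. if s * x \<in> \<Omega> \<and> r (s * x) \<in> {a..b} then r (s * x) else a)"
    by (rule ext) (auto simp: reflected0_def r_def)
  then show ?thesis by simp
qed

lemma reflected_AE:
  assumes s: "s = 1 \<or> s = (-1 :: real)" and sol: "entropy_solution {a..b} f \<Omega> \<rho>0 \<rho>"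
  shows "AE z in lborel. fst z > 0 \<and> s * snd z \<in> \<Omega> \<longrightarrow> \<rho> (fst z) (s * snd z) = reflected a b s \<Omega> \<rho> z"
proof -
  have "AE z in lborel. fst z > 0 \<and> snd z \<in> \<Omega> \<longrightarrow> \<rho> (fst z) (snd z) \<in> {a..b}"
    using sol unfolding entropy_solution_def by (simp add: case_prod_beta)
  from AE_reflect[OF s this] show ?thesis by eventually_elim (simp add: reflected_def)
qed

lemma reflected0_AE:
  assumes s: "s = 1 \<or> s = (-1 :: real)" and "AE x in lborel. x \<in> \<Omega> \<longrightarrow> v x \<in> {a..b}"
  shows "AE x in lborel. s * x \<in> \<Omega> \<longrightarrow> v (s * x) = reflected0 a b s \<Omega> v x"
  using AE_reflect1[OF s assms(2)] by eventually_elim (simp add: reflected0_def)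

lemma tensor_test_fun:
  assumes s: "s = 1 \<or> s = (-1 :: real)" and \<alpha>: "test_fun UNIV \<alpha>" and \<beta>: "test_fun {x. s * x \<in> \<Omega>} \<beta>"
  shows "smooth_compact_support_in (UNIV \<times> \<Omega>) (\<lambda>z. \<alpha> (fst z) * \<beta> (s * snd z))"
  unfolding smooth_compact_support_in_def
proof (intro conjI allI)
  show "Ck k (\<lambda>z. \<alpha> (fst z) * \<beta> (s * snd z))" for k
    using Ck_tensor[OF test_funD(5)[OF \<alpha>] Ck_affine[OF test_funD(5)[OF \<beta>], where c=s and d=0]] by simp
  obtain p q where pq: "\<forall>x. x \<notin> {p..q} \<longrightarrow> \<alpha> x = 0 \<and> deriv \<alpha> x = 0" using test_fun_support[OF \<alpha>] by blast
  obtain c d where cd: "{c..d} \<subseteq> {x. s * x \<in> \<Omega>}" "\<forall>x. x \<notin> {c..d} \<longrightarrow> \<beta> x = 0 \<and> deriv \<beta> x = 0"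
    using test_fun_support[OF \<beta>] by blast
  define K where "K = {p..q} \<times> ((*) s ` {c..d})"
  have K: "compact K" unfolding K_def by (intro compact_Times compact_continuous_image continuous_intros) auto
  have ss: "s * (s * y) = y" for y using s by auto
  have "{z. \<alpha> (fst z) * \<beta> (s * snd z) \<noteq> 0} \<subseteq> K"
  proof
    fix z assume "z \<in> {z. \<alpha> (fst z) * \<beta> (s * snd z) \<noteq> 0}"
    then have "fst z \<in> {p..q}" "s * snd z \<in> {c..d}" using pq cd(2) by auto
    moreover from this(2) have "s * (s * snd z) \<in> (*) s ` {c..d}" by (rule imageI)
    ultimately show "z \<in> K" by (cases z) (simp add: K_def ss)
  qed
  then have sub: "closure {z. \<alpha> (fst z) * \<beta> (s * snd z) \<noteq> 0} \<subseteq> K"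
    using K by (intro closure_minimal compact_imp_closed)
  have "closure {z. \<alpha> (fst z) * \<beta> (s * snd z) \<noteq> 0} = K \<inter> closure {z. \<alpha> (fst z) * \<beta> (s * snd z) \<noteq> 0}"
    using sub by blast
  also have "compact \<dots>" using K by (intro compact_Int_closed) auto
  finally show "compact (closure {z. \<alpha> (fst z) * \<beta> (s * snd z) \<noteq> 0})" .
  have "K \<subseteq> UNIV \<times> \<Omega>" using cd(1) by (auto simp: K_def)
  with sub show "closure {z. \<alpha> (fst z) * \<beta> (s * snd z) \<noteq> 0} \<subseteq> UNIV \<times> \<Omega>" by blast
qed

text \<open>Under \<open>x \<mapsto> s * x\<close> a space derivative acquires the factor
  \<open>s\<close>, and this factor is moved to the flux. The test function is pulled back
  accordingly as \<open>\<alpha> t * \<beta> (s * x)\<close>, using that \<open>s\<close> is its own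
  inverse.\<close>

lemma reflected_pos_ineq:
  assumes s: "s = 1 \<or> s = (-1 :: real)" and sol: "entropy_solution {a..b} f \<Omega> \<rho>0 \<rho>"
    and \<Omega>[measurable]: "\<Omega> \<in> sets borel" and lip: "L-lipschitz_on UNIV f" and diff: "AE u in lborel. f differentiable (at u)"
    and \<rho>0: "set_borel_measurable lborel \<Omega> \<rho>0" and pq: "0 \<le> p" "0 \<le> q"
    and v[measurable]: "v \<in> borel_measurable borel" and v_eq: "AE x in lborel. s * x \<in> \<Omega> \<longrightarrow> \<rho>0 (s * x) = v x"
  shows "pos_ineq {x. s * x \<in> \<Omega>} (\<lambda>z. kruzhkov p q k (reflected a b s \<Omega> \<rho> z))
     (\<lambda>z. kruzhkov_flux (\<lambda>u. s * f u) p q k (reflected a b s \<Omega> \<rho> z)) (\<lambda>x. kruzhkov p q k (v x))"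
  unfolding pos_ineq_def
proof (intro allI impI)
  fix \<alpha> \<beta> assume \<alpha>: "test_fun UNIV \<alpha>" and \<beta>: "test_fun {x. s * x \<in> \<Omega>} \<beta>"
  note [measurable] = test_funD(6,7)[OF \<alpha>] test_funD(6,7)[OF \<beta>]
  have meas_\<rho>: "set_borel_measurable lborel ({0<..} \<times> \<Omega>) (\<lambda>(t, x). \<rho> t x)"
    using sol by (simp add: entropy_solution_def)
  define u where "u = reflected a b s \<Omega> \<rho>"
  have [measurable]: "u \<in> borel_measurable borel" unfolding u_def by (rule reflected_borel[OF meas_\<rho> \<Omega>])
  define \<eta> where "\<eta> = kruzhkov p q k"
  define G where "G = kruzhkov_flux f p q k"
  have [measurable]: "\<eta> \<in> borel_measurable borel" unfolding \<eta>_def kruzhkov_def[abs_def] by measurable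
  have [measurable]: "G \<in> borel_measurable borel"
    unfolding G_def using kruzhkov_flux_borel[OF lip pq measurable_ident_sets[OF refl]] by simp
  have ss: "s * (s * y) = y" "s * s = 1" "\<bar>s\<bar> = 1" "s \<noteq> 0" for y using s by auto
  have sG: "kruzhkov_flux (\<lambda>u. s * f u) p q k w = s * G w" for w
    by (simp add: kruzhkov_flux_def G_def algebra_simps)
  obtain c d where cd: "{c..d} \<subseteq> {x. s * x \<in> \<Omega>}" "\<forall>x. x \<notin> {c..d} \<longrightarrow> \<beta> x = 0 \<and> deriv \<beta> x = 0"
    using test_fun_support[OF \<beta>] by blast
  have out: "\<beta> x = 0" "deriv \<beta> x = 0" if "s * x \<notin> \<Omega>" for x
    using cd(1) cd(2)[rule_format, of x] that by blast+
  define \<phi> where "\<phi> z = \<alpha> (fst z) * \<beta> (s * snd z)" for z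
  have \<phi>: "smooth_compact_support_in (UNIV \<times> \<Omega>) \<phi>" unfolding \<phi>_def[abs_def] by (rule tensor_test_fun[OF s \<alpha> \<beta>])
  have \<phi>0: "\<forall>z. 0 \<le> \<phi> z" using test_funD(4)[OF \<alpha>] test_funD(4)[OF \<beta>] by (simp add: \<phi>_def)
  have d1: "deriv (\<lambda>s'. \<phi> (s', x)) t = deriv \<alpha> t * \<beta> (s * x)" for t x
    unfolding \<phi>_def fst_conv snd_conv
    by (rule DERIV_imp_deriv) (auto intro!: derivative_eq_intros test_funD(1)[OF \<alpha>])
  have d2: "deriv (\<lambda>y. \<phi> (t, y)) x = \<alpha> t * (s * deriv \<beta> (s * x))" for t x
  proof (rule DERIV_imp_deriv)
    have "((\<lambda>y. \<beta> (s * y)) has_real_derivative deriv \<beta> (s * x) * s) (at x)"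
      by (rule DERIV_chain2[OF test_funD(1)[OF \<beta>]]) (auto intro!: derivative_eq_intros)
    then show "((\<lambda>y. \<phi> (t, y)) has_real_derivative \<alpha> t * (s * deriv \<beta> (s * x))) (at x)"
      unfolding \<phi>_def fst_conv snd_conv by (auto intro!: derivative_eq_intros)
  qed
  define r where "r z = indicator ({0<..} \<times> \<Omega>) z * \<rho> (fst z) (snd z)" for z
  have [measurable]: "r \<in> borel_measurable borel"
    using meas_\<rho> by (simp add: set_borel_measurable_def r_def[abs_def] case_prod_beta)
  define r0 where "r0 x = indicator \<Omega> x * \<rho>0 x" for x
  have [measurable]: "r0 \<in> borel_measurable borel"
    using \<rho>0 by (simp add: set_borel_measurable_def r0_def[abs_def])
  define P where "P z = indicator {0<..} (fst z) * indicator \<Omega> (snd z) *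
     (\<eta> (r z) * (deriv \<alpha> (fst z) * \<beta> (s * snd z)) + G (r z) * (\<alpha> (fst z) * (s * deriv \<beta> (s * snd z))))" for z
  define P0 where "P0 x = indicator \<Omega> x * (\<eta> (r0 x) * (\<alpha> 0 * \<beta> (s * x)))" for x
  have [measurable]: "P \<in> borel_measurable borel" unfolding P_def[abs_def] by measurable
  have [measurable]: "P0 \<in> borel_measurable borel" unfolding P0_def[abs_def] by measurable
  have "0 \<le> set_lebesgue_integral lborel ({0<..} \<times> \<Omega>)
          (\<lambda>(t, x). \<eta> (\<rho> t x) * deriv (\<lambda>s. \<phi> (s, x)) t + G (\<rho> t x) * deriv (\<lambda>y. \<phi> (t, y)) x)
        + set_lebesgue_integral lborel \<Omega> (\<lambda>x. \<eta> (\<rho>0 x) * \<phi> (0, x))"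
    using sol \<phi> \<phi>0 entropy_pair_kruzhkov[OF lip pq diff, of k] unfolding entropy_solution_def \<eta>_def G_def by blast
  also have "set_lebesgue_integral lborel ({0<..} \<times> \<Omega>)
          (\<lambda>(t, x). \<eta> (\<rho> t x) * deriv (\<lambda>s. \<phi> (s, x)) t + G (\<rho> t x) * deriv (\<lambda>y. \<phi> (t, y)) x)
     = (LBINT z. P z)"
    unfolding set_lebesgue_integral_def
    by (intro Bochner_Integration.integral_cong refl) (auto simp: P_def r_def d1 d2 indicator_def)
  also have "\<dots> = (LBINT z. P (fst z, s * snd z))" by (rule integral_reflect[OF s, symmetric]) measurable
  also have "\<dots> = (LBINT z. indicator {0<..} (fst z) * (\<eta> (u z) * (deriv \<alpha> (fst z) * \<beta> (snd z))
      + s * G (u z) * (\<alpha> (fst z) * deriv \<beta> (snd z))))"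
  proof (rule integral_cong_AE)
    show "AE z in lborel. P (fst z, s * snd z) = indicator {0<..} (fst z) * (\<eta> (u z) * (deriv \<alpha> (fst z) * \<beta> (snd z))
      + s * G (u z) * (\<alpha> (fst z) * deriv \<beta> (snd z)))"
      using reflected_AE[OF s sol]
    proof eventually_elim
      case (elim z)
      show ?case
      proof (cases "s * snd z \<in> \<Omega>")
        case True
        show ?thesis
        proof (cases "0 < fst z")
          case t: True
          then have "r (fst z, s * snd z) = u z" using elim True by (simp add: r_def u_def)
          then show ?thesis using t True by (simp add: P_def ss algebra_simps)
        qed (simp add: P_def)
      qed (simp add: P_def out)
    qed
  qed measurable
  also have "set_lebesgue_integral lborel \<Omega> (\<lambda>x. \<eta> (\<rho>0 x) * \<phi> (0, x)) = (LBINT x. P0 x)"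
    unfolding set_lebesgue_integral_def
    by (intro Bochner_Integration.integral_cong refl) (auto simp: P0_def r0_def \<phi>_def indicator_def)
  also have "\<dots> = (LBINT x. P0 (s * x))"
    using lborel_integral_real_affine[of s P0 0] ss by simp
  also have "\<dots> = (LBINT x. \<alpha> 0 * (\<eta> (v x) * \<beta> x))"
  proof (rule integral_cong_AE)
    show "AE x in lborel. P0 (s * x) = \<alpha> 0 * (\<eta> (v x) * \<beta> x)"
      using v_eq
    proof eventually_elim
      case (elim x)
      show ?case
      proof (cases "s * x \<in> \<Omega>")
        case True
        then show ?thesis using elim by (simp add: P0_def r0_def ss algebra_simps)
      qed (simp add: P0_def out)
    qed
  qed measurable
  finally show "0 \<le> (LBINT z. indicator {0<..} (fst z) * (kruzhkov p q k (reflected a b s \<Omega> \<rho> z) * (deriv \<alpha> (fst z) * \<beta> (snd z))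
      + kruzhkov_flux (\<lambda>u. s * f u) p q k (reflected a b s \<Omega> \<rho> z) * (\<alpha> (fst z) * deriv \<beta> (snd z))))
    + \<alpha> 0 * (LBINT x. kruzhkov p q k (v x) * \<beta> x)"
    by (simp only: u_def \<eta>_def sG integral_mult_right_zero)
qed

lemma lipschitz_scale:
  assumes "L-lipschitz_on UNIV f" "s = 1 \<or> s = (-1 :: real)"
  shows "L-lipschitz_on UNIV (\<lambda>u :: real. s * f u)"
  using assms by (auto simp: lipschitz_on_def dist_real_def abs_minus_commute)

section \<open>The junction\<close>

text \<open>For \<open>k\<close> between the trace and the exterior state, one of the two
  semi-entropies vanishes at \<open>\<rho>\<close>; the sign of its flux at \<open>\<sigma>\<close>
  is then exactly one clause of \<open>godunov\<close>. The datum on the road coincides with the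
  trace because the solver is applied at a fixed point.\<close>

lemma godunov_of_riemann_problem:
  assumes s: "s = 1 \<or> s = (-1 :: real)" and R: "{x. s * x \<in> R} = {..<0}" and R_borel: "R \<in> sets borel"
    and sol: "entropy_solution {a..b} f UNIV (\<lambda>x. if x \<in> R then \<sigma> else \<rho>) r" and ab: "a \<le> b"
    and tr: "AE t in lborel. t > 0 \<longrightarrow> (r t \<longlongrightarrow> \<sigma>) (ess_at0 R)"
    and lip: "L-lipschitz_on UNIV f" and diff: "AE u in lborel. f differentiable (at u)"
  shows "godunov (\<lambda>u. s * f u) \<sigma> \<rho>"
proof -
  define u where "u = reflected a b s UNIV r"
  have u[measurable]: "u \<in> borel_measurable borel"
    unfolding u_def using sol by (intro reflected_borel) (auto simp: entropy_solution_def)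
  have rng: "u z \<in> {a..b}" for z unfolding u_def by (rule reflected_range[OF ab])
  have ub: "\<bar>u z\<bar> \<le> max \<bar>a\<bar> \<bar>b\<bar>" for z using rng[of z] unfolding atLeastAtMost_iff by linarith
  have lip': "L-lipschitz_on UNIV (\<lambda>u. s * f u)" by (rule lipschitz_scale[OF lip s])
  define v where "v x = (if x < 0 then \<sigma> else \<rho>)" for x :: real
  have v[measurable]: "v \<in> borel_measurable borel" unfolding v_def[abs_def] by measurable
  have iR: "s * x \<in> R \<longleftrightarrow> x < 0" for x using R by auto
  have v_eq: "AE x in lborel. s * x \<in> UNIV \<longrightarrow> (if s * x \<in> R then \<sigma> else \<rho>) = v x" by (simp add: iR v_def)
  have m0: "set_borel_measurable lborel UNIV (\<lambda>x. if x \<in> R then \<sigma> else \<rho>)"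
    using R_borel by (simp add: set_borel_measurable_def)
  have pos: "pos_ineq UNIV (\<lambda>z. kruzhkov p q k (u z)) (\<lambda>z. kruzhkov_flux (\<lambda>u. s * f u) p q k (u z)) (\<lambda>x. kruzhkov p q k (if x < 0 then \<sigma> else \<rho>))"
    if "0 \<le> p" "0 \<le> q" for p q k
    using reflected_pos_ineq[OF s sol _ lip diff m0 that v v_eq, of k] by (simp add: u_def v_def)
  have "AE t in lborel. AE x in lborel. 0 < t \<longrightarrow> r t (s * x) = u (t, x)"
    using AE_sections(1)[OF reflected_AE[OF s sol]] by (simp add: u_def)
  with tr have tr': "AE t in lborel. t > 0 \<longrightarrow> ((\<lambda>x. u (t, x)) \<longlongrightarrow> \<sigma>) (ess_at0 {..<0})"
  proof eventually_elim
    case (elim t)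
    show ?case
    proof
      assume t: "0 < t"
      have "((\<lambda>x. r t (s * x)) \<longlongrightarrow> \<sigma>) (ess_at0 {..<0})"
        using filterlim_compose[OF elim(1)[rule_format, OF t] filterlim_reflect[OF s, of R]] by (simp add: R)
      then show "((\<lambda>x. u (t, x)) \<longlongrightarrow> \<sigma>) (ess_at0 {..<0})"
        by (rule tendsto_ess_cong) (use elim(2) t in auto)
    qed
  qed
  have key: "0 \<le> kruzhkov_flux (\<lambda>u. s * f u) p q k \<sigma>" if "0 \<le> p" "0 \<le> q" "kruzhkov p q k \<rho> = 0" for p q k
    by (rule boundary_entropy_nonneg[OF lip' u ub that(1,2) pos[OF that(1,2)] that(3) tr'])
  show ?thesis unfolding godunov_def
  proof (intro allI conjI impI)
    fix k assume k: "\<sigma> < k \<and> k \<le> \<rho>"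
    then have "kruzhkov 1 0 k \<rho> = 0" by (simp add: kruzhkov_def)
    then show "s * f \<sigma> \<le> s * f k" using key[of 1 0 k] k by (simp add: kruzhkov_flux_def)
  next
    fix k assume k: "\<rho> \<le> k \<and> k \<le> \<sigma>"
    then have "kruzhkov 0 1 k \<rho> = 0" by (simp add: kruzhkov_def)
    then show "s * f k \<le> s * f \<sigma>" using key[of 0 1 k] k by (simp add: kruzhkov_flux_def)
  qed
qed

text \<open>Every road is reflected onto \<open>(0,\<infinity>)\<close> by \<open>x \<mapsto> orient n h * x\<close>, which turns the flux of an
  incoming road into \<open>- f h\<close>.\<close>

definition orient :: "nat \<Rightarrow> nat \<Rightarrow> real" where
  "orient n h = (if h \<le> n then - 1 else 1)"

lemma orient_cases: "orient n h = 1 \<or> orient n h = -1" "- orient n h = 1 \<or> - orient n h = -1"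
  by (auto simp: orient_def)

lemma orient_road: "{x. orient n h * x \<in> road n h} = {0<..}" "{x. - orient n h * x \<in> road n h} = {..<0}"
  by (auto simp: orient_def road_def)

lemma road_borel [measurable]: "road n h \<in> sets borel"
  by (simp add: road_def)

locale junction =
  fixes n m :: nat and a b :: "nat \<Rightarrow> real" and f \<eta>hat :: "nat \<Rightarrow> real \<Rightarrow> real"
    and \<P> :: "real \<Rightarrow> nat \<Rightarrow> real \<Rightarrow> real"
  assumes ab: "\<And>h. h \<in> {1..n+m} \<Longrightarrow> a h \<le> b h"
    and f_out: "\<And>h u. h \<in> {1..n+m} \<Longrightarrow> u \<notin> {a h..b h} \<Longrightarrow> f h u = 0"
    and f_lip: "\<And>h. h \<in> {1..n+m} \<Longrightarrow> \<exists>L. L-lipschitz_on {a h..b h} (f h)"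
    and f_conc: "\<And>h. h \<in> {1..n+m} \<Longrightarrow> concave_on {a h..b h} (f h)"
    and f_end: "\<And>h. h \<in> {1..n+m} \<Longrightarrow> f h (a h) = 0 \<and> f h (b h) = 0"
    and \<eta>_conv: "\<And>h. h \<in> {1..n+m} \<Longrightarrow> convex_on UNIV (\<eta>hat h)"
    and prio: "priority_functions (n+m) a b \<eta>hat \<P>"
begin

definition F :: "nat \<Rightarrow> real \<Rightarrow> real" where
  "F h u = orient n h * f h u"

lemma f_diff: "h \<in> {1..n+m} \<Longrightarrow> AE u in lborel. f h differentiable (at u)"
  by (rule concave_AE_differentiable[OF f_conc f_out])

lemma common_lipschitz: "\<exists>L\<ge>0. \<forall>h\<in>{1..n+m}. L-lipschitz_on UNIV (f h)"
proof -
  have "\<forall>h\<in>{1..n+m}. \<exists>L. L-lipschitz_on UNIV (f h)"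
  proof
    fix h assume h: "h \<in> {1..n+m}"
    obtain L where "L-lipschitz_on {a h..b h} (f h)" using f_lip[OF h] by blast
    from lipschitz_extension[OF this ab[OF h] conjunct1[OF f_end[OF h]] conjunct2[OF f_end[OF h]] f_out[OF h]]
    show "\<exists>L. L-lipschitz_on UNIV (f h)" by blast
  qed
  then obtain L where L: "\<And>h. h \<in> {1..n+m} \<Longrightarrow> (L h)-lipschitz_on UNIV (f h)" by metis
  have nn: "0 \<le> L h" if "h \<in> {1..n+m}" for h using L[OF that] lipschitz_on_nonneg by blast
  show ?thesis
  proof (intro exI[of _ "\<Sum>h\<in>{1..n+m}. L h"] conjI ballI)
    show "0 \<le> (\<Sum>h\<in>{1..n+m}. L h)" using nn by (rule sum_nonneg)
    fix h assume h: "h \<in> {1..n+m}"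
    have "L h \<le> (\<Sum>h\<in>{1..n+m}. L h)" using nn h by (intro member_le_sum) auto
    then show "(\<Sum>h\<in>{1..n+m}. L h)-lipschitz_on UNIV (f h)" by (rule lipschitz_on_le[OF L[OF h]])
  qed
qed

lemma riemann_solver_dissipation:
  assumes "riemann_solver n m a b f \<P> \<sigma>1 \<sigma>1" "riemann_solver n m a b f \<P> \<sigma>2 \<sigma>2"
  shows "(\<Sum>h\<in>{1..n+m}. Q (F h) (\<sigma>1 h) (\<sigma>2 h)) \<le> 0"
proof -
  obtain L where L: "\<And>h. h \<in> {1..n+m} \<Longrightarrow> L-lipschitz_on UNIV (f h)" using common_lipschitz by blast
  \<comment> \<open>Riemann problems are reflected so that the road is on the left, Cauchy problems
    so that it is on the right; hence \<open>g h\<close> is minus \<open>F h\<close>.\<close>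
  define g where "g h u = - orient n h * f h u" for h u
  have god: "\<exists>M. \<exists>z\<in>{0..1}. \<forall>h\<in>{1..n+m}. godunov (g h) (\<sigma> h) (\<P> M h z)"
    and bal: "(\<Sum>h\<in>{1..n+m}. g h (\<sigma> h)) = 0" if rs: "riemann_solver n m a b f \<P> \<sigma> \<sigma>" for \<sigma>
  proof -
    obtain M z r where z: "z \<in> {0..1}"
      and r: "\<And>h. h \<in> {1..n+m} \<Longrightarrow> entropy_solution {a h..b h} (f h) UNIV
             (\<lambda>x. if x \<in> road n h then \<sigma> h else \<P> M h z) (r h)"
        "\<And>h. h \<in> {1..n+m} \<Longrightarrow> AE t in lborel. t > 0 \<longrightarrow> (r h t \<longlongrightarrow> \<sigma> h) (ess_at0 (road n h))"
      and sum: "(\<Sum>i=1..n. f i (\<sigma> i)) - (\<Sum>j=n+1..n+m. f j (\<sigma> j)) = 0"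
      using rs unfolding riemann_solver_def by blast
    have "godunov (g h) (\<sigma> h) (\<P> M h z)" if h: "h \<in> {1..n+m}" for h
      unfolding g_def
      by (rule godunov_of_riemann_problem[OF orient_cases(2) orient_road(2) road_borel r(1)[OF h] ab[OF h] r(2)[OF h] L[OF h] f_diff[OF h]])
    then show "\<exists>M. \<exists>z\<in>{0..1}. \<forall>h\<in>{1..n+m}. godunov (g h) (\<sigma> h) (\<P> M h z)" using z by blast
    have "(\<Sum>h\<in>{1..n+m}. g h (\<sigma> h)) = (\<Sum>h\<in>{1..n}. g h (\<sigma> h)) + (\<Sum>h\<in>{n+1..n+m}. g h (\<sigma> h))"
      by (rule sum.ub_add_nat) simp
    also have "(\<Sum>h\<in>{1..n}. g h (\<sigma> h)) = (\<Sum>i=1..n. f i (\<sigma> i))"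
      by (intro sum.cong) (auto simp: g_def orient_def)
    also have "(\<Sum>h\<in>{n+1..n+m}. g h (\<sigma> h)) = - (\<Sum>j=n+1..n+m. f j (\<sigma> j))"
      unfolding sum_negf[symmetric] by (intro sum.cong) (auto simp: g_def orient_def)
    finally show "(\<Sum>h\<in>{1..n+m}. g h (\<sigma> h)) = 0" using sum by simp
  qed
  obtain M1 z1 where g1: "z1 \<in> {0..1}" "\<And>h. h \<in> {1..n+m} \<Longrightarrow> godunov (g h) (\<sigma>1 h) (\<P> M1 h z1)"
    using god[OF assms(1)] by blast
  obtain M2 z2 where g2: "z2 \<in> {0..1}" "\<And>h. h \<in> {1..n+m} \<Longrightarrow> godunov (g h) (\<sigma>2 h) (\<P> M2 h z2)"
    using god[OF assms(2)] by blast
  have FQ: "Q (F h) u v = - Q (g h) u v" for h u v by (simp add: Q_def F_def g_def algebra_simps)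
  have "0 \<le> (\<Sum>h\<in>{1..n+m}. Q (g h) (\<sigma>1 h) (\<sigma>2 h))"
    using priority_functions_ordered[OF prio \<eta>_conv g1(1) g2(1), of M1 M2]
  proof
    assume le: "\<forall>h\<in>{1..n+m}. \<P> M1 h z1 \<le> \<P> M2 h z2"
    \<comment> \<open>Each trace conserves mass, so both sums of \<open>g\<close> are zero; the
      ordering then applies road by road.\<close>
    have "0 = (\<Sum>h\<in>{1..n+m}. g h (\<sigma>2 h) - g h (\<sigma>1 h))"
      using bal[OF assms(1)] bal[OF assms(2)] by (simp add: sum_subtractf)
    also have "\<dots> \<le> (\<Sum>h\<in>{1..n+m}. Q (g h) (\<sigma>1 h) (\<sigma>2 h))"
      using le by (intro sum_mono godunov_ordered[OF g1(2) g2(2)]) auto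
    finally show ?thesis .
  next
    assume le: "\<forall>h\<in>{1..n+m}. \<P> M2 h z2 \<le> \<P> M1 h z1"
    have "0 = (\<Sum>h\<in>{1..n+m}. g h (\<sigma>1 h) - g h (\<sigma>2 h))"
      using bal[OF assms(1)] bal[OF assms(2)] by (simp add: sum_subtractf)
    also have "\<dots> \<le> (\<Sum>h\<in>{1..n+m}. Q (g h) (\<sigma>2 h) (\<sigma>1 h))"
      using le by (intro sum_mono godunov_ordered[OF g2(2) g1(2)]) auto
    also have "\<dots> = (\<Sum>h\<in>{1..n+m}. Q (g h) (\<sigma>1 h) (\<sigma>2 h))" by (simp only: Q_commute)
    finally show ?thesis .
  qed
  then show ?thesis by (simp add: FQ sum_negf)
qed

end

section \<open>Distance of two solutions\<close>

lemma weight_integrable: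
  assumes "0 < \<mu>" shows "integrable lborel (weight \<mu> (-1))"
proof (rule Bochner_Integration.integrable_bound[OF integrable_exp_halfline[OF assms, of 0]])
  show "AE x in lborel. norm (weight \<mu> (-1) x) \<le> norm (exp (- (\<mu> * x)) * indicator {0..} x)"
    by (rule AE_I2) (simp add: weight_def step_0)
qed simp

lemma weight_nonneg: "0 \<le> weight \<mu> c x"
  by (simp add: weight_def step_bounds)

lemma integrable_set_borel_measurable: "set_integrable M A f \<Longrightarrow> set_borel_measurable M A f"
  unfolding set_integrable_def set_borel_measurable_def by (rule borel_measurable_integrable)

lemma L1_dist_cong_AE:
  assumes "AE x in lborel. x \<in> A \<longrightarrow> u x = u' x" "AE x in lborel. x \<in> A \<longrightarrow> v x = v' x"
  shows "L1_dist A u v = L1_dist A u' v'"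
  unfolding L1_dist_def
proof (rule nn_integral_cong_AE)
  show "AE x in lborel. ennreal \<bar>u x - v x\<bar> * indicator A x = ennreal \<bar>u' x - v' x\<bar> * indicator A x"
    using assms by eventually_elim (simp add: indicator_def)
qed

lemma L1_dist_borel:
  assumes "set_borel_measurable lborel A u" "set_borel_measurable lborel A v"
  shows "(\<lambda>x. ennreal \<bar>u x - v x\<bar> * indicator A x) \<in> borel_measurable borel"
proof -
  have [measurable]: "(\<lambda>x. indicator A x * u x) \<in> borel_measurable borel" "(\<lambda>x. indicator A x * v x) \<in> borel_measurable borel"
    using assms by (simp_all add: set_borel_measurable_def)
  have "(\<lambda>x. ennreal \<bar>u x - v x\<bar> * indicator A x) = (\<lambda>x. ennreal \<bar>indicator A x * u x - indicator A x * v x\<bar>)"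
    by (rule ext) (simp add: indicator_def)
  then show ?thesis by simp
qed

lemma L1_dist_reflect:
  assumes s: "s = 1 \<or> s = (-1 :: real)"
    and "set_borel_measurable lborel A u" "set_borel_measurable lborel A v"
  shows "L1_dist A u v = L1_dist {x. s * x \<in> A} (\<lambda>x. u (s * x)) (\<lambda>x. v (s * x))"
proof -
  have "s \<noteq> 0" "\<bar>s\<bar> = 1" using s by auto
  then show ?thesis
    using nn_integral_real_affine[OF L1_dist_borel[OF assms(2,3)], of s 0]
    by (simp add: L1_dist_def indicator_def)
qed

lemma L1_dist_triangle:
  assumes "set_borel_measurable lborel A u" "set_borel_measurable lborel A v" "set_borel_measurable lborel A w"
  shows "L1_dist A u w \<le> L1_dist A u v + L1_dist A v w"
proof -
  have "L1_dist A u w \<le> (\<integral>\<^sup>+x. ennreal \<bar>u x - v x\<bar> * indicator A x + ennreal \<bar>v x - w x\<bar> * indicator A x \<partial>lborel)"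
    unfolding L1_dist_def
  proof (rule nn_integral_mono)
    fix x
    have "ennreal \<bar>u x - w x\<bar> \<le> ennreal (\<bar>u x - v x\<bar> + \<bar>v x - w x\<bar>)" by (rule ennreal_leI) simp
    also have "\<dots> = ennreal \<bar>u x - v x\<bar> + ennreal \<bar>v x - w x\<bar>" by (rule ennreal_plus) auto
    finally show "ennreal \<bar>u x - w x\<bar> * indicator A x \<le> ennreal \<bar>u x - v x\<bar> * indicator A x + ennreal \<bar>v x - w x\<bar> * indicator A x"
      by (simp add: indicator_def)
  qed
  also have "\<dots> = L1_dist A u v + L1_dist A v w"
    unfolding L1_dist_def
    by (intro nn_integral_add) (use L1_dist_borel[OF assms(1,2)] L1_dist_borel[OF assms(2,3)] in simp_all)
  finally show ?thesis .
qed

lemma L1_dist_commute: "L1_dist A u v = L1_dist A v u"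
  by (simp add: L1_dist_def abs_minus_commute)

text \<open>Compact intervals exhausting the open road, since time continuity is only local in
  space.\<close>

definition truncated_road :: "real \<Rightarrow> nat \<Rightarrow> real set" where
  "truncated_road s R = (if s = 1 then {1 / real R..real R} else {- real R..- (1 / real R)})"

lemma truncated_road_reflect:
  assumes "s = 1 \<or> s = (-1 :: real)"
  shows "{x. s * x \<in> truncated_road s R} = {1 / real R..real R}"
  using assms by (auto simp: truncated_road_def)

lemma truncated_road_subset:
  assumes "1 \<le> R" shows "truncated_road (orient n h) R \<subseteq> road n h"
proof -
  have "0 < 1 / real R" using assms by simp
  then show ?thesis by (auto simp: truncated_road_def orient_def road_def simp del: zero_less_divide_1_iff)
qed

lemma truncated_road_interval: "\<exists>c d. truncated_road s R = {c..d}"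
  by (auto simp: truncated_road_def)

context junction
begin

definition U :: "(nat \<Rightarrow> real \<Rightarrow> real \<Rightarrow> real) \<Rightarrow> nat \<Rightarrow> real \<times> real \<Rightarrow> real" where
  "U \<rho> h = reflected (a h) (b h) (orient n h) (road n h) (\<rho> h)"

definition V :: "(nat \<Rightarrow> real \<Rightarrow> real) \<Rightarrow> nat \<Rightarrow> real \<Rightarrow> real" where
  "V \<rho>0 h = reflected0 (a h) (b h) (orient n h) (road n h) (\<rho>0 h)"

text \<open>The same clipping as for initial data, applied without reflection to the time
  half-line.\<close>

definition trace_repr :: "(nat \<Rightarrow> real \<Rightarrow> real) \<Rightarrow> nat \<Rightarrow> real \<Rightarrow> real" where
  "trace_repr \<sigma> h = reflected0 (a h) (b h) 1 {0<..} (\<sigma> h)"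

lemma Q_F: "Q (F h) u v = orient n h * Q (f h) u v"
  by (simp add: Q_def F_def algebra_simps)

lemma F_lipschitz: "L-lipschitz_on UNIV (f h) \<Longrightarrow> L-lipschitz_on UNIV (F h)"
  unfolding F_def[abs_def] by (rule lipschitz_scale[OF _ orient_cases(1)])

lemma V_facts:
  assumes "initial_data n m a b \<rho>0" and h: "h \<in> {1..n+m}"
  shows "set_borel_measurable lborel (road n h) (\<rho>0 h)" "V \<rho>0 h \<in> borel_measurable borel" "V \<rho>0 h x \<in> {a h..b h}"
    "AE x in lborel. orient n h * x \<in> road n h \<longrightarrow> \<rho>0 h (orient n h * x) = V \<rho>0 h x"
proof -
  show 1: "set_borel_measurable lborel (road n h) (\<rho>0 h)"
    using assms by (intro integrable_set_borel_measurable) (auto simp: initial_data_def)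
  show "V \<rho>0 h \<in> borel_measurable borel" unfolding V_def by (rule reflected0_borel[OF 1 road_borel])
  show "V \<rho>0 h x \<in> {a h..b h}" unfolding V_def by (rule reflected0_range[OF ab[OF h]])
  show "AE x in lborel. orient n h * x \<in> road n h \<longrightarrow> \<rho>0 h (orient n h * x) = V \<rho>0 h x"
    unfolding V_def using assms by (intro reflected0_AE[OF orient_cases(1)]) (auto simp: initial_data_def)
qed

lemma U_facts:
  assumes "generalized_solution n m a b f \<P> \<rho>0 \<rho>" and h: "h \<in> {1..n+m}"
  shows "U \<rho> h \<in> borel_measurable borel" "U \<rho> h z \<in> {a h..b h}"
    "AE z in lborel. fst z > 0 \<and> orient n h * snd z \<in> road n h \<longrightarrow> \<rho> h (fst z) (orient n h * snd z) = U \<rho> h z"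
proof -
  have sol: "entropy_solution {a h..b h} (f h) (road n h) (\<rho>0 h) (\<rho> h)"
    using assms by (auto simp: generalized_solution_def)
  show "U \<rho> h \<in> borel_measurable borel" unfolding U_def
    by (rule reflected_borel[OF _ road_borel]) (use sol in \<open>simp add: entropy_solution_def\<close>)
  show "U \<rho> h z \<in> {a h..b h}" unfolding U_def by (rule reflected_range[OF ab[OF h]])
  show "AE z in lborel. fst z > 0 \<and> orient n h * snd z \<in> road n h \<longrightarrow> \<rho> h (fst z) (orient n h * snd z) = U \<rho> h z"
    unfolding U_def by (rule reflected_AE[OF orient_cases(1) sol])
qed

lemma U_pos_ineq:
  assumes gs: "generalized_solution n m a b f \<P> \<rho>0 \<rho>" and id: "initial_data n m a b \<rho>0" and h: "h \<in> {1..n+m}"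
    and lip: "L-lipschitz_on UNIV (f h)"
  shows "pos_ineq {0<..} (\<lambda>z. \<bar>U \<rho> h z - k\<bar>) (\<lambda>z. Q (F h) (U \<rho> h z) k) (\<lambda>x. \<bar>V \<rho>0 h x - k\<bar>)"
proof -
  have sol: "entropy_solution {a h..b h} (f h) (road n h) (\<rho>0 h) (\<rho> h)"
    using gs h by (auto simp: generalized_solution_def)
  have F: "(\<lambda>u. orient n h * f h u) = F h" by (rule ext) (simp add: F_def)
  show ?thesis
    using reflected_pos_ineq[OF orient_cases(1) sol road_borel lip f_diff[OF h] V_facts(1)[OF id h] zero_le_one zero_le_one
        V_facts(2)[OF id h] V_facts(4)[OF id h], of k]
    unfolding orient_road(1) F by (simp add: kruzhkov_1_1 kruzhkov_flux_1_1 U_def)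
qed

lemma U_kruzhkov_pair:
  assumes gs: "generalized_solution n m a b f \<P> \<rho>01 \<rho>1" "generalized_solution n m a b f \<P> \<rho>02 \<rho>2"
    and id: "initial_data n m a b \<rho>01" "initial_data n m a b \<rho>02" and h: "h \<in> {1..n+m}"
    and lip: "L-lipschitz_on UNIV (f h)"
  shows "kruzhkov_pair (F h) L (max \<bar>a h\<bar> \<bar>b h\<bar>) (U \<rho>1 h) (U \<rho>2 h) (V \<rho>01 h) (V \<rho>02 h)"
proof
  have B: "\<bar>x\<bar> \<le> max \<bar>a h\<bar> \<bar>b h\<bar>" if "x \<in> {a h..b h}" for x using that unfolding atLeastAtMost_iff by linarith
  show "\<bar>U \<rho>1 h z\<bar> \<le> max \<bar>a h\<bar> \<bar>b h\<bar>" "\<bar>U \<rho>2 h z\<bar> \<le> max \<bar>a h\<bar> \<bar>b h\<bar>" for z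
    by (rule B, rule U_facts(2)[OF gs(1) h], rule B, rule U_facts(2)[OF gs(2) h])
  show "\<bar>V \<rho>01 h x\<bar> \<le> max \<bar>a h\<bar> \<bar>b h\<bar>" "\<bar>V \<rho>02 h x\<bar> \<le> max \<bar>a h\<bar> \<bar>b h\<bar>" for x
    by (rule B, rule V_facts(3)[OF id(1) h], rule B, rule V_facts(3)[OF id(2) h])
qed (fact F_lipschitz[OF lip] U_facts(1)[OF gs(1) h] U_facts(1)[OF gs(2) h] V_facts(2)[OF id(1) h] V_facts(2)[OF id(2) h]
    U_pos_ineq[OF gs(1) id(1) h lip] U_pos_ineq[OF gs(2) id(2) h lip])+

text \<open>The traces are replaced by Borel functions with values in \<open>[a h, b h]\<close> at
  all times. For the junction condition a family \<open>\<sigma>\<close> is kept, because the new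
  trace agrees with the given one on the actual roads, whereas the solver takes a family indexed by
  all natural numbers.\<close>

lemma trace_exists:
  assumes gs: "generalized_solution n m a b f \<P> \<rho>0 \<rho>"
  obtains \<tau> where "\<And>h. h \<in> {1..n+m} \<Longrightarrow> \<tau> h \<in> borel_measurable borel"
    "\<And>h t. h \<in> {1..n+m} \<Longrightarrow> \<tau> h t \<in> {a h..b h}"
    "\<And>h c d k. h \<in> {1..n+m} \<Longrightarrow> 0 < c \<Longrightarrow> c \<le> d \<Longrightarrow>
      ((\<lambda>x. L1_dist {c..d} (\<lambda>t. Q (F h) (U \<rho> h (t, x)) k) (\<lambda>t. Q (F h) (\<tau> h t) k)) \<longlongrightarrow> 0) (ess_at0 {0<..})"
    "AE t in lborel. t > 0 \<longrightarrow> (\<exists>\<sigma>. (\<forall>h\<in>{1..n+m}. \<tau> h t = \<sigma> h) \<and> riemann_solver n m a b f \<P> \<sigma> \<sigma>)"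
proof -
  obtain \<sigma> where \<sigma>1: "\<And>h. h \<in> {1..n+m} \<Longrightarrow> set_borel_measurable lborel {0<..} (\<sigma> h)"
    and \<sigma>2: "\<And>h. h \<in> {1..n+m} \<Longrightarrow> AE t in lborel. t > 0 \<longrightarrow> \<sigma> h t \<in> {a h..b h}"
    and \<sigma>3: "\<And>h \<eta> G c d. h \<in> {1..n+m} \<Longrightarrow> entropy_pair (f h) \<eta> G \<Longrightarrow> 0 < c \<Longrightarrow> c \<le> d \<Longrightarrow>
       ((\<lambda>x. L1_dist {c..d} (\<lambda>t. G (\<rho> h t x)) (\<lambda>t. G (\<sigma> h t))) \<longlongrightarrow> 0) (ess_at0 (road n h))"
    and \<sigma>4: "AE t in lborel. t > 0 \<longrightarrow> riemann_solver n m a b f \<P> (\<lambda>h. \<sigma> h t) (\<lambda>h. \<sigma> h t)"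
    using gs unfolding generalized_solution_def by blast
  define \<tau> where "\<tau> = trace_repr \<sigma>"
  have one: "(1::real) = 1 \<or> (1::real) = -1" by simp
  have \<tau>1: "\<tau> h \<in> borel_measurable borel" if h: "h \<in> {1..n+m}" for h
    unfolding \<tau>_def trace_repr_def by (rule reflected0_borel[OF \<sigma>1[OF h]]) simp
  have \<tau>2: "\<tau> h t \<in> {a h..b h}" if h: "h \<in> {1..n+m}" for h t
    unfolding \<tau>_def trace_repr_def by (rule reflected0_range[OF ab[OF h]])
  have \<tau>_eq: "AE t in lborel. 0 < t \<longrightarrow> \<sigma> h t = \<tau> h t" if h: "h \<in> {1..n+m}" for h
    using reflected0_AE[OF one, of "{0<..}" "\<sigma> h" "a h" "b h"] \<sigma>2[OF h] by (simp add: \<tau>_def trace_repr_def)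
  show thesis
  proof (rule that[of \<tau>, OF \<tau>1 \<tau>2])
    fix h c d k assume h: "h \<in> {1..n+m}" and cd: "0 < (c :: real)" "c \<le> d"
    obtain L where L: "L-lipschitz_on UNIV (f h)" using common_lipschitz h by blast
    have "entropy_pair (f h) (kruzhkov 1 1 k) (kruzhkov_flux (f h) 1 1 k)"
      by (rule entropy_pair_kruzhkov[OF L _ _ f_diff[OF h]]) auto
    from \<sigma>3[OF h this cd]
    have "((\<lambda>x. L1_dist {c..d} (\<lambda>t. Q (f h) (\<rho> h t x) k) (\<lambda>t. Q (f h) (\<sigma> h t) k)) \<longlongrightarrow> 0) (ess_at0 (road n h))"
      by (simp add: kruzhkov_flux_1_1)
    from filterlim_compose[OF this filterlim_reflect[OF orient_cases(1)[of n h], of "road n h"]]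
    have "((\<lambda>x. L1_dist {c..d} (\<lambda>t. Q (f h) (\<rho> h t (orient n h * x)) k) (\<lambda>t. Q (f h) (\<sigma> h t) k)) \<longlongrightarrow> 0) (ess_at0 {0<..})"
      by (simp only: orient_road(1))
    then show "((\<lambda>x. L1_dist {c..d} (\<lambda>t. Q (F h) (U \<rho> h (t, x)) k) (\<lambda>t. Q (F h) (\<tau> h t) k)) \<longlongrightarrow> 0) (ess_at0 {0<..})"
    \<comment> \<open>For almost every \<open>x\<close> the section in time of the representative is
      right, and the essential limit neglects the remaining \<open>x\<close>.\<close>
    proof (rule tendsto_ess_cong)
      have "AE x in lborel. AE t in lborel. 0 < t \<and> orient n h * x \<in> road n h \<longrightarrow> \<rho> h t (orient n h * x) = U \<rho> h (t, x)"
        using AE_sections(2)[OF U_facts(3)[OF gs h]] by simp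
      then show "AE x in lborel. x \<in> {0<..} \<longrightarrow>
         L1_dist {c..d} (\<lambda>t. Q (f h) (\<rho> h t (orient n h * x)) k) (\<lambda>t. Q (f h) (\<sigma> h t) k)
         = L1_dist {c..d} (\<lambda>t. Q (F h) (U \<rho> h (t, x)) k) (\<lambda>t. Q (F h) (\<tau> h t) k)"
      proof eventually_elim
        case (elim x)
        show ?case
        proof
          assume "x \<in> {0<..}"
          then have x: "orient n h * x \<in> road n h" using orient_road(1)[of n h] by blast
          have ab: "\<bar>orient n h * p - orient n h * q\<bar> = \<bar>p - q\<bar>" for p q by (auto simp: orient_def)
          show "L1_dist {c..d} (\<lambda>t. Q (f h) (\<rho> h t (orient n h * x)) k) (\<lambda>t. Q (f h) (\<sigma> h t) k)
            = L1_dist {c..d} (\<lambda>t. Q (F h) (U \<rho> h (t, x)) k) (\<lambda>t. Q (F h) (\<tau> h t) k)"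
            unfolding L1_dist_def Q_F ab
          proof (rule nn_integral_cong_AE)
            show "AE t in lborel. ennreal \<bar>Q (f h) (\<rho> h t (orient n h * x)) k - Q (f h) (\<sigma> h t) k\<bar> * indicator {c..d} t
               = ennreal \<bar>Q (f h) (U \<rho> h (t, x)) k - Q (f h) (\<tau> h t) k\<bar> * indicator {c..d} t"
              using elim \<tau>_eq[OF h]
            proof eventually_elim
              case (elim t)
              show ?case
              proof (cases "t \<in> {c..d}")
                case True
                then have "0 < t" using cd by simp
                then show ?thesis using elim x by simp
              qed simp
            qed
          qed
        qed
      qed
    qed
  next
    have "AE t in lborel. \<forall>h\<in>{1..n+m}. 0 < t \<longrightarrow> \<sigma> h t = \<tau> h t"
      using \<tau>_eq by (intro AE_finite_allI) auto
    with \<sigma>4 show "AE t in lborel. t > 0 \<longrightarrow> (\<exists>\<sigma>. (\<forall>h\<in>{1..n+m}. \<tau> h t = \<sigma> h) \<and> riemann_solver n m a b f \<P> \<sigma> \<sigma>)"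
    proof eventually_elim
      case (elim t)
      show ?case
      proof
        assume "0 < t"
        then have "(\<forall>h\<in>{1..n+m}. \<tau> h t = \<sigma> h t) \<and> riemann_solver n m a b f \<P> (\<lambda>h. \<sigma> h t) (\<lambda>h. \<sigma> h t)"
          using elim by auto
        then show "\<exists>\<sigma>. (\<forall>h\<in>{1..n+m}. \<tau> h t = \<sigma> h) \<and> riemann_solver n m a b f \<P> \<sigma> \<sigma>"
          by (rule exI[of _ "\<lambda>h. \<sigma> h t"])
      qed
    qed
  qed
qed

section \<open>Contraction of the weighted distance\<close>

context
  fixes \<rho>01 \<rho>02 :: "nat \<Rightarrow> real \<Rightarrow> real" and \<rho>1 \<rho>2 :: "nat \<Rightarrow> real \<Rightarrow> real \<Rightarrow> real" and L :: real
  assumes id: "initial_data n m a b \<rho>01" "initial_data n m a b \<rho>02"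
    and gs: "generalized_solution n m a b f \<P> \<rho>01 \<rho>1" "generalized_solution n m a b f \<P> \<rho>02 \<rho>2"
    and L: "\<And>h. h \<in> {1..n+m} \<Longrightarrow> L-lipschitz_on UNIV (f h)" and L_nonneg: "0 \<le> L"
begin

definition weighted_dist :: "real \<Rightarrow> nat \<Rightarrow> real \<Rightarrow> real" where
  "weighted_dist \<mu> h t = (LBINT x. \<bar>U \<rho>1 h (t, x) - U \<rho>2 h (t, x)\<bar> * weight \<mu> (-1) x)"

definition weighted_dist0 :: "real \<Rightarrow> nat \<Rightarrow> real" where
  "weighted_dist0 \<mu> h = (LBINT x. \<bar>V \<rho>01 h x - V \<rho>02 h x\<bar> * weight \<mu> (-1) x)"

lemma weighted_dist_integrable:
  assumes "0 < \<mu>" "h \<in> {1..n+m}"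
  shows "integrable lborel (\<lambda>x. \<bar>U \<rho>1 h (t, x) - U \<rho>2 h (t, x)\<bar> * weight \<mu> (-1) x)"
    and "\<bar>weighted_dist \<mu> h t\<bar> \<le> (b h - a h) * (LBINT x. weight \<mu> (-1) x)"
    and "0 \<le> weighted_dist \<mu> h t"
    and "weighted_dist \<mu> h \<in> borel_measurable borel"
proof -
  note [measurable] = U_facts(1)[OF gs(1) assms(2)] U_facts(1)[OF gs(2) assms(2)]
  have le: "\<bar>\<bar>U \<rho>1 h (t, x) - U \<rho>2 h (t, x)\<bar> * weight \<mu> (-1) x\<bar> \<le> (b h - a h) * weight \<mu> (-1) x" for x
  proof -
    have "\<bar>U \<rho>1 h (t, x) - U \<rho>2 h (t, x)\<bar> \<le> b h - a h"
      using U_facts(2)[OF gs(1) assms(2), of "(t, x)"] U_facts(2)[OF gs(2) assms(2), of "(t, x)"]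
      unfolding atLeastAtMost_iff by linarith
    from mult_right_mono[OF this weight_nonneg] show ?thesis by (simp add: abs_mult weight_nonneg)
  qed
  have iw: "integrable lborel (\<lambda>x. (b h - a h) * weight \<mu> (-1) x)" using weight_integrable[OF assms(1)] by simp
  show i: "integrable lborel (\<lambda>x. \<bar>U \<rho>1 h (t, x) - U \<rho>2 h (t, x)\<bar> * weight \<mu> (-1) x)"
  proof (rule Bochner_Integration.integrable_bound[OF iw])
    show "AE x in lborel. norm (\<bar>U \<rho>1 h (t, x) - U \<rho>2 h (t, x)\<bar> * weight \<mu> (-1) x) \<le> norm ((b h - a h) * weight \<mu> (-1) x)"
    proof (rule AE_I2)
      fix x show "norm (\<bar>U \<rho>1 h (t, x) - U \<rho>2 h (t, x)\<bar> * weight \<mu> (-1) x) \<le> norm ((b h - a h) * weight \<mu> (-1) x)"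
        using order_trans[OF le abs_ge_self] by (simp only: real_norm_def)
    qed
  qed measurable
  show nn: "0 \<le> weighted_dist \<mu> h t"
    unfolding weighted_dist_def by (rule Bochner_Integration.integral_nonneg) (simp add: weight_nonneg)
  have "weighted_dist \<mu> h t \<le> (LBINT x. (b h - a h) * weight \<mu> (-1) x)"
    unfolding weighted_dist_def
  proof (rule integral_mono[OF i iw])
    fix x show "\<bar>U \<rho>1 h (t, x) - U \<rho>2 h (t, x)\<bar> * weight \<mu> (-1) x \<le> (b h - a h) * weight \<mu> (-1) x"
      using le[of x] by (rule order_trans[OF abs_ge_self])
  qed
  then show "\<bar>weighted_dist \<mu> h t\<bar> \<le> (b h - a h) * (LBINT x. weight \<mu> (-1) x)" using nn by simp
  show "weighted_dist \<mu> h \<in> borel_measurable borel" unfolding weighted_dist_def[abs_def] by measurable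
qed

text \<open>The Gronwall argument must be applied to the sum over all roads, because only the sum of
  the boundary terms \<open>l h\<close> has a sign.\<close>

lemma weighted_contraction:
  assumes \<mu>: "0 < \<mu>"
  shows "AE t in lborel. t > 0 \<longrightarrow>
    (\<Sum>h\<in>{1..n+m}. weighted_dist \<mu> h t) \<le> exp (L * \<mu> * t) * (\<Sum>h\<in>{1..n+m}. weighted_dist0 \<mu> h)"
proof (rule gronwall_weak)
  show "(\<lambda>t. \<Sum>h\<in>{1..n+m}. weighted_dist \<mu> h t) \<in> borel_measurable borel"
    by (intro borel_measurable_sum weighted_dist_integrable(4)[OF \<mu>])
  show "\<bar>\<Sum>h\<in>{1..n+m}. weighted_dist \<mu> h t\<bar> \<le> (\<Sum>h\<in>{1..n+m}. (b h - a h) * (LBINT x. weight \<mu> (-1) x))" for t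
    by (intro order_trans[OF sum_abs] sum_mono weighted_dist_integrable(2)[OF \<mu>])
  show "0 \<le> L * \<mu>" using L_nonneg \<mu> by simp
  fix \<alpha> assume \<alpha>: "test_fun UNIV \<alpha>"
  note [measurable] = test_funD(6,7)[OF \<alpha>]
  obtain \<tau>1 where t1: "\<And>h. h \<in> {1..n+m} \<Longrightarrow> \<tau>1 h \<in> borel_measurable borel"
    "\<And>h t. h \<in> {1..n+m} \<Longrightarrow> \<tau>1 h t \<in> {a h..b h}"
    "\<And>h c d k. h \<in> {1..n+m} \<Longrightarrow> 0 < c \<Longrightarrow> c \<le> d \<Longrightarrow>
      ((\<lambda>x. L1_dist {c..d} (\<lambda>t. Q (F h) (U \<rho>1 h (t, x)) k) (\<lambda>t. Q (F h) (\<tau>1 h t) k)) \<longlongrightarrow> 0) (ess_at0 {0<..})"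
    "AE t in lborel. t > 0 \<longrightarrow> (\<exists>\<sigma>. (\<forall>h\<in>{1..n+m}. \<tau>1 h t = \<sigma> h) \<and> riemann_solver n m a b f \<P> \<sigma> \<sigma>)"
    using trace_exists[OF gs(1)] by blast
  obtain \<tau>2 where t2: "\<And>h. h \<in> {1..n+m} \<Longrightarrow> \<tau>2 h \<in> borel_measurable borel"
    "\<And>h t. h \<in> {1..n+m} \<Longrightarrow> \<tau>2 h t \<in> {a h..b h}"
    "\<And>h c d k. h \<in> {1..n+m} \<Longrightarrow> 0 < c \<Longrightarrow> c \<le> d \<Longrightarrow>
      ((\<lambda>x. L1_dist {c..d} (\<lambda>t. Q (F h) (U \<rho>2 h (t, x)) k) (\<lambda>t. Q (F h) (\<tau>2 h t) k)) \<longlongrightarrow> 0) (ess_at0 {0<..})"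
    "AE t in lborel. t > 0 \<longrightarrow> (\<exists>\<sigma>. (\<forall>h\<in>{1..n+m}. \<tau>2 h t = \<sigma> h) \<and> riemann_solver n m a b f \<P> \<sigma> \<sigma>)"
    using trace_exists[OF gs(2)] by blast
  define l where "l h = (LBINT t. indicator {0<..} t * (Q (F h) (\<tau>1 h t) (\<tau>2 h t) * \<alpha> t))" for h
  obtain p q where pq: "\<forall>x. x \<notin> {p..q} \<longrightarrow> \<alpha> x = 0 \<and> deriv \<alpha> x = 0" using test_fun_support[OF \<alpha>] by blast
  obtain A where A: "0 \<le> A" "\<forall>x. \<bar>\<alpha> x\<bar> \<le> A \<and> \<bar>deriv \<alpha> x\<bar> \<le> A" using test_fun_bounded[OF \<alpha>] by blast
  have il: "integrable lborel (\<lambda>t. indicator {0<..} t * (Q (F h) (\<tau>1 h t) (\<tau>2 h t) * \<alpha> t))" if h: "h \<in> {1..n+m}" for h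
  proof (rule integrable_bounded_support[where S="{p..q}" and C="L * (b h - a h) * A"])
    note [measurable] = t1(1)[OF h] t2(1)[OF h] borel_measurable_Q[OF lipschitz_on_continuous_on[OF F_lipschitz[OF L[OF h]]]]
    show "(\<lambda>t. indicator {0<..} t * (Q (F h) (\<tau>1 h t) (\<tau>2 h t) * \<alpha> t)) \<in> borel_measurable borel" by measurable
    fix t
    have "\<bar>\<tau>1 h t - \<tau>2 h t\<bar> \<le> b h - a h" using t1(2)[OF h, of t] t2(2)[OF h, of t] unfolding atLeastAtMost_iff by linarith
    from order_trans[OF Q_le[OF F_lipschitz[OF L[OF h]]] mult_left_mono[OF this L_nonneg]]
    have "\<bar>Q (F h) (\<tau>1 h t) (\<tau>2 h t)\<bar> * \<bar>\<alpha> t\<bar> \<le> L * (b h - a h) * A"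
      using A L_nonneg ab[OF h] by (intro mult_mono) auto
    then show "\<bar>indicator {0<..} t * (Q (F h) (\<tau>1 h t) (\<tau>2 h t) * \<alpha> t)\<bar> \<le> L * (b h - a h) * A"
      using L_nonneg ab[OF h] A(1) by (simp add: abs_mult indicator_def)
    show "t \<notin> {p..q} \<Longrightarrow> indicator {0<..} t * (Q (F h) (\<tau>1 h t) (\<tau>2 h t) * \<alpha> t) = 0" using pq by simp
  qed simp
  have l_le: "(\<Sum>h\<in>{1..n+m}. l h) \<le> 0"
  proof -
    have "(\<Sum>h\<in>{1..n+m}. l h) = (LBINT t. (\<Sum>h\<in>{1..n+m}. indicator {0<..} t * (Q (F h) (\<tau>1 h t) (\<tau>2 h t) * \<alpha> t)))"
      unfolding l_def by (intro Bochner_Integration.integral_sum[symmetric] il)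
    also have "\<dots> = (LBINT t. indicator {0<..} t * \<alpha> t * (\<Sum>h\<in>{1..n+m}. Q (F h) (\<tau>1 h t) (\<tau>2 h t)))"
      by (simp add: sum_distrib_left algebra_simps)
    also have "\<dots> \<le> 0"
    proof -
      have "AE t in lborel. 0 \<le> - (indicator {0<..} t * \<alpha> t * (\<Sum>h\<in>{1..n+m}. Q (F h) (\<tau>1 h t) (\<tau>2 h t)))"
        using t1(4) t2(4)
      proof eventually_elim
        case (elim t)
        show ?case
        proof (cases "0 < t")
          case True
          then obtain \<sigma>1 \<sigma>2 where \<sigma>: "\<forall>h\<in>{1..n+m}. \<tau>1 h t = \<sigma>1 h" "riemann_solver n m a b f \<P> \<sigma>1 \<sigma>1"
            "\<forall>h\<in>{1..n+m}. \<tau>2 h t = \<sigma>2 h" "riemann_solver n m a b f \<P> \<sigma>2 \<sigma>2"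
            using elim by blast
          have "(\<Sum>h\<in>{1..n+m}. Q (F h) (\<tau>1 h t) (\<tau>2 h t)) = (\<Sum>h\<in>{1..n+m}. Q (F h) (\<sigma>1 h) (\<sigma>2 h))"
            using \<sigma>(1,3) by (intro sum.cong) auto
          also have "\<dots> \<le> 0" by (rule riemann_solver_dissipation[OF \<sigma>(2,4)])
          finally show ?thesis using True test_funD(4)[OF \<alpha>, of t] by (simp add: mult_nonneg_nonpos)
        qed simp
      qed
      from integral_nonneg_AE[OF this] show ?thesis by simp
    qed
    finally show ?thesis .
  qed
  define I where "I h = (LBINT z. indicator {0<..} (fst z) * (\<bar>U \<rho>1 h z - U \<rho>2 h z\<bar> * ((deriv \<alpha> (fst z) + L * \<mu> * \<alpha> (fst z)) * weight \<mu> (-1) (snd z))))" for h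
  have road: "0 \<le> I h + l h + \<alpha> 0 * weighted_dist0 \<mu> h"
    and I_eq: "I h = (LBINT t. indicator {0<..} t * (weighted_dist \<mu> h t * (deriv \<alpha> t + L * \<mu> * \<alpha> t)))"
    and I_int: "integrable lborel (\<lambda>t. indicator {0<..} t * (weighted_dist \<mu> h t * (deriv \<alpha> t + L * \<mu> * \<alpha> t)))"
    if h: "h \<in> {1..n+m}" for h
  proof -
    \<comment> \<open>The turning point of \<open>f h\<close> is the reference state for the traces;
      the sign contained in \<open>F h\<close> drops out of the absolute values.\<close>
    obtain M where M: "M \<in> {a h..b h}" "mono_on {a h..M} (f h)" "antimono_on {M..b h} (f h)"
      using concave_unimodal[OF f_conc[OF h] continuous_on_subset[OF lipschitz_on_continuous_on[OF L[OF h]] subset_UNIV] ab[OF h]] by blast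
    have uni: "\<bar>Q (F h) u v - Q (F h) u' v\<bar> \<le> \<bar>Q (F h) u M - Q (F h) u' M\<bar>"
      if "u \<in> {a h..b h}" "u' \<in> {a h..b h}" "v \<in> {a h..b h}" for u u' v
    proof -
      have ab: "\<bar>orient n h * p - orient n h * q\<bar> = \<bar>p - q\<bar>" for p q by (auto simp: orient_def)
      show ?thesis unfolding Q_F ab by (rule Q_le_unimodal[OF M(2,3,1) that])
    qed
    have tr: "((\<lambda>x. LBINT t. indicator {0<..} t * (Q (F h) (U \<rho>1 h (t, x)) (U \<rho>2 h (t, x)) * \<alpha> t)) \<longlongrightarrow> l h) (ess_at0 {0<..})"
      unfolding l_def
      by (rule trace_flux_limit[OF F_lipschitz[OF L[OF h]] U_facts(1)[OF gs(1) h] U_facts(1)[OF gs(2) h] t1(1)[OF h] t2(1)[OF h]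
            U_facts(2)[OF gs(1) h] U_facts(2)[OF gs(2) h] t1(2)[OF h] t2(2)[OF h] uni t1(3)[OF h] t2(3)[OF h] \<alpha>])
    note rc = road_contraction[OF U_kruzhkov_pair[OF gs id h L[OF h]] order_refl \<mu> \<alpha> tr]
    show "0 \<le> I h + l h + \<alpha> 0 * weighted_dist0 \<mu> h" using rc(1) by (simp add: I_def weighted_dist0_def)
    have inner: "(LBINT x. indicator {0<..} t * (\<bar>U \<rho>1 h (t, x) - U \<rho>2 h (t, x)\<bar> * ((deriv \<alpha> t + L * \<mu> * \<alpha> t) * weight \<mu> (-1) x)))
       = indicator {0<..} t * (weighted_dist \<mu> h t * (deriv \<alpha> t + L * \<mu> * \<alpha> t))" for t
    proof -
      have "(LBINT x. indicator {0<..} t * (\<bar>U \<rho>1 h (t, x) - U \<rho>2 h (t, x)\<bar> * ((deriv \<alpha> t + L * \<mu> * \<alpha> t) * weight \<mu> (-1) x)))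
        = (LBINT x. indicator {0<..} t * (deriv \<alpha> t + L * \<mu> * \<alpha> t) * (\<bar>U \<rho>1 h (t, x) - U \<rho>2 h (t, x)\<bar> * weight \<mu> (-1) x))"
        by (intro Bochner_Integration.integral_cong refl) (simp add: algebra_simps)
      also have "\<dots> = indicator {0<..} t * (deriv \<alpha> t + L * \<mu> * \<alpha> t) * weighted_dist \<mu> h t"
        unfolding weighted_dist_def by (rule integral_mult_right_zero)
      finally show ?thesis by (simp only: mult.assoc mult.commute[of "weighted_dist \<mu> h t"])
    qed
    show "I h = (LBINT t. indicator {0<..} t * (weighted_dist \<mu> h t * (deriv \<alpha> t + L * \<mu> * \<alpha> t)))"
      using Fubini_lborel(1)[OF rc(2)] by (simp only: I_def fst_conv snd_conv inner)
    show "integrable lborel (\<lambda>t. indicator {0<..} t * (weighted_dist \<mu> h t * (deriv \<alpha> t + L * \<mu> * \<alpha> t)))"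
      using Fubini_lborel(3)[OF rc(2)] by (simp only: fst_conv snd_conv inner)
  qed
  have "0 \<le> (\<Sum>h\<in>{1..n+m}. I h + l h + \<alpha> 0 * weighted_dist0 \<mu> h)" using road by (rule sum_nonneg)
  also have "\<dots> = (\<Sum>h\<in>{1..n+m}. I h) + (\<Sum>h\<in>{1..n+m}. l h) + \<alpha> 0 * (\<Sum>h\<in>{1..n+m}. weighted_dist0 \<mu> h)"
    by (simp add: sum.distrib sum_distrib_left)
  also have "\<dots> \<le> (\<Sum>h\<in>{1..n+m}. I h) + \<alpha> 0 * (\<Sum>h\<in>{1..n+m}. weighted_dist0 \<mu> h)" using l_le by simp
  also have "(\<Sum>h\<in>{1..n+m}. I h) = (\<Sum>h\<in>{1..n+m}. LBINT t. indicator {0<..} t * (weighted_dist \<mu> h t * (deriv \<alpha> t + L * \<mu> * \<alpha> t)))"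
    by (intro sum.cong refl I_eq)
  also have "\<dots> = (LBINT t. (\<Sum>h\<in>{1..n+m}. indicator {0<..} t * (weighted_dist \<mu> h t * (deriv \<alpha> t + L * \<mu> * \<alpha> t))))"
    by (intro Bochner_Integration.integral_sum[symmetric] I_int)
  also have "\<dots> = (LBINT t. indicator {0<..} t * ((\<Sum>h\<in>{1..n+m}. weighted_dist \<mu> h t) * (deriv \<alpha> t + L * \<mu> * \<alpha> t)))"
    by (simp add: sum_distrib_left sum_distrib_right)
  finally show "0 \<le> (LBINT t. indicator {0<..} t * ((\<Sum>h\<in>{1..n+m}. weighted_dist \<mu> h t) * (deriv \<alpha> t + L * \<mu> * \<alpha> t)))
      + \<alpha> 0 * (\<Sum>h\<in>{1..n+m}. weighted_dist0 \<mu> h)" .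
qed

text \<open>The weight is positive on the positive half-line, so a vanishing weighted distance means
  equality almost everywhere; \<open>\<mu> = 1\<close> will do. The conclusion is almost everywhere
  in time and space, so no representative has to be chosen.\<close>

lemma solutions_unique:
  assumes V_eq: "\<And>h. h \<in> {1..n+m} \<Longrightarrow> V \<rho>01 h = V \<rho>02 h" and h: "h \<in> {1..n+m}"
  shows "AE (t, x) in lborel. t > 0 \<and> x \<in> road n h \<longrightarrow> \<rho>1 h t x = \<rho>2 h t x"
proof -
  note [measurable] = U_facts(1)[OF gs(1) h] U_facts(1)[OF gs(2) h]
  have "(\<Sum>h\<in>{1..n+m}. weighted_dist0 1 h) = 0" using V_eq by (simp add: weighted_dist0_def)
  then have "AE t in lborel. t > 0 \<longrightarrow> (\<Sum>h\<in>{1..n+m}. weighted_dist 1 h t) \<le> 0"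
    using weighted_contraction[of 1] by simp
  then have "AE t in lborel. AE x in lborel. 0 < t \<and> 0 < x \<longrightarrow> U \<rho>1 h (t, x) = U \<rho>2 h (t, x)"
  proof eventually_elim
    case (elim t)
    show ?case
    proof (cases "0 < t")
      case True
      have "weighted_dist 1 h t \<le> (\<Sum>h\<in>{1..n+m}. weighted_dist 1 h t)"
        using h by (intro member_le_sum weighted_dist_integrable(3)) auto
      then have "weighted_dist 1 h t = 0"
        using elim True weighted_dist_integrable(3)[of 1 h t] h by simp
      then have "AE x in lborel. \<bar>U \<rho>1 h (t, x) - U \<rho>2 h (t, x)\<bar> * weight 1 (-1) x = 0"
        unfolding weighted_dist_def
        by (subst (asm) integral_nonneg_eq_0_iff_AE)
          (use weighted_dist_integrable(1)[of 1 h t] h weight_nonneg in auto)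
      then show ?thesis by eventually_elim (auto simp: weight_def)
    qed simp
  qed
  then have ae: "AE t in lborel. AE x in lborel. 0 < fst (t, x) \<and> 0 < snd (t, x) \<longrightarrow> U \<rho>1 h (t, x) = U \<rho>2 h (t, x)"
    by simp
  \<comment> \<open>Passing from almost all sections to almost all points needs a measurable set,
    which the Borel representatives provide; the result is then transferred to the given
    densities.\<close>
  have "{z \<in> space (lborel \<Otimes>\<^sub>M lborel). 0 < fst z \<and> 0 < snd z \<longrightarrow> U \<rho>1 h z = U \<rho>2 h z} \<in> sets (lborel \<Otimes>\<^sub>M lborel)"
    unfolding lborel_prod by measurable
  from lborel_pair.AE_pair_measure[OF this ae]
  have "AE z in (lborel :: (real \<times> real) measure). 0 < fst z \<and> 0 < snd z \<longrightarrow> U \<rho>1 h z = U \<rho>2 h z"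
    unfolding lborel_prod .
  with U_facts(3)[OF gs(1) h] U_facts(3)[OF gs(2) h]
  have "AE z in lborel. fst z > 0 \<and> orient n h * snd z \<in> road n h \<longrightarrow>
      \<rho>1 h (fst z) (orient n h * snd z) = \<rho>2 h (fst z) (orient n h * snd z)"
  proof eventually_elim
    case (elim z)
    show ?case
    proof
      assume z: "fst z > 0 \<and> orient n h * snd z \<in> road n h"
      then have "0 < snd z" using orient_road(1)[of n h] by auto
      then show "\<rho>1 h (fst z) (orient n h * snd z) = \<rho>2 h (fst z) (orient n h * snd z)" using elim z by simp
    qed
  qed
  from AE_reflect[OF orient_cases(1) this]
  have "AE z in lborel. fst z > 0 \<and> orient n h * (orient n h * snd z) \<in> road n h \<longrightarrow>
      \<rho>1 h (fst z) (orient n h * (orient n h * snd z)) = \<rho>2 h (fst z) (orient n h * (orient n h * snd z))" by simp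
  moreover have "orient n h * (orient n h * y) = y" for y by (simp add: orient_def)
  ultimately show ?thesis by (simp add: case_prod_beta)
qed

lemma weighted_dist0_le:
  assumes \<mu>: "0 < \<mu>" and h: "h \<in> {1..n+m}"
  shows "0 \<le> weighted_dist0 \<mu> h" "ennreal (weighted_dist0 \<mu> h) \<le> L1_dist (road n h) (\<rho>01 h) (\<rho>02 h)"
proof -
  show "0 \<le> weighted_dist0 \<mu> h"
    unfolding weighted_dist0_def by (rule Bochner_Integration.integral_nonneg) (simp add: weight_nonneg)
  note [measurable] = V_facts(2)[OF id(1) h] V_facts(2)[OF id(2) h]
  have i: "integrable lborel (\<lambda>x. \<bar>V \<rho>01 h x - V \<rho>02 h x\<bar> * weight \<mu> (-1) x)"
  proof (rule Bochner_Integration.integrable_bound)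
    show "integrable lborel (\<lambda>x. (b h - a h) * weight \<mu> (-1) x)" using weight_integrable[OF \<mu>] by simp
    show "AE x in lborel. norm (\<bar>V \<rho>01 h x - V \<rho>02 h x\<bar> * weight \<mu> (-1) x) \<le> norm ((b h - a h) * weight \<mu> (-1) x)"
    proof (rule AE_I2)
      fix x
      have "\<bar>V \<rho>01 h x - V \<rho>02 h x\<bar> \<le> \<bar>b h - a h\<bar>"
        using V_facts(3)[OF id(1) h, of x] V_facts(3)[OF id(2) h, of x] unfolding atLeastAtMost_iff by linarith
      from mult_right_mono[OF this weight_nonneg[of \<mu> "-1" x]]
      show "norm (\<bar>V \<rho>01 h x - V \<rho>02 h x\<bar> * weight \<mu> (-1) x) \<le> norm ((b h - a h) * weight \<mu> (-1) x)"
        by (simp add: abs_mult weight_nonneg)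
    qed
  qed measurable
  have "ennreal (weighted_dist0 \<mu> h) = (\<integral>\<^sup>+x. ennreal (\<bar>V \<rho>01 h x - V \<rho>02 h x\<bar> * weight \<mu> (-1) x) \<partial>lborel)"
    unfolding weighted_dist0_def by (rule nn_integral_eq_integral[symmetric, OF i]) (simp add: weight_nonneg)
  also have "\<dots> \<le> L1_dist {0<..} (V \<rho>01 h) (V \<rho>02 h)"
    unfolding L1_dist_def
  proof (rule nn_integral_mono)
    fix x
    show "ennreal (\<bar>V \<rho>01 h x - V \<rho>02 h x\<bar> * weight \<mu> (-1) x) \<le> ennreal \<bar>V \<rho>01 h x - V \<rho>02 h x\<bar> * indicator {0<..} x"
    proof (cases "0 < x")
      case True
      then have "weight \<mu> (-1) x \<le> 1" using \<mu> by (simp add: weight_def)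
      then have "\<bar>V \<rho>01 h x - V \<rho>02 h x\<bar> * weight \<mu> (-1) x \<le> \<bar>V \<rho>01 h x - V \<rho>02 h x\<bar>" by (simp add: mult_left_le)
      then show ?thesis using True by (simp add: ennreal_leI)
    qed (simp add: weight_def step_0)
  qed
  also have "\<dots> = L1_dist {0<..} (\<lambda>x. \<rho>01 h (orient n h * x)) (\<lambda>x. \<rho>02 h (orient n h * x))"
  proof (rule L1_dist_cong_AE)
    have r: "orient n h * x \<in> road n h \<longleftrightarrow> x \<in> {0<..}" for x using orient_road(1)[of n h] by blast
    show "AE x in lborel. x \<in> {0<..} \<longrightarrow> V \<rho>01 h x = \<rho>01 h (orient n h * x)"
      using V_facts(4)[OF id(1) h] unfolding r by eventually_elim simp
    show "AE x in lborel. x \<in> {0<..} \<longrightarrow> V \<rho>02 h x = \<rho>02 h (orient n h * x)"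
      using V_facts(4)[OF id(2) h] unfolding r by eventually_elim simp
  qed
  also have "\<dots> = L1_dist (road n h) (\<rho>01 h) (\<rho>02 h)"
    using L1_dist_reflect[OF orient_cases(1)[of n h] V_facts(1)[OF id(1) h] V_facts(1)[OF id(2) h]] by (simp only: orient_road(1))
  finally show "ennreal (weighted_dist0 \<mu> h) \<le> L1_dist (road n h) (\<rho>01 h) (\<rho>02 h)" .
qed

section \<open>From almost every time to every time\<close>

context
  assumes tc: "time_continuous n m \<rho>1" "time_continuous n m \<rho>2"
begin

lemma slice_borel:
  assumes "h \<in> {1..n+m}" "0 \<le> t" "1 \<le> R"
  shows "set_borel_measurable lborel (truncated_road (orient n h) R) (\<rho>1 h t)"
    "set_borel_measurable lborel (truncated_road (orient n h) R) (\<rho>2 h t)"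
proof -
  obtain c d where cd: "truncated_road (orient n h) R = {c..d}" using truncated_road_interval by blast
  have sub: "{c..d} \<subseteq> road n h" using truncated_road_subset[OF assms(3), of n h] cd by simp
  show "set_borel_measurable lborel (truncated_road (orient n h) R) (\<rho>1 h t)"
    "set_borel_measurable lborel (truncated_road (orient n h) R) (\<rho>2 h t)"
    unfolding cd using tc assms sub by (auto intro!: integrable_set_borel_measurable simp: time_continuous_def)
qed

lemma slice_continuous:
  assumes h: "h \<in> {1..n+m}" and "0 \<le> T" "1 \<le> R"
  shows "((\<lambda>t. L1_dist (truncated_road (orient n h) R) (\<rho>1 h t) (\<rho>1 h T)) \<longlongrightarrow> 0) (at T within {0..})"
    "((\<lambda>t. L1_dist (truncated_road (orient n h) R) (\<rho>2 h t) (\<rho>2 h T)) \<longlongrightarrow> 0) (at T within {0..})"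
proof -
  obtain c d where cd: "truncated_road (orient n h) R = {c..d}" using truncated_road_interval by blast
  have sub: "{c..d} \<subseteq> road n h" using truncated_road_subset[OF assms(3), of n h] cd by simp
  show "((\<lambda>t. L1_dist (truncated_road (orient n h) R) (\<rho>1 h t) (\<rho>1 h T)) \<longlongrightarrow> 0) (at T within {0..})"
    "((\<lambda>t. L1_dist (truncated_road (orient n h) R) (\<rho>2 h t) (\<rho>2 h T)) \<longlongrightarrow> 0) (at T within {0..})"
    unfolding cd using tc h sub \<open>0 \<le> T\<close> unfolding time_continuous_def by blast+
qed

text \<open>On \<open>[1 / R, R]\<close> the weight is at least \<open>exp (- \<mu> R)\<close>. This
  loss and the Gronwall factor are collected in one exponent, which tends to 0 with
  \<open>\<mu>\<close> when \<open>R\<close> and \<open>t\<close> are fixed.\<close>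

lemma truncated_AE_le:
  assumes \<mu>: "0 < \<mu>" and R: "1 \<le> R"
  shows "AE t in lborel. t > 0 \<longrightarrow>
    (\<Sum>h\<in>{1..n+m}. L1_dist (truncated_road (orient n h) R) (\<rho>1 h t) (\<rho>2 h t))
      \<le> ennreal (exp (\<mu> * (real R + L * t))) * (\<Sum>h\<in>{1..n+m}. L1_dist (road n h) (\<rho>01 h) (\<rho>02 h))"
proof -
  have sec: "AE t in lborel. \<forall>h\<in>{1..n+m}. AE x in lborel. 0 < t \<and> orient n h * x \<in> road n h \<longrightarrow>
      \<rho>1 h t (orient n h * x) = U \<rho>1 h (t, x) \<and> \<rho>2 h t (orient n h * x) = U \<rho>2 h (t, x)"
  proof (rule AE_finite_allI)
    fix h assume h: "h \<in> {1..n+m}"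
    from AE_sections(1)[OF U_facts(3)[OF gs(1) h]] AE_sections(1)[OF U_facts(3)[OF gs(2) h]]
    show "AE t in lborel. AE x in lborel. 0 < t \<and> orient n h * x \<in> road n h \<longrightarrow>
      \<rho>1 h t (orient n h * x) = U \<rho>1 h (t, x) \<and> \<rho>2 h t (orient n h * x) = U \<rho>2 h (t, x)"
    proof eventually_elim
      case (elim t)
      then show ?case by eventually_elim simp
    qed
  qed simp
  from weighted_contraction[OF \<mu>] sec show ?thesis
  proof eventually_elim
    case (elim t)
    show ?case
    proof
      assume t: "0 < t"
      let ?D = "\<Sum>h\<in>{1..n+m}. L1_dist (road n h) (\<rho>01 h) (\<rho>02 h)"
      have one: "L1_dist (truncated_road (orient n h) R) (\<rho>1 h t) (\<rho>2 h t) \<le> ennreal (exp (\<mu> * real R)) * ennreal (weighted_dist \<mu> h t)"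
        if h: "h \<in> {1..n+m}" for h
      proof -
        note [measurable] = U_facts(1)[OF gs(1) h] U_facts(1)[OF gs(2) h]
        have R0: "0 < 1 / real R" using R by simp
        have "L1_dist (truncated_road (orient n h) R) (\<rho>1 h t) (\<rho>2 h t)
          = L1_dist {1 / real R..real R} (\<lambda>x. \<rho>1 h t (orient n h * x)) (\<lambda>x. \<rho>2 h t (orient n h * x))"
          using L1_dist_reflect[OF orient_cases(1)[of n h] slice_borel[OF h less_imp_le[OF t] R]]
          by (simp only: truncated_road_reflect[OF orient_cases(1)])
        also have "\<dots> = L1_dist {1 / real R..real R} (\<lambda>x. U \<rho>1 h (t, x)) (\<lambda>x. U \<rho>2 h (t, x))"
        proof (rule L1_dist_cong_AE)
          have r: "orient n h * x \<in> road n h" if "x \<in> {1 / real R..real R}" for x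
          proof -
            have "x \<in> {0<..}" using that R0 unfolding atLeastAtMost_iff greaterThan_iff by linarith
            then show ?thesis using orient_road(1)[of n h] by blast
          qed
          have e: "AE x in lborel. 0 < t \<and> orient n h * x \<in> road n h \<longrightarrow>
             \<rho>1 h t (orient n h * x) = U \<rho>1 h (t, x) \<and> \<rho>2 h t (orient n h * x) = U \<rho>2 h (t, x)"
            using elim(2) h by blast
          show "AE x in lborel. x \<in> {1 / real R..real R} \<longrightarrow> \<rho>1 h t (orient n h * x) = U \<rho>1 h (t, x)"
            using e by eventually_elim (use r t in blast)
          show "AE x in lborel. x \<in> {1 / real R..real R} \<longrightarrow> \<rho>2 h t (orient n h * x) = U \<rho>2 h (t, x)"
            using e by eventually_elim (use r t in blast)
        qed
        also have "\<dots> \<le> (\<integral>\<^sup>+x. ennreal (exp (\<mu> * real R)) * ennreal (\<bar>U \<rho>1 h (t, x) - U \<rho>2 h (t, x)\<bar> * weight \<mu> (-1) x) \<partial>lborel)"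
          unfolding L1_dist_def
        proof (rule nn_integral_mono)
          fix x
          show "ennreal \<bar>U \<rho>1 h (t, x) - U \<rho>2 h (t, x)\<bar> * indicator {1 / real R..real R} x
            \<le> ennreal (exp (\<mu> * real R)) * ennreal (\<bar>U \<rho>1 h (t, x) - U \<rho>2 h (t, x)\<bar> * weight \<mu> (-1) x)"
          proof (cases "x \<in> {1 / real R..real R}")
            case True
            then have x: "0 < x" "x \<le> real R" using R0 unfolding atLeastAtMost_iff by linarith+
            have "\<mu> * x \<le> \<mu> * real R" using x \<mu> by simp
            then have "1 \<le> exp (\<mu> * real R) * weight \<mu> (-1) x" using x by (simp add: weight_def flip: exp_add)
            from mult_left_mono[OF this abs_ge_zero[of "U \<rho>1 h (t, x) - U \<rho>2 h (t, x)"]]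
            have "\<bar>U \<rho>1 h (t, x) - U \<rho>2 h (t, x)\<bar> \<le> exp (\<mu> * real R) * (\<bar>U \<rho>1 h (t, x) - U \<rho>2 h (t, x)\<bar> * weight \<mu> (-1) x)"
              by (simp add: mult.left_commute)
            from ennreal_leI[OF this] show ?thesis using True by (simp add: ennreal_mult' weight_nonneg)
          qed simp
        qed
        also have "\<dots> = ennreal (exp (\<mu> * real R)) * (\<integral>\<^sup>+x. ennreal (\<bar>U \<rho>1 h (t, x) - U \<rho>2 h (t, x)\<bar> * weight \<mu> (-1) x) \<partial>lborel)"
          by (rule nn_integral_cmult) measurable
        also have "(\<integral>\<^sup>+x. ennreal (\<bar>U \<rho>1 h (t, x) - U \<rho>2 h (t, x)\<bar> * weight \<mu> (-1) x) \<partial>lborel) = ennreal (weighted_dist \<mu> h t)"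
          unfolding weighted_dist_def
          by (rule nn_integral_eq_integral[OF weighted_dist_integrable(1)[OF \<mu> h]]) (simp add: weight_nonneg)
        finally show ?thesis .
      qed
      have "(\<Sum>h\<in>{1..n+m}. L1_dist (truncated_road (orient n h) R) (\<rho>1 h t) (\<rho>2 h t))
         \<le> (\<Sum>h\<in>{1..n+m}. ennreal (exp (\<mu> * real R)) * ennreal (weighted_dist \<mu> h t))"
        by (rule sum_mono[OF one])
      also have "\<dots> = ennreal (exp (\<mu> * real R)) * ennreal (\<Sum>h\<in>{1..n+m}. weighted_dist \<mu> h t)"
      proof -
        have "(\<Sum>h\<in>{1..n+m}. ennreal (weighted_dist \<mu> h t)) = ennreal (\<Sum>h\<in>{1..n+m}. weighted_dist \<mu> h t)"
          by (rule sum_ennreal) (rule weighted_dist_integrable(3)[OF \<mu>])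
        then show ?thesis by (simp only: sum_distrib_left[symmetric])
      qed
      also have "\<dots> \<le> ennreal (exp (\<mu> * real R)) * ennreal (exp (L * \<mu> * t) * (\<Sum>h\<in>{1..n+m}. weighted_dist0 \<mu> h))"
        using elim(1) t by (intro mult_left_mono ennreal_leI) auto
      also have "\<dots> = ennreal (exp (\<mu> * (real R + L * t))) * ennreal (\<Sum>h\<in>{1..n+m}. weighted_dist0 \<mu> h)"
      proof -
        have "exp (\<mu> * (real R + L * t)) = exp (\<mu> * real R) * exp (L * \<mu> * t)"
          by (simp add: algebra_simps flip: exp_add)
        then show ?thesis by (simp only: ennreal_mult' exp_ge_zero mult.assoc)
      qed
      also have "\<dots> \<le> ennreal (exp (\<mu> * (real R + L * t))) * ?D"
      proof (rule mult_left_mono)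
        have "ennreal (\<Sum>h\<in>{1..n+m}. weighted_dist0 \<mu> h) = (\<Sum>h\<in>{1..n+m}. ennreal (weighted_dist0 \<mu> h))"
          by (rule sum_ennreal[symmetric]) (rule weighted_dist0_le(1)[OF \<mu>])
        also have "\<dots> \<le> ?D" by (rule sum_mono) (rule weighted_dist0_le(2)[OF \<mu>])
        finally show "ennreal (\<Sum>h\<in>{1..n+m}. weighted_dist0 \<mu> h) \<le> ?D" .
      qed simp
      finally show "(\<Sum>h\<in>{1..n+m}. L1_dist (truncated_road (orient n h) R) (\<rho>1 h t) (\<rho>2 h t))
        \<le> ennreal (exp (\<mu> * (real R + L * t))) * ?D" .
    qed
  qed
qed

text \<open>A good time \<open>t\<close> shortly after \<open>T\<close> is compared with
  \<open>T\<close> through continuity; \<open>T + 1\<close> bounds all such \<open>t\<close> in the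
  exponent.\<close>

lemma truncated_le:
  assumes \<mu>: "0 < \<mu>" and R: "1 \<le> R" and T: "0 \<le> T" and e: "0 < e"
  shows "(\<Sum>h\<in>{1..n+m}. L1_dist (truncated_road (orient n h) R) (\<rho>1 h T) (\<rho>2 h T))
      \<le> ennreal (exp (\<mu> * (real R + L * (T + 1)))) * (\<Sum>h\<in>{1..n+m}. L1_dist (road n h) (\<rho>01 h) (\<rho>02 h)) + ennreal e"
proof -
  let ?D = "\<Sum>h\<in>{1..n+m}. L1_dist (road n h) (\<rho>01 h) (\<rho>02 h)"
  let ?A = "\<lambda>h. truncated_road (orient n h) R"
  have "((\<lambda>t. \<Sum>h\<in>{1..n+m}. L1_dist (?A h) (\<rho>1 h t) (\<rho>1 h T) + L1_dist (?A h) (\<rho>2 h t) (\<rho>2 h T))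
      \<longlongrightarrow> (\<Sum>h\<in>{1..n+m}. 0 + 0)) (at T within {0..})"
    by (intro tendsto_sum tendsto_add slice_continuous T R)
  then have "((\<lambda>t. \<Sum>h\<in>{1..n+m}. L1_dist (?A h) (\<rho>1 h t) (\<rho>1 h T) + L1_dist (?A h) (\<rho>2 h t) (\<rho>2 h T)) \<longlongrightarrow> 0) (at T within {0..})"
    by simp
  from order_tendstoD(2)[OF this, of "ennreal e"] e
  obtain d where d: "0 < d" "\<And>t. t \<in> {0..} \<Longrightarrow> t \<noteq> T \<Longrightarrow> dist t T < d \<Longrightarrow>
      (\<Sum>h\<in>{1..n+m}. L1_dist (?A h) (\<rho>1 h t) (\<rho>1 h T) + L1_dist (?A h) (\<rho>2 h t) (\<rho>2 h T)) < ennreal e"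
    unfolding eventually_at by auto
  \<comment> \<open>Exceptional times cannot fill an interval of positive length. The interval lies
    after \<open>T\<close>, so that \<open>T = 0\<close> is included.\<close>
  have "\<exists>t. T < t \<and> t < T + min d 1 \<and> (\<Sum>h\<in>{1..n+m}. L1_dist (?A h) (\<rho>1 h t) (\<rho>2 h t)) \<le> ennreal (exp (\<mu> * (real R + L * t))) * ?D"
  proof (rule ccontr)
    assume neg: "\<not> ?thesis"
    from truncated_AE_le[OF \<mu> R] have "AE t in lborel. t \<notin> {T<..<T + min d 1}"
    proof eventually_elim
      case (elim t)
      show ?case
      proof
        assume "t \<in> {T<..<T + min d 1}"
        then show False using elim neg T by auto
      qed
    qed
    then have "emeasure lborel {T<..<T + min d 1} = 0"
      by (subst (asm) AE_iff_measurable[of "{T<..<T + min d 1}"]) auto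
    then show False using d(1) by simp
  qed
  then obtain t where t: "T < t" "t < T + min d 1"
    "(\<Sum>h\<in>{1..n+m}. L1_dist (?A h) (\<rho>1 h t) (\<rho>2 h t)) \<le> ennreal (exp (\<mu> * (real R + L * t))) * ?D" by blast
  have t0: "0 \<le> t" using t T by simp
  have tri: "L1_dist (?A h) (\<rho>1 h T) (\<rho>2 h T) \<le> L1_dist (?A h) (\<rho>1 h t) (\<rho>2 h t)
      + (L1_dist (?A h) (\<rho>1 h t) (\<rho>1 h T) + L1_dist (?A h) (\<rho>2 h t) (\<rho>2 h T))" if h: "h \<in> {1..n+m}" for h
  proof -
    note mT = slice_borel[OF h T R] and mt = slice_borel[OF h t0 R]
    have "L1_dist (?A h) (\<rho>1 h T) (\<rho>2 h T) \<le> L1_dist (?A h) (\<rho>1 h T) (\<rho>1 h t) + L1_dist (?A h) (\<rho>1 h t) (\<rho>2 h T)"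
      by (rule L1_dist_triangle[OF mT(1) mt(1) mT(2)])
    also have "\<dots> \<le> L1_dist (?A h) (\<rho>1 h T) (\<rho>1 h t) + (L1_dist (?A h) (\<rho>1 h t) (\<rho>2 h t) + L1_dist (?A h) (\<rho>2 h t) (\<rho>2 h T))"
      by (intro add_left_mono L1_dist_triangle[OF mt(1) mt(2) mT(2)])
    finally show ?thesis by (simp add: L1_dist_commute[of _ "\<rho>1 h T"] ac_simps)
  qed
  have "(\<Sum>h\<in>{1..n+m}. L1_dist (?A h) (\<rho>1 h T) (\<rho>2 h T)) \<le> (\<Sum>h\<in>{1..n+m}. L1_dist (?A h) (\<rho>1 h t) (\<rho>2 h t)
      + (L1_dist (?A h) (\<rho>1 h t) (\<rho>1 h T) + L1_dist (?A h) (\<rho>2 h t) (\<rho>2 h T)))"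
    by (rule sum_mono[OF tri])
  also have "\<dots> = (\<Sum>h\<in>{1..n+m}. L1_dist (?A h) (\<rho>1 h t) (\<rho>2 h t))
      + (\<Sum>h\<in>{1..n+m}. L1_dist (?A h) (\<rho>1 h t) (\<rho>1 h T) + L1_dist (?A h) (\<rho>2 h t) (\<rho>2 h T))"
    by (rule sum.distrib)
  also have "\<dots> \<le> ennreal (exp (\<mu> * (real R + L * (T + 1)))) * ?D + ennreal e"
  proof (rule add_mono)
    have "L * t \<le> L * (T + 1)" using t(2) L_nonneg by (intro mult_left_mono) auto
    then have "\<mu> * (real R + L * t) \<le> \<mu> * (real R + L * (T + 1))" using \<mu> by (intro mult_left_mono) auto
    then have "ennreal (exp (\<mu> * (real R + L * t))) * ?D \<le> ennreal (exp (\<mu> * (real R + L * (T + 1)))) * ?D"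
      by (intro mult_right_mono ennreal_leI) auto
    with t(3) show "(\<Sum>h\<in>{1..n+m}. L1_dist (?A h) (\<rho>1 h t) (\<rho>2 h t)) \<le> ennreal (exp (\<mu> * (real R + L * (T + 1)))) * ?D"
      by (rule order_trans)
    have "dist t T < d" using t(1,2) by (simp add: dist_real_def)
    then show "(\<Sum>h\<in>{1..n+m}. L1_dist (?A h) (\<rho>1 h t) (\<rho>1 h T) + L1_dist (?A h) (\<rho>2 h t) (\<rho>2 h T)) \<le> ennreal e"
      using d(2)[of t] t(1) t0 by (intro less_imp_le) auto
  qed
  finally show ?thesis .
qed

lemma truncated_le_data:
  assumes R: "1 \<le> R" and T: "0 \<le> T"
  shows "(\<Sum>h\<in>{1..n+m}. L1_dist (truncated_road (orient n h) R) (\<rho>1 h T) (\<rho>2 h T))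
      \<le> (\<Sum>h\<in>{1..n+m}. L1_dist (road n h) (\<rho>01 h) (\<rho>02 h))" (is "?X \<le> ?D")
proof (cases "?D = \<infinity>")
  case False
  then obtain r where r: "0 \<le> r" "?D = ennreal r" by (cases ?D) auto
  \<comment> \<open>\<open>\<mu>\<close> and the error \<open>e\<close> are sent to 0 together, both
    being \<open>inverse (Suc j)\<close>.\<close>
  have "(\<lambda>j. ennreal (exp (inverse (real (Suc j)) * (real R + L * (T + 1))) * r + inverse (real (Suc j))))
      \<longlonglongrightarrow> ennreal (exp (0 * (real R + L * (T + 1))) * r + 0)"
    by (intro tendsto_ennrealI tendsto_intros LIMSEQ_inverse_real_of_nat)
  moreover have "?X \<le> ennreal (exp (inverse (real (Suc j)) * (real R + L * (T + 1))) * r + inverse (real (Suc j)))" for j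
  proof -
    have "0 < inverse (real (Suc j))" by simp
    from truncated_le[OF this R T this] show ?thesis
      unfolding r(2) using r(1) by (simp add: ennreal_mult' ennreal_plus del: of_nat_Suc)
  qed
  ultimately have "?X \<le> ennreal (exp (0 * (real R + L * (T + 1))) * r + 0)"
    by (intro LIMSEQ_le_const) auto
  then show ?thesis unfolding r(2) by simp
next
  case True
  then show ?thesis by (simp only: infinity_ennreal_def top_greatest)
qed

lemma L1_contraction:
  assumes T: "0 \<le> T"
  shows "(\<Sum>h\<in>{1..n+m}. L1_dist (road n h) (\<rho>1 h T) (\<rho>2 h T))
      \<le> (\<Sum>h\<in>{1..n+m}. L1_dist (road n h) (\<rho>01 h) (\<rho>02 h))"
proof -
  have lim: "(\<lambda>j. L1_dist (truncated_road (orient n h) (Suc j)) (\<rho>1 h T) (\<rho>2 h T)) \<longlonglongrightarrow> L1_dist (road n h) (\<rho>1 h T) (\<rho>2 h T)"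
    if h: "h \<in> {1..n+m}" for h
    unfolding L1_dist_def
  proof (rule nn_integral_LIMSEQ)
    have mono: "truncated_road (orient n h) (Suc j) \<subseteq> truncated_road (orient n h) (Suc k)" if "j \<le> k" for j k
    proof -
      have "1 / real (Suc k) \<le> 1 / real (Suc j)" "real (Suc j) \<le> real (Suc k)" using that by (auto simp: frac_le)
      then show ?thesis unfolding truncated_road_def by (simp only: split: if_split) auto
    qed
    show "incseq (\<lambda>j x. ennreal \<bar>\<rho>1 h T x - \<rho>2 h T x\<bar> * indicator (truncated_road (orient n h) (Suc j)) x)"
    proof (intro monoI le_funI mult_left_mono)
      fix j k :: nat and x assume "j \<le> k"
      from mono[OF this]
      show "indicator (truncated_road (orient n h) (Suc j)) x \<le> (indicator (truncated_road (orient n h) (Suc k)) x :: ennreal)"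
        by (auto simp: indicator_def)
    qed simp
    show "(\<lambda>x. ennreal \<bar>\<rho>1 h T x - \<rho>2 h T x\<bar> * indicator (truncated_road (orient n h) (Suc j)) x) \<in> borel_measurable lborel" for j
      using L1_dist_borel[OF slice_borel[OF h T, of "Suc j"]] by simp
    fix x
    show "(\<lambda>j. ennreal \<bar>\<rho>1 h T x - \<rho>2 h T x\<bar> * indicator (truncated_road (orient n h) (Suc j)) x)
        \<longlonglongrightarrow> ennreal \<bar>\<rho>1 h T x - \<rho>2 h T x\<bar> * indicator (road n h) x"
    proof (cases "x \<in> road n h")
      case True
      \<comment> \<open>One index that bounds both \<open>\<bar>x\<bar>\<close> and its inverse, so
        that \<open>x\<close> is inside both ends of the truncated road.\<close>
      obtain N :: nat where N: "\<bar>x\<bar> + 1 / \<bar>x\<bar> \<le> real N" using real_arch_simple by blast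
      have x0: "0 < \<bar>x\<bar>" using True by (auto simp: road_def split: if_splits)
      have "x \<in> truncated_road (orient n h) (Suc j)" if "N \<le> j" for j
      proof -
        have j: "\<bar>x\<bar> + 1 / \<bar>x\<bar> \<le> real (Suc j)" using N that by simp
        moreover have "0 < 1 / \<bar>x\<bar>" using x0 by simp
        ultimately have "\<bar>x\<bar> \<le> real (Suc j)" "1 / \<bar>x\<bar> \<le> real (Suc j)" using x0 by linarith+
        moreover from this(2) have "1 / real (Suc j) \<le> \<bar>x\<bar>" using x0 by (simp add: field_simps del: of_nat_Suc)
        ultimately show ?thesis
          using True unfolding truncated_road_def orient_def road_def by (auto split: if_splits simp del: of_nat_Suc)
      qed
      then have "eventually (\<lambda>j. ennreal \<bar>\<rho>1 h T x - \<rho>2 h T x\<bar> * indicator (truncated_road (orient n h) (Suc j)) x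
         = ennreal \<bar>\<rho>1 h T x - \<rho>2 h T x\<bar> * indicator (road n h) x) sequentially"
        using True unfolding eventually_sequentially by (intro exI[of _ N]) simp
      then show ?thesis by (rule tendsto_eventually)
    next
      case False
      then have "x \<notin> truncated_road (orient n h) (Suc j)" for j using truncated_road_subset[of "Suc j" n h] by auto
      then show ?thesis using False by simp
    qed
  qed
  have "(\<lambda>j. \<Sum>h\<in>{1..n+m}. L1_dist (truncated_road (orient n h) (Suc j)) (\<rho>1 h T) (\<rho>2 h T))
      \<longlonglongrightarrow> (\<Sum>h\<in>{1..n+m}. L1_dist (road n h) (\<rho>1 h T) (\<rho>2 h T))"
    by (intro tendsto_sum lim)
  then show ?thesis
    by (rule LIMSEQ_le_const2) (use truncated_le_data[OF _ T] in auto)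
qed

end

end

end

theorem proposition10:
  fixes n m :: nat
    and a b :: "nat \<Rightarrow> real"
    and f \<eta>hat :: "nat \<Rightarrow> real \<Rightarrow> real"
    and \<P> :: "real \<Rightarrow> nat \<Rightarrow> real \<Rightarrow> real"
  assumes "n \<ge> 1" and "m \<ge> 1"
    and "\<And>h. h \<in> {1..n+m} \<Longrightarrow> a h \<le> b h"
    and "\<And>h u. h \<in> {1..n+m} \<Longrightarrow> u \<in> {a h..b h} \<Longrightarrow> f h u \<ge> 0"
    and "\<And>h u. h \<in> {1..n+m} \<Longrightarrow> u \<notin> {a h..b h} \<Longrightarrow> f h u = 0"
    and "\<And>h. h \<in> {1..n+m} \<Longrightarrow> \<exists>L. L-lipschitz_on {a h..b h} (f h)"
    and "\<And>h. h \<in> {1..n+m} \<Longrightarrow> concave_on {a h..b h} (f h)"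
    and "\<And>h. h \<in> {1..n+m} \<Longrightarrow> f h (a h) = 0 \<and> f h (b h) = 0"
    and "(\<Sum>i=1..n. f i 0) - (\<Sum>j=n+1..n+m. f j 0) = 0"
    and "\<And>h. h \<in> {1..n+m} \<Longrightarrow> convex_on UNIV (\<eta>hat h)"
    and "priority_functions (n+m) a b \<eta>hat \<P>"
  shows
    "(\<forall>\<rho>0 \<rho>1 \<rho>2.
        initial_data n m a b \<rho>0 \<longrightarrow>
        generalized_solution n m a b f \<P> \<rho>0 \<rho>1 \<longrightarrow>
        generalized_solution n m a b f \<P> \<rho>0 \<rho>2 \<longrightarrow>
        (\<forall>h\<in>{1..n+m}. AE (t, x) in lborel. t > 0 \<and> x \<in> road n h \<longrightarrow> \<rho>1 h t x = \<rho>2 h t x)) \<and>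
     (\<forall>\<rho>01 \<rho>02 \<rho>1 \<rho>2.
        initial_data n m a b \<rho>01 \<longrightarrow> initial_data n m a b \<rho>02 \<longrightarrow>
        generalized_solution n m a b f \<P> \<rho>01 \<rho>1 \<longrightarrow> time_continuous n m \<rho>1 \<longrightarrow>
        generalized_solution n m a b f \<P> \<rho>02 \<rho>2 \<longrightarrow> time_continuous n m \<rho>2 \<longrightarrow>
        (\<forall>T\<ge>0. (\<Sum>h=1..n+m. L1_dist (road n h) (\<rho>1 h T) (\<rho>2 h T))
              \<le> (\<Sum>h=1..n+m. L1_dist (road n h) (\<rho>01 h) (\<rho>02 h))))"
proof -
  interpret junction n m a b f \<eta>hat \<P>
    by unfold_locales (fact assms)+
  obtain L where L: "0 \<le> L" "\<And>h. h \<in> {1..n+m} \<Longrightarrow> L-lipschitz_on UNIV (f h)"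
    using common_lipschitz by blast
  show ?thesis
  proof (intro conjI allI impI ballI)
    fix \<rho>0 \<rho>1 \<rho>2 h
    assume "initial_data n m a b \<rho>0" "generalized_solution n m a b f \<P> \<rho>0 \<rho>1"
      "generalized_solution n m a b f \<P> \<rho>0 \<rho>2" "h \<in> {1..n+m}"
    then show "AE (t, x) in lborel. t > 0 \<and> x \<in> road n h \<longrightarrow> \<rho>1 h t x = \<rho>2 h t x"
      by (intro solutions_unique[OF _ _ _ _ L(2) L(1)]) auto
  next
    fix \<rho>01 \<rho>02 \<rho>1 \<rho>2 and T :: real
    assume "initial_data n m a b \<rho>01" "initial_data n m a b \<rho>02"
      "generalized_solution n m a b f \<P> \<rho>01 \<rho>1" "time_continuous n m \<rho>1"
      "generalized_solution n m a b f \<P> \<rho>02 \<rho>2" "time_continuous n m \<rho>2" "0 \<le> T"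
    then show "(\<Sum>h=1..n+m. L1_dist (road n h) (\<rho>1 h T) (\<rho>2 h T)) \<le> (\<Sum>h=1..n+m. L1_dist (road n h) (\<rho>01 h) (\<rho>02 h))"
      by (intro L1_contraction[OF _ _ _ _ L(2) L(1)])
  qed
qed

end
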